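(* Let $\kappa$ be a twice continuously differentiable kernel. Let $\mathcal{F}_\Phi=\{\Phi(Z): Z\in\Omega\}$, where $\Phi(Z)=\kappa(\cdot,Z)$ is the feature map of $\kappa$; i.e. $f\in\mathcal{F}_\Phi$ if $f(X)=\kappa(X,Z)$ for some $Z\in\Omega$. Suppose $(\mathbf{X}_n,\mathbf{A}_n)\sim\mathrm{RDPG}(F)$, $n=1,2,\dots$, is a sequence of $d$-dimensional random dot product graphs, the $n$-th on $n$ vertices, and the latent position distribution $F$ on $\Omega\subset\mathbb{R}^d$ satisfies the distinct eigenvalues condition: the second moment matrix $\mathbb{E}_{X\sim F}[XX^\top]$ (of rank $d$) has $d$ distinct eigenvalues, and $d$ is known. Denote by $\mathbf{W}_n$ the orthogonal matrix in the eigendecomposition $\mathbf{W}_n\mathbf{S}_n\mathbf{W}_n^\top=\mathbf{X}_n^\top\mathbf{X}_n$. Then, as $n\to\infty$, the sequence $\mathbf{W}_n$ satisfies $$\sup_{f\in\mathcal{F}_\Phi}\Bigl|\frac{1}{\sqrt n}\sum_{i=1}^n\bigl(f(\mathbf{W}_n\hat X_i)-f(X_i)\bigr)\Bigr|\longrightarrow 0\quad\text{almost surely,}$$ where $X_1,\dots,X_n$ are the rows of $\mathbf{X}_n$ and $\hat{\mathbf{X}}_n=\{\hat X_i\}_{i=1}^n$ is the adjacency spectral embedding of $\mathbf{A}_n$ into $\mathbb{R}^d$.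
   Context: Random dot product graph: $\Omega\subset\mathbb{R}^d$ is compact and $\langle\omega_1,\omega_2\rangle\in[0,1]$ for all $\omega_1,\omega_2\in\Omega$. For a probability distribution $F$ on $\Omega$, $(\mathbf{X},\mathbf{A})\sim\mathrm{RDPG}(F)$ on $n$ vertices means that $\mathbf{X}=[X_1,\dots,X_n]^\top$ is $n\times d$ with rows $X_i$ i.i.d. from $F$ (the latent positions), and, given $\mathbf{X}$, $\mathbf{A}$ is a random symmetric $n\times n$ adjacency matrix with $\mathbb{P}[\mathbf{A}\mid\{X_i\}]=\prod_{i<j}(X_i^\top X_j)^{\mathbf{A}_{ij}}(1-X_i^\top X_j)^{1-\mathbf{A}_{ij}}$. Rows $X_i$, $\hat X_i$ are regarded as column vectors in $\mathbb{R}^d$ in expressions such as $\mathbf{W}_n\hat X_i$. Adjacency spectral embedding: let $|\mathbf{A}|=(\mathbf{A}^\top\mathbf{A})^{1/2}=\sum_{i=1}^n\lambda_i u_iu_i^\top$ be an eigendecomposition with $\lambda_1\ge\dots\ge\lambda_n$; put $\mathbf{S}_{\mathbf{A}}=\mathrm{diag}(\lambda_1,\dots,\lambda_d)$ and $\mathbf{U}_{\mathbf{A}}=[u_1,\dots,u_d]$. The embedding of $\mathbf{A}$ into $\mathbb{R}^d$ ($d\le n$) is $\hat{\mathbf{X}}=\mathbf{U}_{\mathbf{A}}\mathbf{S}_{\mathbf{A}}^{1/2}\in\mathbb{R}^{n\times d}$, with rows $\hat X_i$. Kernel: a kernel $\kappa$ is a continuous, symmetric, positive definite function of two arguments.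
   Formalization: Eigenvectors are fixed only up to sign and order, and the claim fails for mismatched choices (d=1, W_n=-1); so the eigenvalues in S_n are taken in decreasing order and each column of the embedding is assumed to have nonnegative inner product with the same column of X_n W_n. *)

theory Defs
  imports "HOL-Probability.Probability" "Jordan_Normal_Form.Matrix"
begin

(* The order n of the graphs varies, so n x n matrices are elements of the type 'a mat with
   explicit dimensions; the dimension d of the latent space is fixed, so latent positions lie in
   real ^ 'd. The symbols for vector components and inner products refer to real ^ 'd. *)
no_notation Matrix.vec_index (infixl \<open>$\<close> 100)
no_notation Matrix.scalar_prod (infix \<open>\<bullet>\<close> 70)

definition twice_continuously_differentiable :: "('a::real_normed_vector \<Rightarrow> real) \<Rightarrow> bool" where
  "twice_continuously_differentiable f \<longleftrightarrow>
     (\<exists>(f' :: 'a \<Rightarrow> 'a \<Rightarrow>\<^sub>L real) (f'' :: 'a \<Rightarrow> 'a \<Rightarrow>\<^sub>L ('a \<Rightarrow>\<^sub>L real)).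
        (\<forall>x. (f has_derivative blinfun_apply (f' x)) (at x)) \<and>
        (\<forall>x. (f' has_derivative blinfun_apply (f'' x)) (at x)) \<and>
        continuous_on UNIV f'')"

(* Positive definiteness in the sense of reproducing kernels: Gram matrices of finitely many
   distinct points are positive semidefinite. *)
definition pd_kernel :: "('a::topological_space \<Rightarrow> 'a \<Rightarrow> real) \<Rightarrow> bool" where
  "pd_kernel \<kappa> \<longleftrightarrow>
     continuous_on UNIV (\<lambda>(x, y). \<kappa> x y) \<and>
     (\<forall>x y. \<kappa> x y = \<kappa> y x) \<and>
     (\<forall>S c. finite S \<longrightarrow> 0 \<le> (\<Sum>x\<in>S. \<Sum>y\<in>S. c x * c y * \<kappa> x y))"

definition feature_map :: "('a \<Rightarrow> 'a \<Rightarrow> real) \<Rightarrow> 'a \<Rightarrow> ('a \<Rightarrow> real)" where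
  "feature_map \<kappa> z = (\<lambda>x. \<kappa> x z)"

definition feature_class :: "('a \<Rightarrow> 'a \<Rightarrow> real) \<Rightarrow> 'a set \<Rightarrow> ('a \<Rightarrow> real) set" where
  "feature_class \<kappa> \<Omega> = feature_map \<kappa> ` \<Omega>"

definition latent_space :: "(real ^ 'd) set \<Rightarrow> bool" where
  "latent_space \<Omega> \<longleftrightarrow> compact \<Omega> \<and> (\<forall>x\<in>\<Omega>. \<forall>y\<in>\<Omega>. 0 \<le> x \<bullet> y \<and> x \<bullet> y \<le> 1)"

definition latent_distribution :: "(real ^ 'd) set \<Rightarrow> (real ^ 'd) measure \<Rightarrow> bool" where
  "latent_distribution \<Omega> F \<longleftrightarrow> prob_space F \<and> sets F = sets borel \<and> (AE x in F. x \<in> \<Omega>)"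

definition second_moment_matrix :: "(real ^ 'd) measure \<Rightarrow> real ^ 'd ^ 'd" where
  "second_moment_matrix F = (\<chi> k l. \<integral>x. x $ k * x $ l \<partial>F)"

definition distinct_eigenvalues_condition :: "(real ^ 'd) measure \<Rightarrow> bool" where
  "distinct_eigenvalues_condition F \<longleftrightarrow>
     rank (second_moment_matrix F) = CARD('d) \<and>
     card {\<mu>::real. \<exists>v. v \<noteq> 0 \<and> second_moment_matrix F *v v = \<mu> *\<^sub>R v} = CARD('d)"

definition adjacency_matrices :: "nat \<Rightarrow> real mat set" where
  "adjacency_matrices n = {a \<in> carrier_mat n n.
     (\<forall>i<n. \<forall>j<n. a $$ (i, j) \<in> {0, 1} \<and> a $$ (i, j) = a $$ (j, i)) \<and> (\<forall>i<n. a $$ (i, i) = 0)}"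

(* The factor p^a (1 - p)^(1 - a), with a = 0 or a = 1, is written as a case distinction. *)
definition edge_likelihood :: "nat \<Rightarrow> (nat \<Rightarrow> real ^ 'd) \<Rightarrow> real mat \<Rightarrow> real" where
  "edge_likelihood n x a =
     (\<Prod>j<n. \<Prod>i<j. if a $$ (i, j) = 1 then x i \<bullet> x j else 1 - x i \<bullet> x j)"

(* The conditional law of the adjacency matrix is given through conditional expectations with
   respect to the sigma-algebra generated by the latent positions with indices below n. *)
definition rdpg ::
  "nat \<Rightarrow> (real ^ 'd) measure \<Rightarrow> 'w measure \<Rightarrow> ('w \<Rightarrow> nat \<Rightarrow> real ^ 'd) \<Rightarrow> ('w \<Rightarrow> real mat) \<Rightarrow> bool" where
  "rdpg n F M X A \<longleftrightarrow>
     prob_space.indep_vars M (\<lambda>_. borel) (\<lambda>i \<omega>. X \<omega> i) {..<n} \<and>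
     (\<forall>i<n. distr M borel (\<lambda>\<omega>. X \<omega> i) = F) \<and>
     (\<forall>\<omega>\<in>space M. A \<omega> \<in> adjacency_matrices n) \<and>
     (\<forall>i<n. \<forall>j<n. (\<lambda>\<omega>. A \<omega> $$ (i, j)) \<in> borel_measurable M) \<and>
     (\<forall>a\<in>adjacency_matrices n. AE \<omega> in M.
        real_cond_exp M
          (vimage_algebra (space M) (\<lambda>\<omega>. \<lambda>i\<in>{..<n}. X \<omega> i) (Pi\<^sub>M {..<n} (\<lambda>_. borel)))
          (indicator {\<omega>' \<in> space M. A \<omega>' = a}) \<omega>
        = edge_likelihood n (X \<omega>) a)"

(* B is the positive semidefinite square root of the matrix A^T A. *)
definition is_abs_mat :: "nat \<Rightarrow> real mat \<Rightarrow> real mat \<Rightarrow> bool" where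
  "is_abs_mat n A B \<longleftrightarrow>
     B \<in> carrier_mat n n \<and> transpose_mat B = B \<and>
     (\<forall>v\<in>carrier_vec n. 0 \<le> scalar_prod v (B *\<^sub>v v)) \<and>
     B * B = transpose_mat A * A"

(* Columns of n x d matrices are indexed by the type 'd; pos numbers them from 0 to d - 1.
   An embedding is determined only up to the choice of the eigenvectors (column k of U is the
   eigenvector for lam k, counted from 0), hence a relation. It is meant for n at least d. *)
definition is_ase ::
  "('d::finite \<Rightarrow> nat) \<Rightarrow> nat \<Rightarrow> real mat \<Rightarrow> (nat \<Rightarrow> real ^ 'd) \<Rightarrow> bool" where
  "is_ase pos n A Xhat \<longleftrightarrow>
     (\<exists>B U lam. is_abs_mat n A B \<and>
        U \<in> carrier_mat n n \<and> transpose_mat U * U = 1\<^sub>m n \<and>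
        B = U * mat_diag n lam * transpose_mat U \<and>
        (\<forall>i j. i \<le> j \<and> j < n \<longrightarrow> lam j \<le> lam i) \<and>
        (\<forall>i<n. Xhat i = (\<chi> k. U $$ (i, pos k) * sqrt (lam (pos k)))))"

(* X^T X for the n x d matrix X with rows x 0, ..., x (n - 1). *)
definition gram_matrix :: "nat \<Rightarrow> (nat \<Rightarrow> real ^ 'd) \<Rightarrow> real ^ 'd ^ 'd" where
  "gram_matrix n x = (\<chi> k l. \<Sum>i<n. x i $ k * x i $ l)"

definition is_ordered_eigendecomposition ::
  "('d::finite \<Rightarrow> nat) \<Rightarrow> real ^ 'd ^ 'd \<Rightarrow> real ^ 'd ^ 'd \<Rightarrow> bool" where
  "is_ordered_eigendecomposition pos W G \<longleftrightarrow>
     orthogonal_matrix W \<and>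
     (\<exists>s :: real ^ 'd.
        W ** (\<chi> k l. if k = l then s $ k else 0) ** Finite_Cartesian_Product.transpose W = G \<and>
        (\<forall>k l. pos k \<le> pos l \<longrightarrow> s $ l \<le> s $ k))"

(* Eigenvectors are determined only up to sign, and the signs chosen for the embedding and for W
   have to be compatible (already for d = 1, where W is 1 or -1). Convention: every column of the
   embedding has a nonnegative inner product with the same column of X W, whose rows are W^T x i;
   that is, the diagonal entries of Xhat^T X W are nonnegative. *)
definition sign_compatible ::
  "nat \<Rightarrow> (nat \<Rightarrow> real ^ 'd) \<Rightarrow> (nat \<Rightarrow> real ^ 'd) \<Rightarrow> real ^ 'd ^ 'd \<Rightarrow> bool" where
  "sign_compatible n Xhat x W \<longleftrightarrow>
     (\<forall>k. 0 \<le> (\<Sum>i<n. Xhat i $ k * (Finite_Cartesian_Product.transpose W *v x i) $ k))"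

end

theory Submission
  imports Defs "HOL-Real_Asymp.Real_Asymp"
begin

text \<open>Put \<open>P = X X\<^sup>T\<close>, \<open>B = A - P\<close>, \<open>Y = X W\<close> and write \<open>y\<^sub>k\<close>, \<open>s\<^sub>k\<close> for the columns of \<open>Y\<close> and their
  squared norms. Since the eigenvalues of \<open>X\<^sup>T X\<close> are separated by gaps of order \<open>n\<close>, the \<open>k\<close>-th column of the
  embedding is \<open>y\<^sub>k + B y\<^sub>k / s\<^sub>k\<close> up to an error whose norm tends to \<open>0\<close>. In the Taylor expansion of
  \<open>\<kappa>(\<cdot>, z)\<close> at the latent positions the quadratic term is then negligible, and the linear term is
  governed by bilinear forms of the noise \<open>B\<close> whose coefficients \<open>\<nabla>\<kappa>(X\<^sub>i, z)\<close> and \<open>X\<^sub>j\<close> depend on the latent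
  positions only. Conditionally on \<open>X\<close> the entries of \<open>B\<close> are independent, so by Hoeffding's inequality
  such a form is \<open>o(n\<^bsup>3/2\<^esup>)\<close> for each \<open>z\<close>. Hoeffding's inequality with a union bound over sign vectors
  shows that the cut norm of \<open>B\<close> is \<open>O(n\<^bsup>3/2\<^esup>)\<close>. The cut norm makes the forms equicontinuous in \<open>z\<close>, so that a
  countable dense set of \<open>z\<close> suffices, and it bounds the fourth Schatten norm of \<open>B\<close>, so that the operator
  norm of \<open>B\<close> is \<open>O(n\<^bsup>7/8\<^esup>)\<close>, which is all the perturbation argument needs.\<close>

subsection \<open>Perturbation of singular values and eigenvectors\<close>

text \<open>The expansion moves all dependence on \<open>A\<close> into forms that are linear in the
  noise; the rotation, which varies with the sample, is pulled out of them as coefficients bounded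
  by 1. After multiplication by sqrt n every error has to vanish. With \<open>B\<close> divided by
  n, the operator norm is of order e = n^(-1/8), and an error of order e^2 would be too large. What
  helps is that \<open>B\<close> meets essentially only the d vectors y_k, on which it has norm of
  order \<beta> = n^(-7/16) by concentration row by row. The errors are then of order \<beta>^2 and
  e \<beta>, both o(n^(-1/2)). The graphs have no loops, so the diagonal of \<open>B\<close> is not
  centred; it costs O(n) in a form, which is below n^(3/2). Embedding and rotation are arbitrary
  choices for each sample point and need not be measurable. Hence all events concern
  \<open>X\<close> and \<open>A\<close> only, and everything after them is deterministic. Nothing
  links graphs of different orders, so all limits come from summable tails.\<close>

lemma homogeneous_system_nontrivial:
  fixes f :: "nat \<Rightarrow> nat \<Rightarrow> 'a::field"
  shows "\<exists>c. (\<exists>i\<le>k. c i \<noteq> 0) \<and> (\<forall>r<k. (\<Sum>i\<le>k. c i * f r i) = 0)"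
proof (induction k arbitrary: f)
  case 0
  show ?case by (rule exI[of _ "\<lambda>_. 1"]) auto
next
  case (Suc k)
  show ?case
  proof (cases "\<exists>r<Suc k. f r (Suc k) \<noteq> 0")
    case False
    then show ?thesis
      by (intro exI[of _ "\<lambda>i. if i = Suc k then 1 else 0"]) (auto simp: if_distrib cong: if_cong)
  next
    case True
    then obtain r0 where r0: "r0 < Suc k" "f r0 (Suc k) \<noteq> 0" by blast
    \<comment> \<open>Gaussian elimination with pivot \<open>p\<close> in the last unknown of row
      \<open>r0\<close>. The family \<open>g\<close> lists the other rows, row \<open>k\<close>
      taking the slot of \<open>r0\<close>. The induction hypothesis solves the reduced rows, and
      the pivot row then fixes the last unknown as \<open>- t / p\<close>.\<close>
    define g where "g r = f (if r = r0 then k else r)" for r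
    define p where "p = f r0 (Suc k)"
    obtain c where c: "\<exists>i\<le>k. c i \<noteq> 0"
      "\<And>r. r < k \<Longrightarrow> (\<Sum>i\<le>k. c i * (g r i - g r (Suc k) / p * f r0 i)) = 0"
      using Suc.IH[of "\<lambda>r i. g r i - g r (Suc k) / p * f r0 i"] by blast
    define t where "t = (\<Sum>i\<le>k. c i * f r0 i)"
    define c' where "c' i = (if i = Suc k then - t / p else c i)" for i
    have sum': "(\<Sum>i\<le>Suc k. c' i * q i) = (\<Sum>i\<le>k. c i * q i) - t / p * q (Suc k)" for q
    proof -
      have "(\<Sum>i\<le>k. c' i * q i) = (\<Sum>i\<le>k. c i * q i)"
        by (intro sum.cong) (auto simp: c'_def)
      then show ?thesis unfolding sum.atMost_Suc by (simp add: c'_def)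
    qed
    have g: "(\<Sum>i\<le>Suc k. c' i * g r i) = 0" if "r < k" for r
    proof -
      have "0 = (\<Sum>i\<le>k. c i * g r i - g r (Suc k) / p * (c i * f r0 i))"
        using c(2)[OF that] by (simp add: algebra_simps)
      also have "\<dots> = (\<Sum>i\<le>k. c i * g r i) - g r (Suc k) / p * t"
        by (simp add: sum_subtractf t_def sum_distrib_left)
      finally show ?thesis unfolding sum' by (simp add: field_simps)
    qed
    have f0: "(\<Sum>i\<le>Suc k. c' i * f r0 i) = 0"
      using r0 by (subst sum') (simp add: p_def t_def)
    have "(\<Sum>i\<le>Suc k. c' i * f r i) = 0" if "r < Suc k" for r
    proof (cases "r = r0")
      case True
      then show ?thesis using f0 by simp
    next
      case False
      show ?thesis
      proof (cases "r = k")
        case True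
        then have "f r = g r0" "r0 < k" using False r0 by (auto simp: g_def)
        then show ?thesis using g by simp
      next
        case False
        then show ?thesis using g[of r] \<open>r \<noteq> r0\<close> that by (simp add: g_def)
      qed
    qed
    moreover have "\<exists>i\<le>Suc k. c' i \<noteq> 0"
    proof -
      obtain i where "i \<le> k" "c i \<noteq> 0" using c(1) by blast
      then have "i \<le> Suc k \<and> c' i \<noteq> 0" by (simp add: c'_def)
      then show ?thesis by blast
    qed
    ultimately show ?thesis by blast
  qed
qed

lemma Bessel_inequality:
  fixes h :: "nat \<Rightarrow> 'v::real_inner"
  assumes h: "\<And>i j. i < m \<Longrightarrow> j < m \<Longrightarrow> h i \<bullet> h j = (if i = j then 1 else 0)"
  shows "(\<Sum>l<m. (h l \<bullet> v)\<^sup>2) \<le> (norm v)\<^sup>2"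
proof -
  define w where "w = (\<Sum>l<m. (h l \<bullet> v) *\<^sub>R h l)"
  have hw: "h l \<bullet> w = h l \<bullet> v" if "l < m" for l
    using that by (simp add: w_def inner_sum_right h if_distrib cong: if_cong)
  have wv: "w \<bullet> v = (\<Sum>l<m. (h l \<bullet> v)\<^sup>2)"
    by (simp add: w_def inner_sum_left power2_eq_square)
  have ww: "w \<bullet> w = (\<Sum>l<m. (h l \<bullet> v)\<^sup>2)"
    by (subst (1) w_def) (simp add: inner_sum_left hw power2_eq_square)
  have "0 \<le> (v - w) \<bullet> (v - w)" by simp
  also have "\<dots> = v \<bullet> v - w \<bullet> v - w \<bullet> v + w \<bullet> w"
    by (simp add: inner_diff_left inner_diff_right inner_commute)
  finally show ?thesis by (simp add: wv ww power2_norm_eq_inner)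
qed

text \<open>Weyl's inequality for singular values: some nonzero combination of the first \<open>j + 1\<close>
  singular vectors of \<open>A\<close> is orthogonal to the first \<open>j\<close> singular vectors of \<open>P\<close>.\<close>

lemma singular_value_le:
  fixes A P :: "'v::real_inner \<Rightarrow> 'v" and u h :: "nat \<Rightarrow> 'v" and a b :: "nat \<Rightarrow> real"
  assumes u: "\<And>i j. i < n \<Longrightarrow> j < n \<Longrightarrow> u i \<bullet> u j = (if i = j then 1 else 0)"
    and A: "\<And>v. (norm (A v))\<^sup>2 = (\<Sum>j<n. (a j)\<^sup>2 * (u j \<bullet> v)\<^sup>2)"
    and a0: "\<And>i. i < n \<Longrightarrow> 0 \<le> a i" and adec: "\<And>i j. i \<le> j \<Longrightarrow> j < n \<Longrightarrow> a j \<le> a i"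
    and h: "\<And>i j. i < m \<Longrightarrow> j < m \<Longrightarrow> h i \<bullet> h j = (if i = j then 1 else 0)"
    and P: "\<And>v. (norm (P v))\<^sup>2 = (\<Sum>j<m. (b j)\<^sup>2 * (h j \<bullet> v)\<^sup>2)"
    and b0: "\<And>i. i < m \<Longrightarrow> 0 \<le> b i" and bdec: "\<And>i j. i \<le> j \<Longrightarrow> j < m \<Longrightarrow> b j \<le> b i"
    and close: "\<And>v. norm (A v - P v) \<le> e * norm v"
    and j: "j < n" "j < m"
  shows "a j \<le> b j + e"
proof -
  obtain c where c: "\<exists>i\<le>j. c i \<noteq> 0" "\<And>r. r < j \<Longrightarrow> (\<Sum>i\<le>j. c i * (h r \<bullet> u i)) = 0"
    using homogeneous_system_nontrivial[of j "\<lambda>r i. h r \<bullet> u i"] by blast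
  define v where "v = (\<Sum>i\<le>j. c i *\<^sub>R u i)"
  have hv: "h r \<bullet> v = 0" if "r < j" for r
    using c(2)[OF that] by (simp add: v_def inner_sum_right)
  have uv: "u i \<bullet> v = (if i \<le> j then c i else 0)" if "i < n" for i
    using that j by (simp add: v_def inner_sum_right u if_distrib cong: if_cong)
  have nv: "(norm v)\<^sup>2 = (\<Sum>i\<le>j. (c i)\<^sup>2)"
  proof -
    have "(norm v)\<^sup>2 = (\<Sum>i\<le>j. c i * (u i \<bullet> v))"
      by (simp only: power2_norm_eq_inner) (subst (1) v_def, simp add: inner_sum_left)
    also have "\<dots> = (\<Sum>i\<le>j. (c i)\<^sup>2)"
      using j by (intro sum.cong) (auto simp: uv power2_eq_square)
    finally show ?thesis .
  qed
  have "(norm v)\<^sup>2 > 0"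
  proof -
    obtain i where "i \<le> j" "c i \<noteq> 0" using c(1) by blast
    then show ?thesis unfolding nv by (intro sum_pos2[of _ i]) auto
  qed
  then have v0: "norm v > 0" by auto
  \<comment> \<open>On the span of \<open>u 0\<close>, ..., \<open>u j\<close> the map
    \<open>A\<close> stretches by at least \<open>a j\<close>; on the orthogonal complement of the
    earlier \<open>h r\<close> the map \<open>P\<close> stretches by at most
    \<open>b j\<close>.\<close>
  have "(a j * norm v)\<^sup>2 = (\<Sum>i\<le>j. (a j)\<^sup>2 * (c i)\<^sup>2)"
    by (simp add: power_mult_distrib nv sum_distrib_left)
  also have "\<dots> \<le> (\<Sum>i\<le>j. (a i)\<^sup>2 * (c i)\<^sup>2)"
    using j a0 adec by (intro sum_mono mult_right_mono power_mono) auto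
  also have "\<dots> = (\<Sum>i\<le>j. (a i)\<^sup>2 * (u i \<bullet> v)\<^sup>2)"
    using j by (intro sum.cong) (auto simp: uv)
  also have "\<dots> \<le> (norm (A v))\<^sup>2"
    unfolding A using j by (intro sum_mono2) auto
  finally have 1: "a j * norm v \<le> norm (A v)"
    by (rule power2_le_imp_le) simp
  have "(norm (P v))\<^sup>2 \<le> (\<Sum>i<m. (b j)\<^sup>2 * (h i \<bullet> v)\<^sup>2)"
    unfolding P
  proof (intro sum_mono)
    fix i assume "i \<in> {..<m}"
    then show "(b i)\<^sup>2 * (h i \<bullet> v)\<^sup>2 \<le> (b j)\<^sup>2 * (h i \<bullet> v)\<^sup>2"
      using hv[of i] b0 bdec[of j i] j
      by (cases "i < j") (auto intro!: mult_right_mono power_mono)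
  qed
  also have "\<dots> = (b j)\<^sup>2 * (\<Sum>i<m. (h i \<bullet> v)\<^sup>2)"
    by (simp add: sum_distrib_left)
  also have "\<dots> \<le> (b j)\<^sup>2 * (norm v)\<^sup>2"
    by (intro mult_left_mono Bessel_inequality h) auto
  finally have "(norm (P v))\<^sup>2 \<le> (b j * norm v)\<^sup>2" by (simp add: power_mult_distrib)
  then have 2: "norm (P v) \<le> b j * norm v"
    using b0 j by (auto intro: power2_le_imp_le)
  have "norm (A v) \<le> norm (P v) + norm (A v - P v)"
    using norm_triangle_ineq[of "P v" "A v - P v"] by simp
  with 1 2 close[of v] have "a j * norm v \<le> (b j + e) * norm v"
    by (simp add: distrib_right)
  with v0 show ?thesis by simp
qed

text \<open>The alternative \<open>A u = - \<mu> u\<close> is excluded because \<open>A\<close> is close to a positive operator.\<close>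

lemma eigenvector_of_square:
  fixes A P B :: "'v::real_inner \<Rightarrow> 'v"
  assumes "linear A" "\<And>v. A v = P v + B v" "\<And>v. 0 \<le> P v \<bullet> v"
    and B: "\<And>v. norm (B v) \<le> e * norm v" and "e < \<mu>"
    and sq: "A (A u) = \<mu>\<^sup>2 *\<^sub>R u"
  shows "A u = \<mu> *\<^sub>R u"
proof -
  \<comment> \<open>Since (A + \<mu>)(A - \<mu>) u = 0, the defect \<open>r\<close> is killed by A +
    \<mu>. Testing this against \<open>r\<close> makes - \<mu> a value of the form of P + B, which
    is at least - e.\<close>
  define r where "r = A u - \<mu> *\<^sub>R u"
  have "A r = - \<mu> *\<^sub>R r"
    using assms(1) by (simp add: r_def linear_diff linear_scale sq algebra_simps power2_eq_square)
  then have "- \<mu> * (r \<bullet> r) = P r \<bullet> r + B r \<bullet> r"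
    using assms(2)[of r] by (metis inner_add_left inner_scaleR_left)
  moreover have "\<bar>B r \<bullet> r\<bar> \<le> e * (r \<bullet> r)"
  proof -
    have "\<bar>B r \<bullet> r\<bar> \<le> norm (B r) * norm r" by (rule Cauchy_Schwarz_ineq2)
    also have "\<dots> \<le> e * norm r * norm r" by (intro mult_right_mono B) auto
    finally show ?thesis by (simp add: power2_eq_square flip: power2_norm_eq_inner)
  qed
  ultimately have "(\<mu> - e) * (r \<bullet> r) \<le> 0"
    using assms(3)[of r] by (simp add: algebra_simps)
  with \<open>e < \<mu>\<close> have "r \<bullet> r \<le> 0" by (simp add: mult_le_0_iff)
  then have "r = 0" by (metis inner_gt_zero_iff not_less)
  then show ?thesis by (simp add: r_def)
qed

section \<open>Two-term expansion of the perturbed eigenvectors\<close>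

definition first_order_const :: "real \<Rightarrow> real \<Rightarrow> real" where
  "first_order_const D c = 4 / c * (1 + 4 * D / c + 32 * D / c ^ 3 + 4 / c)"

text \<open>Both constants collect the coefficients at the end of \<open>first_order\<close> and
  \<open>second_order\<close>. Here the three summands stem from \<open>B\<close> applied to the
  first-order error together with the exchange of eigenvalues, from the directions
  \<open>y l\<close> with l different from k, and from the coefficient along
  \<open>y k\<close>.\<close>

definition second_order_const :: "real \<Rightarrow> real \<Rightarrow> real" where
  "second_order_const D c = (let K = first_order_const D c in
     (2 * K / c + 2 / c\<^sup>2) + 4 * D / c\<^sup>2 * (1 + K) + 4 / c\<^sup>2 * (8 * D / c\<^sup>2 * (1 + K) + 1 + 2 * K + K\<^sup>2))"

text \<open>In the application all vectors are divided by \<open>sqrt n\<close> and all matrices by \<open>n\<close>, so that the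
  constants below do not depend on \<open>n\<close>; \<open>x\<close> is the embedding and \<open>y\<close> the rotated latent positions.\<close>

locale spectral_perturbation =
  fixes x y :: "'d::finite \<Rightarrow> 'v::real_inner" and s lam :: "'d \<Rightarrow> real"
    and B :: "'v \<Rightarrow> 'v" and c e \<beta> \<gamma> D :: real
  assumes c0: "0 < c" and D: "D = real CARD('d)"
    and y_orth: "\<And>k l. y k \<bullet> y l = (if k = l then s k else 0)"
    and s_le: "\<And>k. s k \<le> 1" and s_ge: "\<And>k. c \<le> s k"
    and gap: "\<And>k l. k \<noteq> l \<Longrightarrow> c \<le> \<bar>s k - s l\<bar>"
    and B_lin: "linear B" and B_sym: "\<And>v w. B v \<bullet> w = v \<bullet> B w"
    and B_norm: "\<And>v. norm (B v) \<le> e * norm v"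
    and By: "\<And>k. norm (B (y k)) \<le> \<beta>" and yBy: "\<And>k l. \<bar>y k \<bullet> B (y l)\<bar> \<le> \<gamma>"
    and eig: "\<And>k. (\<Sum>l\<in>UNIV. (y l \<bullet> x k) *\<^sub>R y l) + B (x k) = lam k *\<^sub>R x k"
    and x_norm: "\<And>k. x k \<bullet> x k = lam k"
    and lam_close: "\<And>k. \<bar>lam k - s k\<bar> \<le> e"
    and sign: "\<And>k. 0 \<le> x k \<bullet> y k"
    and e_small: "e \<le> c\<^sup>2 / 20" and beta1: "\<beta> \<le> 1"
begin

abbreviation "K\<^sub>1 \<equiv> first_order_const D c"
abbreviation "K\<^sub>2 \<equiv> second_order_const D c"

lemmas K\<^sub>1_def = first_order_const_def[of D c]
lemmas K\<^sub>2_def = second_order_const_def[of D c, unfolded Let_def]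

text \<open>The eigenvalue equation expresses \<open>lam k\<close> times \<open>x k\<close> as the
  noise term \<open>B (x k)\<close> plus the combination of the \<open>y l\<close> with these
  overlaps as coefficients. Off the diagonal they have to be small, on the diagonal close to
  \<open>lam k\<close>.\<close>

definition g where "g k l = x k \<bullet> y l"

lemma c1: "c \<le> 1"
  using s_le s_ge order_trans by blast

lemma e0: "0 \<le> e"
  using lam_close[of undefined] by linarith

lemma beta0: "0 \<le> \<beta>"
  using By[of undefined] norm_ge_zero order_trans by blast

lemma gamma0: "0 \<le> \<gamma>"
  using yBy[of undefined undefined] by linarith

lemma e_le: "e \<le> c / 20" "e \<le> 1"
proof -
  have "c\<^sup>2 \<le> c * 1" unfolding power2_eq_square using c0 c1 by (intro mult_left_mono) auto
  then show "e \<le> c / 20" "e \<le> 1" using e_small c1 by auto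
qed

lemma K1_pos: "0 < K\<^sub>1"
  unfolding K\<^sub>1_def using c0 by (intro mult_pos_pos add_pos_nonneg) (auto simp: D)

lemma lam_ge: "c / 2 \<le> lam k"
  using lam_close[of k] s_ge[of k] e_le c0 by linarith

lemma lam_le: "lam k \<le> 2"
  using lam_close[of k] s_le[of k] e_le c0 by linarith

lemma lam_gap: "k \<noteq> l \<Longrightarrow> c / 2 \<le> \<bar>lam k - s l\<bar>"
  using lam_close[of k] gap[of k l] e_le c0 by linarith

lemma norm_y: "norm (y k) \<le> 1"
  using s_le[of k] by (simp add: norm_eq_sqrt_inner y_orth)

lemma norm_x: "norm (x k) \<le> 2"
proof -
  have "norm (x k) \<le> sqrt 4" unfolding norm_eq_sqrt_inner x_norm
    using lam_le[of k] by (intro real_sqrt_le_mono) auto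
  then show ?thesis by simp
qed

text \<open>Pairing the eigenvalue equation with \<open>y l\<close> isolates a single overlap,
  because the \<open>y l\<close> are orthogonal. Division by the gap then bounds the off-diagonal
  overlaps, as in the Davis-Kahan argument.\<close>

lemma g_eq: "(lam k - s l) * g k l = x k \<bullet> B (y l)"
proof -
  have "lam k * g k l = ((\<Sum>j\<in>UNIV. (y j \<bullet> x k) *\<^sub>R y j) + B (x k)) \<bullet> y l"
    unfolding eig g_def by simp
  also have "\<dots> = s l * g k l + x k \<bullet> B (y l)"
    by (simp add: inner_add_left inner_sum_left y_orth B_sym g_def inner_commute[of "x k" "y l"] 
        if_distrib cong: if_cong)
  finally show ?thesis by (simp add: algebra_simps)
qed

lemma g_le:
  assumes "k \<noteq> l" "\<bar>x k \<bullet> B (y l)\<bar> \<le> t"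
  shows "\<bar>g k l\<bar> \<le> 2 / c * t"
proof -
  have "c / 2 * \<bar>g k l\<bar> \<le> \<bar>lam k - s l\<bar> * \<bar>g k l\<bar>"
    by (intro mult_right_mono lam_gap assms) auto
  also have "\<dots> \<le> t" using assms(2) by (simp add: g_eq[symmetric] abs_mult)
  finally show ?thesis using c0 by (simp add: field_simps)
qed

lemma g_off: "k \<noteq> l \<Longrightarrow> \<bar>g k l\<bar> \<le> 4 / c * \<beta>"
proof -
  assume "k \<noteq> l"
  have "\<bar>x k \<bullet> B (y l)\<bar> \<le> norm (x k) * norm (B (y l))" by (rule Cauchy_Schwarz_ineq2)
  also have "\<dots> \<le> 2 * \<beta>" by (intro mult_mono norm_x By) auto
  finally show ?thesis using g_le[OF \<open>k \<noteq> l\<close>] by force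
qed

text \<open>The diagonal overlap has no gap to divide by. Pairing the equation with
  \<open>x k\<close>, whose squared norm is \<open>lam k\<close>, determines its square
  instead.\<close>

lemma lam_sq: "(lam k)\<^sup>2 = (\<Sum>l\<in>UNIV. (g k l)\<^sup>2) + x k \<bullet> B (x k)"
proof -
  have "(lam k)\<^sup>2 = (lam k *\<^sub>R x k) \<bullet> x k" by (simp add: x_norm power2_eq_square)
  also have "\<dots> = ((\<Sum>j\<in>UNIV. (y j \<bullet> x k) *\<^sub>R y j) + B (x k)) \<bullet> x k" unfolding eig ..
  also have "\<dots> = (\<Sum>l\<in>UNIV. (g k l)\<^sup>2) + x k \<bullet> B (x k)"
    by (simp add: inner_add_left inner_sum_left g_def power2_eq_square
        inner_commute[of "x k" "y _"] inner_commute[of "x k" "B _"])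
  finally show ?thesis .
qed

text \<open>The square of \<open>g k k\<close> is close to that of \<open>lam k\<close>. The sign
  convention makes \<open>g k k\<close> nonnegative, so the factor \<open>g k k + lam k\<close>
  stays above c/2 and can be divided out; with the opposite sign \<open>x k\<close> would
  approximate \<open>- y k\<close>.\<close>

lemma g_diag:
  assumes "\<And>l. l \<noteq> k \<Longrightarrow> (g k l)\<^sup>2 \<le> t" "\<bar>x k \<bullet> B (x k)\<bar> \<le> r" "0 \<le> t"
  shows "\<bar>g k k - lam k\<bar> \<le> 2 / c * (D * t + r)"
proof -
  have "(\<Sum>l\<in>UNIV. (g k l)\<^sup>2) = (g k k)\<^sup>2 + (\<Sum>l\<in>UNIV - {k}. (g k l)\<^sup>2)"
    by (simp add: sum.remove)
  moreover have "(\<Sum>l\<in>UNIV - {k}. (g k l)\<^sup>2) \<le> (\<Sum>l\<in>(UNIV::'d set) - {k}. t)"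
    by (intro sum_mono assms) auto
  moreover have "(\<Sum>l\<in>(UNIV::'d set) - {k}. t) \<le> D * t"
    using assms(3) by (simp add: D card_Diff_subset algebra_simps of_nat_diff)
  moreover have "0 \<le> (\<Sum>l\<in>UNIV - {k}. (g k l)\<^sup>2)" by (intro sum_nonneg) auto
  ultimately have "\<bar>(g k k)\<^sup>2 - (lam k)\<^sup>2\<bar> \<le> D * t + r"
    using lam_sq[of k] assms(2) by linarith
  moreover have "(g k k)\<^sup>2 - (lam k)\<^sup>2 = (g k k - lam k) * (g k k + lam k)"
    by (simp add: power2_eq_square algebra_simps)
  ultimately have "\<bar>g k k - lam k\<bar> * \<bar>g k k + lam k\<bar> \<le> D * t + r" by (simp add: abs_mult)
  moreover have "c / 2 \<le> \<bar>g k k + lam k\<bar>" using sign[of k] lam_ge[of k] by (simp add: g_def abs_if)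
  then have "\<bar>g k k - lam k\<bar> * (c / 2) \<le> \<bar>g k k - lam k\<bar> * \<bar>g k k + lam k\<bar>"
    by (intro mult_left_mono) auto
  ultimately have "\<bar>g k k - lam k\<bar> * (c / 2) \<le> D * t + r" by linarith
  then show ?thesis using c0 by (simp add: field_simps)
qed

lemma expansion:
  "lam k *\<^sub>R (x k - y k) = B (x k) + (\<Sum>l\<in>UNIV - {k}. g k l *\<^sub>R y l) + (g k k - lam k) *\<^sub>R y k"
proof -
  have "lam k *\<^sub>R x k = B (x k) + (\<Sum>l\<in>UNIV. g k l *\<^sub>R y l)"
    using eig[of k] by (simp add: g_def inner_commute add.commute)
  also have "(\<Sum>l\<in>UNIV. g k l *\<^sub>R y l) = g k k *\<^sub>R y k + (\<Sum>l\<in>UNIV - {k}. g k l *\<^sub>R y l)"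
    by (simp add: sum.remove)
  finally show ?thesis by (simp add: algebra_simps)
qed

lemma norm_off:
  assumes "\<And>l. l \<noteq> k \<Longrightarrow> \<bar>g k l\<bar> \<le> t" "0 \<le> t"
  shows "norm (\<Sum>l\<in>UNIV - {k}. g k l *\<^sub>R y l) \<le> D * t"
proof -
  have "norm (\<Sum>l\<in>UNIV - {k}. g k l *\<^sub>R y l) \<le> (\<Sum>l\<in>(UNIV::'d set) - {k}. t * 1)"
    using assms norm_y unfolding norm_scaleR real_norm_def
    by (intro sum_norm_le) (auto simp del: mult_1_right intro!: mult_mono)
  also have "\<dots> \<le> D * t"
    using assms(2) by (simp add: D card_Diff_subset algebra_simps of_nat_diff)
  finally show ?thesis .
qed

text \<open>The crude operator bound \<open>e\<close> is spent only on the difference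
  \<open>x k - y k\<close>; the main part is measured by the much smaller \<beta>.\<close>

lemma norm_Bx: "norm (B (x k)) \<le> \<beta> + e * norm (x k - y k)"
proof -
  have "B (x k) = B (y k) + B (x k - y k)" using B_lin by (simp add: linear_diff)
  then show ?thesis using norm_triangle_ineq[of "B (y k)" "B (x k - y k)"] By[of k] B_norm[of "x k - y k"]
    by simp
qed

text \<open>A self-bounding argument: the error \<delta> reappears on the right of the expansion,
  multiplied by \<open>e\<close>, and is absorbed into the left side.\<close>

lemma first_order: "norm (x k - y k) \<le> K\<^sub>1 * \<beta>"
proof -
  define \<delta> where "\<delta> = norm (x k - y k)"
  have \<delta>0: "0 \<le> \<delta>" by (simp add: \<delta>_def)
  \<comment> \<open>Squares of overlaps may be bounded linearly here, as the claim is only of order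
    \<beta>.\<close>
  have b2: "\<beta>\<^sup>2 \<le> \<beta>" using beta0 beta1 by (simp add: power2_eq_square mult_left_le)
  have sq: "(g k l)\<^sup>2 \<le> 16 / c\<^sup>2 * \<beta>" if "l \<noteq> k" for l
  proof -
    have "(g k l)\<^sup>2 = \<bar>g k l\<bar>\<^sup>2" by simp
    also have "\<dots> \<le> (4 / c * \<beta>)\<^sup>2" using g_off[of k l] that by (intro power_mono) auto
    also have "\<dots> = 16 / c\<^sup>2 * \<beta>\<^sup>2" by (simp add: power_mult_distrib power_divide)
    also have "\<dots> \<le> 16 / c\<^sup>2 * \<beta>" using b2 by (intro mult_left_mono) auto
    finally show ?thesis .
  qed
  have "\<bar>x k \<bullet> B (x k)\<bar> \<le> norm (x k) * norm (B (x k))" by (rule Cauchy_Schwarz_ineq2)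
  also have "\<dots> \<le> 2 * (\<beta> + e * \<delta>)" unfolding \<delta>_def by (intro mult_mono norm_x norm_Bx) auto
  finally have d: "\<bar>g k k - lam k\<bar> \<le> 2 / c * (D * (16 / c\<^sup>2 * \<beta>) + 2 * (\<beta> + e * \<delta>))"
    using sq beta0 by (intro g_diag) auto
  have o: "norm (\<Sum>l\<in>UNIV - {k}. g k l *\<^sub>R y l) \<le> D * (4 / c * \<beta>)"
    using g_off beta0 c0 by (intro norm_off) auto
  have dy: "norm ((g k k - lam k) *\<^sub>R y k) \<le> \<bar>g k k - lam k\<bar>"
    using norm_y[of k] by (simp add: mult_left_le)
  have "c / 2 * \<delta> \<le> lam k * \<delta>" using lam_ge \<delta>0 by (intro mult_right_mono) auto
  also have "\<dots> = norm (lam k *\<^sub>R (x k - y k))"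
    using lam_ge[of k] c0 by (simp add: \<delta>_def)
  also have "\<dots> \<le> norm (B (x k)) + norm (\<Sum>l\<in>UNIV - {k}. g k l *\<^sub>R y l) + norm ((g k k - lam k) *\<^sub>R y k)"
    unfolding expansion by (intro norm_triangle_le add_right_mono norm_triangle_ineq)
  also have "\<dots> \<le> (\<beta> + e * \<delta>) + D * (4 / c * \<beta>) + 2 / c * (D * (16 / c\<^sup>2 * \<beta>) + 2 * (\<beta> + e * \<delta>))"
    using norm_Bx[of k] o dy d unfolding \<delta>_def by linarith
  also have "\<dots> = (1 + 4 * D / c + 32 * D / c ^ 3 + 4 / c) * \<beta> + (1 + 4 / c) * e * \<delta>"
    using c0 by (simp add: field_simps power2_eq_square power3_eq_cube)
  finally have "c / 2 * \<delta> \<le> (1 + 4 * D / c + 32 * D / c ^ 3 + 4 / c) * \<beta> + (1 + 4 / c) * e * \<delta>" .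
  \<comment> \<open>The smallness condition on \<open>e\<close> is made for this: (5/c)(c^2/20) =
    c/4 is half of the factor c/2 on the left, so half of the left side survives.\<close>
  moreover have "(1 + 4 / c) * e * \<delta> \<le> c / 4 * \<delta>"
  proof (intro mult_right_mono \<delta>0)
    have "(1 + 4 / c) * e \<le> (5 / c) * (c\<^sup>2 / 20)"
      using c0 c1 e0 e_small by (intro mult_mono) (auto simp: field_simps)
    also have "\<dots> = c / 4" using c0 by (simp add: power2_eq_square)
    finally show "(1 + 4 / c) * e \<le> c / 4" .
  qed
  ultimately have "c / 4 * \<delta> \<le> (1 + 4 * D / c + 32 * D / c ^ 3 + 4 / c) * \<beta>" by argo
  then have "4 / c * (c / 4 * \<delta>) \<le> 4 / c * ((1 + 4 * D / c + 32 * D / c ^ 3 + 4 / c) * \<beta>)"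
    using c0 by (intro mult_left_mono) auto
  moreover have "4 / c * (c / 4 * \<delta>) = \<delta>" using c0 by simp
  ultimately show ?thesis by (simp only: K\<^sub>1_def \<delta>_def mult.assoc)
qed

text \<open>The first-order bound is fed back into the expansion through
  \<open>x k = y k + w\<close>. Every term except \<open>B (y k)\<close> then has size \<gamma>,
  \<beta>^2 or e \<beta>. The factor 1 / \<open>lam k\<close> is replaced by 1 / \<open>s k\<close>,
  since \<open>lam k\<close> depends on the graph whereas \<open>s k\<close> comes from the latent
  positions.\<close>

lemma second_order:
  "norm (x k - y k - (1 / s k) *\<^sub>R B (y k)) \<le> K\<^sub>2 * (\<gamma> + \<beta>\<^sup>2 + e * \<beta>)"
proof -
  define w where "w = x k - y k"
  have xw: "x k = y k + w" by (simp add: w_def)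
  have w: "norm w \<le> K\<^sub>1 * \<beta>" unfolding w_def by (rule first_order)
  have Bx: "B (x k) = B (y k) + B w" unfolding xw by (rule linear_add[OF B_lin])
  have wB: "\<bar>w \<bullet> B (y l)\<bar> \<le> K\<^sub>1 * \<beta>\<^sup>2" for l
  proof -
    have "\<bar>w \<bullet> B (y l)\<bar> \<le> norm w * norm (B (y l))" by (rule Cauchy_Schwarz_ineq2)
    also have "\<dots> \<le> (K\<^sub>1 * \<beta>) * \<beta>" using K1_pos beta0 by (intro mult_mono w By) auto
    finally show ?thesis by (simp add: power2_eq_square mult.assoc)
  qed
  have Bw: "norm (B w) \<le> e * (K\<^sub>1 * \<beta>)"
    using B_norm[of w] mult_left_mono[OF w e0] by linarith
  have wBw: "\<bar>w \<bullet> B w\<bar> \<le> K\<^sub>1\<^sup>2 * \<beta>\<^sup>2"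
  proof -
    have "\<bar>w \<bullet> B w\<bar> \<le> norm w * norm (B w)" by (rule Cauchy_Schwarz_ineq2)
    also have "\<dots> \<le> (K\<^sub>1 * \<beta>) * (e * (K\<^sub>1 * \<beta>))" using K1_pos beta0 by (intro mult_mono w Bw) auto
    also have "\<dots> = e * (K\<^sub>1\<^sup>2 * \<beta>\<^sup>2)" by (simp add: power2_eq_square)
    also have "\<dots> \<le> 1 * (K\<^sub>1\<^sup>2 * \<beta>\<^sup>2)" using e_le by (intro mult_right_mono) auto
    finally show ?thesis by simp
  qed
  \<comment> \<open>\<open>T\<close> bounds the pairing of \<open>x k\<close> with
    \<open>B (y l)\<close>: the part \<open>y k\<close> contributes \<gamma>, the part
    \<open>w\<close> contributes the product of two quantities of order \<beta>.\<close>
  define T where "T = \<gamma> + K\<^sub>1 * \<beta>\<^sup>2"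
  have T0: "0 \<le> T" using gamma0 K1_pos by (simp add: T_def)
  have goff: "\<bar>g k l\<bar> \<le> 2 / c * T" if "l \<noteq> k" for l
  proof (rule g_le)
    show "\<bar>x k \<bullet> B (y l)\<bar> \<le> T"
      using yBy[of k l] wB[of l] unfolding xw inner_add_left T_def by linarith
  qed (use that in auto)
  \<comment> \<open>One factor is bounded by the constant 4/c and only the other by
    \<open>T\<close>, so that the square is linear in \<open>T\<close>.\<close>
  have gsq: "(g k l)\<^sup>2 \<le> 8 / c\<^sup>2 * T" if "l \<noteq> k" for l
  proof -
    have "(g k l)\<^sup>2 = \<bar>g k l\<bar> * \<bar>g k l\<bar>" by (simp add: power2_eq_square)
    also have "\<dots> \<le> (4 / c * 1) * (2 / c * T)"
    proof (intro mult_mono)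
      show "\<bar>g k l\<bar> \<le> 4 / c * 1"
      proof (rule order_trans[OF g_off])
        show "4 / c * \<beta> \<le> 4 / c * 1" using beta1 c0 by (intro mult_left_mono) auto
      qed (use that in auto)
    qed (use goff that c0 in auto)
    finally show ?thesis by (simp add: power2_eq_square)
  qed
  have xBx: "\<bar>x k \<bullet> B (x k)\<bar> \<le> \<gamma> + 2 * (K\<^sub>1 * \<beta>\<^sup>2) + K\<^sub>1\<^sup>2 * \<beta>\<^sup>2"
  proof -
    have "x k \<bullet> B (x k) = y k \<bullet> B (y k) + 2 * (w \<bullet> B (y k)) + w \<bullet> B w"
    proof -
      have "y k \<bullet> B w = w \<bullet> B (y k)" by (metis B_sym inner_commute)
      then show ?thesis unfolding Bx unfolding xw by (simp add: inner_add_left inner_add_right)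
    qed
    then show ?thesis using yBy[of k k] wB[of k] wBw by linarith
  qed
  have d: "\<bar>g k k - lam k\<bar> \<le> 2 / c * (D * (8 / c\<^sup>2 * T) + (\<gamma> + 2 * (K\<^sub>1 * \<beta>\<^sup>2) + K\<^sub>1\<^sup>2 * \<beta>\<^sup>2))"
    using gsq xBx T0 by (intro g_diag) auto
  have o: "norm (\<Sum>l\<in>UNIV - {k}. g k l *\<^sub>R y l) \<le> D * (2 / c * T)"
    using goff T0 c0 by (intro norm_off) auto
  have l0: "0 < lam k" "0 < s k" using lam_ge[of k] s_ge[of k] c0 by linarith+
  have dy: "norm ((g k k - lam k) *\<^sub>R y k) \<le> \<bar>g k k - lam k\<bar>"
    using norm_y[of k] by (simp add: mult_left_le)
  have il: "1 / lam k \<le> 2 / c" using lam_ge[of k] c0 l0 by (simp add: field_simps)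
  have sk: "1 / s k \<le> 1 / c" using s_ge[of k] c0 l0 by (simp add: field_simps)
  have "x k - y k = (1 / lam k) *\<^sub>R (lam k *\<^sub>R (x k - y k))" using l0 by simp
  also have "\<dots> - (1 / s k) *\<^sub>R B (y k) = (1 / lam k) *\<^sub>R (B w + (\<Sum>l\<in>UNIV - {k}. g k l *\<^sub>R y l)
      + (g k k - lam k) *\<^sub>R y k) + (1 / lam k - 1 / s k) *\<^sub>R B (y k)"
    unfolding expansion Bx by (simp add: algebra_simps)
  finally have eq: "x k - y k - (1 / s k) *\<^sub>R B (y k) = (1 / lam k) *\<^sub>R (B w + (\<Sum>l\<in>UNIV - {k}. g k l *\<^sub>R y l)
      + (g k k - lam k) *\<^sub>R y k) + (1 / lam k - 1 / s k) *\<^sub>R B (y k)" .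
  have p1: "norm ((1 / lam k) *\<^sub>R (B w + (\<Sum>l\<in>UNIV - {k}. g k l *\<^sub>R y l) + (g k k - lam k) *\<^sub>R y k))
    \<le> 2 / c * (e * (K\<^sub>1 * \<beta>) + D * (2 / c * T) + 
        2 / c * (D * (8 / c\<^sup>2 * T) + (\<gamma> + 2 * (K\<^sub>1 * \<beta>\<^sup>2) + K\<^sub>1\<^sup>2 * \<beta>\<^sup>2)))"
  proof -
    have "norm (B w + (\<Sum>l\<in>UNIV - {k}. g k l *\<^sub>R y l) + (g k k - lam k) *\<^sub>R y k)
      \<le> norm (B w) + norm (\<Sum>l\<in>UNIV - {k}. g k l *\<^sub>R y l) + norm ((g k k - lam k) *\<^sub>R y k)"
      by (intro norm_triangle_le add_right_mono norm_triangle_ineq)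
    also have "\<dots> \<le> e * (K\<^sub>1 * \<beta>) + D * (2 / c * T) + 
        2 / c * (D * (8 / c\<^sup>2 * T) + (\<gamma> + 2 * (K\<^sub>1 * \<beta>\<^sup>2) + K\<^sub>1\<^sup>2 * \<beta>\<^sup>2))"
      using Bw o dy d by linarith
    finally show ?thesis using l0 il c0 
      unfolding norm_scaleR by (intro mult_mono) auto
  qed
  \<comment> \<open>The price of exchanging the eigenvalues: their difference is at most
    \<open>e\<close>, and it multiplies a vector of norm at most \<beta>.\<close>
  have p2: "norm ((1 / lam k - 1 / s k) *\<^sub>R B (y k)) \<le> 2 / c\<^sup>2 * e * \<beta>"
  proof -
    have "1 / lam k - 1 / s k = (1 / lam k) * (1 / s k) * (s k - lam k)"
      using l0 by (simp add: field_simps)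
    then have "\<bar>1 / lam k - 1 / s k\<bar> = (1 / lam k) * (1 / s k) * \<bar>s k - lam k\<bar>"
      using l0 by (simp add: abs_mult)
    also have "\<dots> \<le> (2 / c) * (1 / c) * e"
      using lam_close[of k] l0 c0 by (intro mult_mono il sk) auto
    finally have "\<bar>1 / lam k - 1 / s k\<bar> \<le> 2 / c\<^sup>2 * e" by (simp add: power2_eq_square)
    then show ?thesis unfolding norm_scaleR real_norm_def using e0 by (intro mult_mono By) auto
  qed
  define R where "R = \<gamma> + \<beta>\<^sup>2 + e * \<beta>"
  have R: "\<gamma> \<le> R" "\<beta>\<^sup>2 \<le> R" "e * \<beta> \<le> R" "0 \<le> R"
    using gamma0 e0 beta0 by (auto simp: R_def)
  have TR: "T \<le> (1 + K\<^sub>1) * R"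
    using R(1) mult_left_mono[OF R(2) less_imp_le[OF K1_pos]] by (simp add: T_def algebra_simps)
  have GR: "\<gamma> + 2 * (K\<^sub>1 * \<beta>\<^sup>2) + K\<^sub>1\<^sup>2 * \<beta>\<^sup>2 \<le> (1 + 2 * K\<^sub>1 + K\<^sub>1\<^sup>2) * R"
    using R(1) mult_left_mono[OF R(2) less_imp_le[OF K1_pos]] mult_left_mono[OF R(2) zero_le_power2[of K\<^sub>1]]
    by (simp add: algebra_simps)
  have "norm (x k - y k - (1 / s k) *\<^sub>R B (y k)) \<le> 
     2 / c * (e * (K\<^sub>1 * \<beta>) + D * (2 / c * T) + 
        2 / c * (D * (8 / c\<^sup>2 * T) + (\<gamma> + 2 * (K\<^sub>1 * \<beta>\<^sup>2) + K\<^sub>1\<^sup>2 * \<beta>\<^sup>2))) + 2 / c\<^sup>2 * e * \<beta>"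
    unfolding eq using p1 p2 by (intro norm_triangle_le add_mono)
  also have "\<dots> = (2 * K\<^sub>1 / c + 2 / c\<^sup>2) * (e * \<beta>) + 4 * D / c\<^sup>2 * T +
      4 / c\<^sup>2 * (8 * D / c\<^sup>2 * T + (\<gamma> + 2 * (K\<^sub>1 * \<beta>\<^sup>2) + K\<^sub>1\<^sup>2 * \<beta>\<^sup>2))"
  proof -
    have "2 * q * (e * (K * \<beta>) + D * (2 * q * T) + 2 * q * (D * (8 * p * T) + r)) + 2 * p * e * \<beta> =
      (2 * K * q + 2 * p) * (e * \<beta>) + 4 * D * p * T + 4 * p * (8 * D * p * T + r)" if "p = q * q" for p q K r
      unfolding that by (simp add: algebra_simps)
    from this[of "1 / c\<^sup>2" "1 / c" K\<^sub>1 "\<gamma> + 2 * (K\<^sub>1 * \<beta>\<^sup>2) + K\<^sub>1\<^sup>2 * \<beta>\<^sup>2"] show ?thesis by (simp add: power2_eq_square)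
  qed
  also have "\<dots> \<le> (2 * K\<^sub>1 / c + 2 / c\<^sup>2) * R + 4 * D / c\<^sup>2 * ((1 + K\<^sub>1) * R) +
      4 / c\<^sup>2 * (8 * D / c\<^sup>2 * ((1 + K\<^sub>1) * R) + (1 + 2 * K\<^sub>1 + K\<^sub>1\<^sup>2) * R)"
  proof -
    have p: "0 \<le> 2 * K\<^sub>1 / c + 2 / c\<^sup>2" "0 \<le> 4 * D / c\<^sup>2" "0 \<le> 4 / c\<^sup>2" "0 \<le> 8 * D / c\<^sup>2"
      using c0 K1_pos by (auto simp: D)
    show ?thesis
      by (intro add_mono mult_left_mono[OF R(3) p(1)] mult_left_mono[OF TR p(2)] mult_left_mono[OF _ p(3)]
          mult_left_mono[OF TR p(4)] GR)
  qed
  also have "\<dots> = K\<^sub>2 * R" unfolding K\<^sub>2_def by (simp only: distrib_right distrib_left mult.assoc)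
  finally show ?thesis by (simp add: R_def)
qed

end

subsection \<open>Conditional concentration of the edge noise\<close>

text \<open>Hoeffding's lemma for a centred Bernoulli variable. Swapping the two outcomes, that is p
  with 1 - p, reduces negative h to positive h.\<close>

lemma bernoulli_mgf_le:
  fixes p h :: real
  assumes "0 \<le> p" "p \<le> 1"
  shows "p * exp (h * (1 - p)) + (1 - p) * exp (h * (0 - p)) \<le> exp (h\<^sup>2 / 8)"
proof -
  have *: "p * exp (h * (1 - p)) + (1 - p) * exp (h * (0 - p)) \<le> exp (h\<^sup>2 / 8)"
    if "0 \<le> h" "0 \<le> p" "p \<le> 1" for h p :: real
  proof -
    have pos: "0 < 1 + p * (exp h - 1)" using that by (intro add_pos_nonneg) auto
    have "p * exp (h * (1 - p)) + (1 - p) * exp (h * (0 - p)) = exp (- h * p) * (1 + p * (exp h - 1))"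
      by (simp add: algebra_simps exp_diff exp_minus divide_inverse)
    also have "\<dots> = exp (- h * p + ln (1 + p * (exp h - 1)))"
      using pos by (simp add: exp_add exp_diff exp_minus divide_inverse mult.commute)
    also have "\<dots> \<le> exp (h\<^sup>2 / 8)"
      using Hoeffdings_lemma_aux[OF that(1,2)] by simp
    finally show ?thesis .
  qed
  show ?thesis
  proof (cases "0 \<le> h")
    case True
    then show ?thesis using * assms by blast
  next
    case False
    then show ?thesis using *[of "- h" "1 - p"] assms by (simp add: algebra_simps)
  qed
qed

text \<open>A simple graph is determined by its edge set. Edges are stored with the larger endpoint
  first, so that they run through the same index set as the double products over j < n and i <
  j.\<close>

lemma adjacency_matrices_bij:
  "bij_betw (\<lambda>S. mat n n (\<lambda>(i, j). if (j, i) \<in> S \<or> (i, j) \<in> S then 1 else 0))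
     (Pow (Sigma {..<n} (\<lambda>j. {..<j}))) (adjacency_matrices n)"
proof (rule bij_betwI[where g = "\<lambda>a. {(j, i). i < j \<and> j < n \<and> a $$ (i, j) = 1}"])
  show "(\<lambda>S. mat n n (\<lambda>(i, j). if (j, i) \<in> S \<or> (i, j) \<in> S then 1 else 0))
    \<in> Pow (Sigma {..<n} (\<lambda>j. {..<j})) \<rightarrow> adjacency_matrices n"
    by (auto simp: adjacency_matrices_def)
  show "(\<lambda>a. {(j, i). i < j \<and> j < n \<and> a $$ (i, j) = 1}) \<in> adjacency_matrices n \<rightarrow> Pow (Sigma {..<n} (\<lambda>j. {..<j}))"
    by auto
  show "{(j, i). i < j \<and> j < n \<and> mat n n (\<lambda>(i, j). if (j, i) \<in> S \<or> (i, j) \<in> S then 1 else (0::real)) $$ (i, j) = 1} = S"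
    if "S \<in> Pow (Sigma {..<n} (\<lambda>j. {..<j}))" for S
    using that by (auto split: if_splits)
  show "mat n n (\<lambda>(i, j). if (j, i) \<in> {(j, i). i < j \<and> j < n \<and> a $$ (i, j) = 1} \<or>
     (i, j) \<in> {(j, i). i < j \<and> j < n \<and> a $$ (i, j) = 1} then 1 else 0) = a"
    if a: "a \<in> adjacency_matrices n" for a :: "real mat"
  proof (rule eq_matI)
    fix i j assume "i < dim_row a" "j < dim_col a"
    moreover have "a \<in> carrier_mat n n" using a by (auto simp: adjacency_matrices_def)
    ultimately have ij: "i < n" "j < n" by auto
    then have p: "a $$ (i, j) = 0 \<or> a $$ (i, j) = 1" "a $$ (i, j) = a $$ (j, i)" "a $$ (i, i) = 0"
      using a by (auto simp: adjacency_matrices_def)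
    show "mat n n (\<lambda>(i, j). if (j, i) \<in> {(j, i). i < j \<and> j < n \<and> a $$ (i, j) = 1} \<or>
     (i, j) \<in> {(j, i). i < j \<and> j < n \<and> a $$ (i, j) = 1} then 1 else 0) $$ (i, j) = a $$ (i, j)"
      using ij p by (cases i j rule: linorder_cases) auto
  qed (use a in \<open>auto simp: adjacency_matrices_def\<close>)
qed

lemma finite_adjacency_matrices: "finite (adjacency_matrices n)"
  using bij_betw_finite[OF adjacency_matrices_bij[of n]] by auto

text \<open>The distributive law: the product over all edges of a two-term sum expands into a sum
  over edge sets. With likelihoods as factors this is the conditional independence of the
  edges.\<close>

lemma sum_adjacency_matrices:
  fixes f :: "nat \<Rightarrow> nat \<Rightarrow> real \<Rightarrow> real"
  shows "(\<Sum>a\<in>adjacency_matrices n. \<Prod>j<n. \<Prod>i<j. f i j (a $$ (i, j))) = (\<Prod>j<n. \<Prod>i<j. f i j 1 + f i j 0)"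
proof -
  let ?E = "Sigma {..<n} (\<lambda>j. {..<j})"
  let ?m = "\<lambda>S. mat n n (\<lambda>(i, j). if (j, i) \<in> S \<or> (i, j) \<in> S then 1 else (0::real))"
  have fin: "finite ?E" by auto
  have "(\<Prod>j<n. \<Prod>i<j. f i j 1 + f i j 0) = (\<Prod>(j, i)\<in>?E. f i j 1 + f i j 0)"
    by (subst prod.Sigma) auto
  also have "\<dots> = (\<Sum>S\<in>Pow ?E. (\<Prod>(j, i)\<in>S. f i j 1) * (\<Prod>(j, i)\<in>?E - S. f i j 0))"
    using prod_add[OF fin, of "\<lambda>(j, i). f i j 1" "\<lambda>(j, i). f i j 0"] by (simp add: case_prod_unfold)
  also have "\<dots> = (\<Sum>S\<in>Pow ?E. \<Prod>j<n. \<Prod>i<j. f i j (?m S $$ (i, j)))"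
  proof (intro sum.cong refl)
    fix S assume S: "S \<in> Pow ?E"
    have "(\<Prod>j<n. \<Prod>i<j. f i j (?m S $$ (i, j))) = (\<Prod>(j, i)\<in>?E. f i j (?m S $$ (i, j)))"
      by (subst prod.Sigma) auto
    also have "\<dots> = (\<Prod>(j, i)\<in>?E - S. f i j (?m S $$ (i, j))) * (\<Prod>(j, i)\<in>S. f i j (?m S $$ (i, j)))"
      using S by (intro prod.subset_diff fin) auto
    also have "(\<Prod>(j, i)\<in>?E - S. f i j (?m S $$ (i, j))) = (\<Prod>(j, i)\<in>?E - S. f i j 0)"
      using S by (intro prod.cong) auto
    also have "(\<Prod>(j, i)\<in>S. f i j (?m S $$ (i, j))) = (\<Prod>(j, i)\<in>S. f i j 1)"
      using S by (intro prod.cong) auto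
    finally show "(\<Prod>(j, i)\<in>S. f i j 1) * (\<Prod>(j, i)\<in>?E - S. f i j 0) = (\<Prod>j<n. \<Prod>i<j. f i j (?m S $$ (i, j)))"
      by simp
  qed
  also have "\<dots> = (\<Sum>a\<in>adjacency_matrices n. \<Prod>j<n. \<Prod>i<j. f i j (a $$ (i, j)))"
    by (rule sum.reindex_bij_betw[OF adjacency_matrices_bij])
  finally show ?thesis ..
qed

text \<open>For fixed positions the left side is the moment generating function of a weighted noise
  sum. It factorizes over the edges, and each factor is that of a Bernoulli variable with parameter
  \<open>x i \<bullet> x j\<close>.\<close>

lemma sum_edge_likelihood_exp_le:
  fixes x :: "nat \<Rightarrow> real ^ 'd"
  assumes x: "\<And>i j. i < n \<Longrightarrow> j < n \<Longrightarrow> 0 \<le> x i \<bullet> x j \<and> x i \<bullet> x j \<le> 1"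
  shows "(\<Sum>a\<in>adjacency_matrices n. edge_likelihood n x a *
      exp (\<Sum>j<n. \<Sum>i<j. w i j * (a $$ (i, j) - x i \<bullet> x j))) \<le> exp ((\<Sum>j<n. \<Sum>i<j. (w i j)\<^sup>2) / 8)"
proof -
  define f where "f i j t = (if t = 1 then x i \<bullet> x j else 1 - x i \<bullet> x j) * exp (w i j * (t - x i \<bullet> x j))"
    for i j and t :: real
  have "(\<Sum>a\<in>adjacency_matrices n. edge_likelihood n x a *
      exp (\<Sum>j<n. \<Sum>i<j. w i j * (a $$ (i, j) - x i \<bullet> x j))) =
    (\<Sum>a\<in>adjacency_matrices n. \<Prod>j<n. \<Prod>i<j. f i j (a $$ (i, j)))"
    by (intro sum.cong) (auto simp: f_def edge_likelihood_def exp_sum prod.distrib)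
  also have "\<dots> = (\<Prod>j<n. \<Prod>i<j. f i j 1 + f i j 0)" by (rule sum_adjacency_matrices)
  also have "\<dots> \<le> (\<Prod>j<n. \<Prod>i<j. exp ((w i j)\<^sup>2 / 8))"
  proof -
    have "f i j 1 + f i j 0 \<le> exp ((w i j)\<^sup>2 / 8) \<and> 0 \<le> f i j 1 + f i j 0" if "j < n" "i < j" for i j
    proof -
      have "0 \<le> x i \<bullet> x j" "x i \<bullet> x j \<le> 1" using x[of i j] that by auto
      then show ?thesis
        using bernoulli_mgf_le[of "x i \<bullet> x j" "w i j"] by (auto simp: f_def)
    qed
    then show ?thesis by (intro prod_mono conjI prod_nonneg) auto
  qed
  also have "\<dots> = exp ((\<Sum>j<n. \<Sum>i<j. (w i j)\<^sup>2) / 8)"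
    by (simp add: exp_sum sum_divide_distrib)
  finally show ?thesis .
qed

text \<open>An entry of the noise matrix. For distinct indices it has conditional mean zero; on the
  diagonal, where a graph has the entry 0, it is minus the squared norm of the latent
  position.\<close>

definition residual :: "real mat \<Rightarrow> (nat \<Rightarrow> real ^ 'd) \<Rightarrow> nat \<Rightarrow> nat \<Rightarrow> real" where
  "residual a x i j = a $$ (i, j) - x i \<bullet> x j"

section \<open>Conditioning one random graph on its latent positions\<close>

locale rdpg_space = prob_space M for M :: "'w measure" +
  fixes n :: nat and \<Omega> :: "(real ^ 'd) set" and F :: "(real ^ 'd) measure"
    and X :: "'w \<Rightarrow> nat \<Rightarrow> real ^ 'd" and A :: "'w \<Rightarrow> real mat"
  assumes latent: "latent_space \<Omega>" and dist: "latent_distribution \<Omega> F" and rdpg: "rdpg n F M X A"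
begin

abbreviation "R \<omega> \<equiv> residual (A \<omega>) (X \<omega>)"
text \<open>Positions with index n or larger are unconstrained by the model, so the conditioning
  \<sigma>-algebra is generated by the family restricted to the vertices.\<close>

abbreviation "XR \<equiv> (\<lambda>\<omega>. \<lambda>i\<in>{..<n}. X \<omega> i)"

lemma A_adj: "\<omega> \<in> space M \<Longrightarrow> A \<omega> \<in> adjacency_matrices n"
  using rdpg by (auto simp: rdpg_def)

lemma X_meas: "i < n \<Longrightarrow> (\<lambda>\<omega>. X \<omega> i) \<in> borel_measurable M"
  using rdpg by (auto simp: rdpg_def indep_vars_def)

lemma A_meas: "i < n \<Longrightarrow> j < n \<Longrightarrow> (\<lambda>\<omega>. A \<omega> $$ (i, j)) \<in> borel_measurable M"
  using rdpg by (auto simp: rdpg_def)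

lemma X_in: "AE \<omega> in M. \<forall>i<n. X \<omega> i \<in> \<Omega>"
proof -
  have "AE \<omega> in M. X \<omega> i \<in> \<Omega>" if "i < n" for i
  proof -
    have "AE x in distr M borel (\<lambda>\<omega>. X \<omega> i). x \<in> \<Omega>"
      using rdpg dist that by (auto simp: rdpg_def latent_distribution_def)
    moreover have "closed \<Omega>" using latent by (auto simp: latent_space_def compact_imp_closed)
    ultimately show ?thesis
      using X_meas[OF that] by (subst (asm) AE_distr_iff) auto
  qed
  then have "AE \<omega> in M. \<forall>i\<in>{..<n}. X \<omega> i \<in> \<Omega>" by (intro AE_finite_allI) auto
  then show ?thesis by (auto elim: AE_mp)
qed

lemma A_event: "a \<in> adjacency_matrices n \<Longrightarrow> {\<omega> \<in> space M. A \<omega> = a} \<in> sets M"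
proof -
  assume a: "a \<in> adjacency_matrices n"
  have "{\<omega> \<in> space M. A \<omega> = a} = {\<omega> \<in> space M. \<forall>i\<in>{..<n}. \<forall>j\<in>{..<n}. A \<omega> $$ (i, j) = a $$ (i, j)}"
  proof (intro Collect_cong conj_cong refl)
    fix \<omega> assume "\<omega> \<in> space M"
    then have "A \<omega> \<in> carrier_mat n n" "a \<in> carrier_mat n n"
      using a A_adj by (auto simp: adjacency_matrices_def)
    then show "(A \<omega> = a) = (\<forall>i\<in>{..<n}. \<forall>j\<in>{..<n}. A \<omega> $$ (i, j) = a $$ (i, j))"
      by (auto intro!: eq_matI)
  qed
  also have "\<dots> \<in> sets M"
    using A_meas by (intro sets.sets_Collect_finite_All) auto
  finally show ?thesis .
qed

abbreviation "\<F> \<equiv> vimage_algebra (space M) XR (Pi\<^sub>M {..<n} (\<lambda>_. borel))"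

lemma subalgebra_F: "finite_measure_subalgebra M \<F>"
proof
  have "XR \<in> measurable M (Pi\<^sub>M {..<n} (\<lambda>_. borel))"
    using X_meas by (intro measurable_restrict) auto
  then have "sets \<F> \<subseteq> sets M" by (intro sets_image_in_sets) auto
  then show "subalgebra M \<F>" by (auto simp: subalgebra_def)
qed

text \<open>The characteristic property of conditional expectation, tested against a bounded
  function of the latent positions: under the integral, the indicator of a graph may be replaced by
  its likelihood. The conditional law enters all later estimates through this exchange.\<close>

lemma integral_cond:
  assumes a: "a \<in> adjacency_matrices n"
    and h: "h \<in> borel_measurable (Pi\<^sub>M {..<n} (\<lambda>_. borel))"
    and bd: "AE \<omega> in M. \<bar>h (XR \<omega>)\<bar> \<le> K"
  shows "integrable M (\<lambda>\<omega>. h (XR \<omega>) * indicator {\<omega> \<in> space M. A \<omega> = a} \<omega>)"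
    and "integrable M (\<lambda>\<omega>. h (XR \<omega>) * edge_likelihood n (X \<omega>) a)"
    and "(\<integral>\<omega>. h (XR \<omega>) * indicator {\<omega> \<in> space M. A \<omega> = a} \<omega> \<partial>M)
      = (\<integral>\<omega>. h (XR \<omega>) * edge_likelihood n (X \<omega>) a \<partial>M)"
proof -
  interpret S: finite_measure_subalgebra M \<F> by (rule subalgebra_F)
  let ?f = "\<lambda>\<omega>. h (XR \<omega>)" and ?g = "indicator {\<omega> \<in> space M. A \<omega> = a} :: 'w \<Rightarrow> real"
  have G: "XR \<in> measurable M (Pi\<^sub>M {..<n} (\<lambda>_. borel))"
    using X_meas by (intro measurable_restrict) auto
  have fF: "?f \<in> borel_measurable \<F>"
    by (rule measurable_compose[OF measurable_vimage_algebra1 h]) (auto simp: space_PiM)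
  have fM: "?f \<in> borel_measurable M" by (rule measurable_compose[OF G h])
  have gM: "?g \<in> borel_measurable M" using A_event[OF a] by simp
  show int: "integrable M (\<lambda>\<omega>. ?f \<omega> * ?g \<omega>)"
  proof (rule integrable_const_bound)
    show "AE \<omega> in M. norm (?f \<omega> * ?g \<omega>) \<le> \<bar>K\<bar>"
      using bd by eventually_elim (auto simp: indicator_def)
  qed (use fM gM in measurable)
  have ae: "AE \<omega> in M. ?f \<omega> * real_cond_exp M \<F> ?g \<omega> = ?f \<omega> * edge_likelihood n (X \<omega>) a"
    using rdpg a by (auto simp: rdpg_def elim!: AE_mp)
  have lik: "(\<lambda>\<omega>. edge_likelihood n (X \<omega>) a) \<in> borel_measurable M"
    unfolding edge_likelihood_def
    using X_meas by (auto intro!: borel_measurable_prod borel_measurable_inner borel_measurable_diff)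
  have m1: "(\<lambda>\<omega>. ?f \<omega> * real_cond_exp M \<F> ?g \<omega>) \<in> borel_measurable M"
    using fM by measurable
  have m2: "(\<lambda>\<omega>. ?f \<omega> * edge_likelihood n (X \<omega>) a) \<in> borel_measurable M"
    using fM lik by measurable
  note R = S.real_cond_exp_intg[OF int fF gM]
  show "integrable M (\<lambda>\<omega>. ?f \<omega> * edge_likelihood n (X \<omega>) a)"
    by (rule integrable_cong_AE_imp[OF R(1) m2]) (use ae in \<open>auto elim!: AE_mp\<close>)
  show "(\<integral>\<omega>. ?f \<omega> * ?g \<omega> \<partial>M) = (\<integral>\<omega>. ?f \<omega> * edge_likelihood n (X \<omega>) a \<partial>M)"
    unfolding R(2)[symmetric] by (rule integral_cong_AE[OF m1 m2 ae])
qed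

text \<open>The weights may depend on the latent positions. Decomposing along the finitely many
  values of \<open>A\<close> leaves functions of the positions alone, to which the exchange of
  indicator and likelihood applies. The conditional bound is uniform over \<Omega>, so it survives
  integration with the deterministic \<open>V\<close>.\<close>

lemma weighted_noise:
  assumes w: "\<And>i j. case_prod (w i j) \<in> borel_measurable (borel \<Otimes>\<^sub>M borel)"
    and V: "\<And>x. \<forall>i<n. x i \<in> \<Omega> \<Longrightarrow> (\<Sum>j<n. \<Sum>i<j. (w i j (x i) (x j))\<^sup>2) \<le> V"
  defines "Z \<equiv> \<lambda>\<omega>. \<Sum>j<n. \<Sum>i<j. w i j (X \<omega> i) (X \<omega> j) * R \<omega> i j"
  shows "Z \<in> borel_measurable M"
    and "integrable M (\<lambda>\<omega>. exp (s * Z \<omega>))"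
    and "expectation (\<lambda>\<omega>. exp (s * Z \<omega>)) \<le> exp (s\<^sup>2 * V / 8)"
proof -
  have wX: "(\<lambda>\<omega>. w i j (X \<omega> i) (X \<omega> j)) \<in> borel_measurable M" if "i < n" "j < n" for i j
    using measurable_compose[OF measurable_Pair[OF X_meas[OF that(1)] X_meas[OF that(2)]] w[of i j]] by simp
  show Zm: "Z \<in> borel_measurable M"
    unfolding Z_def residual_def using wX X_meas A_meas
    by (intro borel_measurable_sum borel_measurable_times borel_measurable_diff borel_measurable_inner) auto
  \<comment> \<open>For a frozen graph \<open>a\<close> the exponential is a function of the
    positions only, hence measurable with respect to the conditioning \<sigma>-algebra.\<close>
  define h where "h a x = exp (\<Sum>j<n. \<Sum>i<j. s * w i j (x i) (x j) * (a $$ (i, j) - x i \<bullet> x j))"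
    for a :: "real mat" and x :: "nat \<Rightarrow> real ^ 'd"
  have wP: "(\<lambda>x. w i j (x i) (x j)) \<in> borel_measurable (Pi\<^sub>M {..<n} (\<lambda>_. borel))" if "i < n" "j < n" for i j
  proof -
    have "(\<lambda>x :: nat \<Rightarrow> real ^ 'd. (x i, x j)) \<in> measurable (Pi\<^sub>M {..<n} (\<lambda>_. borel)) (borel \<Otimes>\<^sub>M borel)"
      using that by (intro measurable_Pair measurable_component_singleton) auto
    from measurable_compose[OF this w[of i j]] show ?thesis by simp
  qed
  have xP: "(\<lambda>x. x i) \<in> borel_measurable (Pi\<^sub>M {..<n} (\<lambda>_. borel :: (real ^ 'd) measure))" if "i < n" for i
    using that by (intro measurable_component_singleton) auto
  have hm: "h a \<in> borel_measurable (Pi\<^sub>M {..<n} (\<lambda>_. borel))" for a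
    unfolding h_def using wP xP
    by (intro borel_measurable_exp borel_measurable_sum borel_measurable_times borel_measurable_diff
        borel_measurable_inner borel_measurable_const measurable_compose[OF _ borel_measurable_exp]) auto
  have hr: "h a (XR \<omega>) = h a (X \<omega>)" for a \<omega>
    unfolding h_def by (intro arg_cong[where f = exp] sum.cong refl) auto
  \<comment> \<open>Any bound that is uniform over graphs and positions serves, since it is used
    only for integrability.\<close>
  define K where "K = exp (\<bar>s\<bar> * (V + real n * real n))"
  have hb: "\<bar>h a x\<bar> \<le> K" if a: "a \<in> adjacency_matrices n" and x: "\<forall>i<n. x i \<in> \<Omega>" for a x
  proof -
    have "(\<Sum>j<n. \<Sum>i<j. s * w i j (x i) (x j) * (a $$ (i, j) - x i \<bullet> x j)) 
      \<le> (\<Sum>j<n. \<Sum>i<j. \<bar>s\<bar> * ((w i j (x i) (x j))\<^sup>2 + 1))"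
    proof (intro sum_mono)
      fix j i assume "j \<in> {..<n}" "i \<in> {..<j}"
      then have ij: "i < n" "j < n" by auto
      have "0 \<le> x i \<bullet> x j \<and> x i \<bullet> x j \<le> 1" using latent x ij by (auto simp: latent_space_def)
      moreover have "a $$ (i, j) = 0 \<or> a $$ (i, j) = 1" using a ij by (auto simp: adjacency_matrices_def)
      ultimately have 1: "\<bar>a $$ (i, j) - x i \<bullet> x j\<bar> \<le> 1" by auto
      \<comment> \<open>Estimating the absolute value by the square plus 1 lets \<open>V\<close>, a
        bound on squares, control the absolute weights as well.\<close>
      have 2: "\<bar>w i j (x i) (x j)\<bar> \<le> (w i j (x i) (x j))\<^sup>2 + 1"
        using zero_le_power2[of "\<bar>w i j (x i) (x j)\<bar> - 1"] unfolding power2_diff by (simp add: power2_eq_square)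
      have "s * w i j (x i) (x j) * (a $$ (i, j) - x i \<bullet> x j) \<le> \<bar>s * w i j (x i) (x j) * (a $$ (i, j) - x i \<bullet> x j)\<bar>"
        by simp
      also have "\<dots> = \<bar>s\<bar> * (\<bar>w i j (x i) (x j)\<bar> * \<bar>a $$ (i, j) - x i \<bullet> x j\<bar>)" by (simp add: abs_mult)
      also have "\<dots> \<le> \<bar>s\<bar> * (((w i j (x i) (x j))\<^sup>2 + 1) * 1)"
        by (intro mult_left_mono mult_mono 1 2) auto
      finally show "s * w i j (x i) (x j) * (a $$ (i, j) - x i \<bullet> x j) \<le> \<bar>s\<bar> * ((w i j (x i) (x j))\<^sup>2 + 1)" by simp
    qed
    also have "\<dots> = \<bar>s\<bar> * ((\<Sum>j<n. \<Sum>i<j. (w i j (x i) (x j))\<^sup>2) + (\<Sum>j<n. real j))"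
      by (simp add: sum.distrib flip: sum_distrib_left)
    also have "\<dots> \<le> \<bar>s\<bar> * (V + (\<Sum>j<n. real n))"
      using V[OF x] by (intro mult_left_mono add_mono sum_mono) auto
    finally show ?thesis by (simp add: h_def K_def)
  qed
  have hbd: "AE \<omega> in M. \<bar>h a (XR \<omega>)\<bar> \<le> K" if "a \<in> adjacency_matrices n" for a
    using X_in unfolding hr by eventually_elim (use hb that in auto)
  note C = integral_cond[OF _ hm hbd, unfolded hr]
  have expZ: "exp (s * Z \<omega>) = (\<Sum>a\<in>adjacency_matrices n. h a (X \<omega>) * indicator {\<omega> \<in> space M. A \<omega> = a} \<omega>)"
    if "\<omega> \<in> space M" for \<omega>
  proof -
    have "(\<Sum>a\<in>adjacency_matrices n. h a (X \<omega>) * indicator {\<omega> \<in> space M. A \<omega> = a} \<omega>) 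
      = (\<Sum>a\<in>adjacency_matrices n. if A \<omega> = a then h a (X \<omega>) else 0)"
      using that by (intro sum.cong) (auto simp: indicator_def)
    also have "\<dots> = h (A \<omega>) (X \<omega>)"
      using A_adj[OF that] finite_adjacency_matrices by simp
    also have "\<dots> = exp (s * Z \<omega>)"
      by (simp add: h_def Z_def residual_def sum_distrib_left mult.assoc)
    finally show ?thesis ..
  qed
  have "integrable M (\<lambda>\<omega>. \<Sum>a\<in>adjacency_matrices n. h a (X \<omega>) * indicator {\<omega> \<in> space M. A \<omega> = a} \<omega>)"
    by (intro Bochner_Integration.integrable_sum C)
  then show "integrable M (\<lambda>\<omega>. exp (s * Z \<omega>))"
    by (subst Bochner_Integration.integrable_cong[OF refl expZ]) auto
  have "expectation (\<lambda>\<omega>. exp (s * Z \<omega>)) 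
     = (\<integral>\<omega>. (\<Sum>a\<in>adjacency_matrices n. h a (X \<omega>) * indicator {\<omega> \<in> space M. A \<omega> = a} \<omega>) \<partial>M)"
    by (intro Bochner_Integration.integral_cong refl expZ)
  also have "\<dots> = (\<Sum>a\<in>adjacency_matrices n. \<integral>\<omega>. h a (X \<omega>) * edge_likelihood n (X \<omega>) a \<partial>M)"
    by (subst Bochner_Integration.integral_sum) (auto intro!: sum.cong C)
  also have "\<dots> = (\<integral>\<omega>. (\<Sum>a\<in>adjacency_matrices n. h a (X \<omega>) * edge_likelihood n (X \<omega>) a) \<partial>M)"
    by (intro Bochner_Integration.integral_sum[symmetric] C)
  also have "\<dots> \<le> (\<integral>\<omega>. exp (s\<^sup>2 * V / 8) \<partial>M)"
  proof (rule integral_mono_AE)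
    show "AE \<omega> in M. (\<Sum>a\<in>adjacency_matrices n. h a (X \<omega>) * edge_likelihood n (X \<omega>) a) \<le> exp (s\<^sup>2 * V / 8)"
      using X_in
    proof eventually_elim
      fix \<omega> assume x: "\<forall>i<n. X \<omega> i \<in> \<Omega>"
      have "(\<Sum>a\<in>adjacency_matrices n. h a (X \<omega>) * edge_likelihood n (X \<omega>) a) 
          \<le> exp ((\<Sum>j<n. \<Sum>i<j. (s * w i j (X \<omega> i) (X \<omega> j))\<^sup>2) / 8)"
        using sum_edge_likelihood_exp_le[of n "X \<omega>" "\<lambda>i j. s * w i j (X \<omega> i) (X \<omega> j)"] latent x
        by (auto simp: h_def latent_space_def mult.commute)
      also have "(\<Sum>j<n. \<Sum>i<j. (s * w i j (X \<omega> i) (X \<omega> j))\<^sup>2) = s\<^sup>2 * (\<Sum>j<n. \<Sum>i<j. (w i j (X \<omega> i) (X \<omega> j))\<^sup>2)"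
        by (simp add: power_mult_distrib sum_distrib_left)
      also have "exp (\<dots> / 8) \<le> exp (s\<^sup>2 * V / 8)"
        using V x by (auto intro!: mult_left_mono divide_right_mono)
      finally show "(\<Sum>a\<in>adjacency_matrices n. h a (X \<omega>) * edge_likelihood n (X \<omega>) a) \<le> exp (s\<^sup>2 * V / 8)" .
    qed
  qed (auto intro!: C Bochner_Integration.integrable_sum)
  also have "\<dots> = exp (s\<^sup>2 * V / 8)" by (simp add: prob_space)
  finally show "expectation (\<lambda>\<omega>. exp (s * Z \<omega>)) \<le> exp (s\<^sup>2 * V / 8)" .
qed

lemma weighted_noise_tail_one_sided:
  assumes w: "\<And>i j. case_prod (w i j) \<in> borel_measurable (borel \<Otimes>\<^sub>M borel)"
    and V: "\<And>x. \<forall>i<n. x i \<in> \<Omega> \<Longrightarrow> (\<Sum>j<n. \<Sum>i<j. (w i j (x i) (x j))\<^sup>2) \<le> V"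
    and t: "0 < t" and V0: "0 < V"
  shows "prob {\<omega> \<in> space M. t \<le> (\<Sum>j<n. \<Sum>i<j. w i j (X \<omega> i) (X \<omega> j) * R \<omega> i j)}
     \<le> exp (- 2 * t\<^sup>2 / V)"
proof -
  let ?Z = "\<lambda>\<omega>. \<Sum>j<n. \<Sum>i<j. w i j (X \<omega> i) (X \<omega> j) * R \<omega> i j"
  \<comment> \<open>This value minimizes the Chernoff exponent - s t + s^2 V / 8.\<close>
  define s where "s = 4 * t / V"
  have s0: "0 < s" using t V0 by (simp add: s_def)
  note W = weighted_noise(2,3)[OF w V, where s = s]
  have "prob {\<omega> \<in> space M. t \<le> ?Z \<omega>} \<le> exp (- s * t) * (\<integral>\<omega>\<in>space M. exp (s * ?Z \<omega>) \<partial>M)"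
    using W(1) s0 by (intro Chernoff_ineq_ge) (auto simp del: real_scaleR_def simp: set_integrable_def intro!: integrable_mult_indicator)
  also have "(\<integral>\<omega>\<in>space M. exp (s * ?Z \<omega>) \<partial>M) = expectation (\<lambda>\<omega>. exp (s * ?Z \<omega>))"
    using W(1) by (simp add: set_integral_space)
  also have "exp (- s * t) * \<dots> \<le> exp (- s * t) * exp (s\<^sup>2 * V / 8)"
    by (intro mult_left_mono W(2)) auto
  also have "\<dots> = exp (- 2 * t\<^sup>2 / V)"
    using V0 by (simp add: s_def power2_eq_square field_simps flip: exp_add)
  finally show ?thesis .
qed

lemma weighted_noise_tail:
  assumes w: "\<And>i j. case_prod (w i j) \<in> borel_measurable (borel \<Otimes>\<^sub>M borel)"
    and V: "\<And>x. \<forall>i<n. x i \<in> \<Omega> \<Longrightarrow> (\<Sum>j<n. \<Sum>i<j. (w i j (x i) (x j))\<^sup>2) \<le> V"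
    and t: "0 < t" and V0: "0 < V"
  shows "prob {\<omega> \<in> space M. t \<le> \<bar>\<Sum>j<n. \<Sum>i<j. w i j (X \<omega> i) (X \<omega> j) * R \<omega> i j\<bar>}
     \<le> 2 * exp (- 2 * t\<^sup>2 / V)"
proof -
  let ?Z = "\<lambda>\<omega>. \<Sum>j<n. \<Sum>i<j. w i j (X \<omega> i) (X \<omega> j) * R \<omega> i j"
  let ?Y = "\<lambda>\<omega>. \<Sum>j<n. \<Sum>i<j. (- w i j (X \<omega> i) (X \<omega> j)) * R \<omega> i j"
  have wm: "case_prod (\<lambda>x y. - w i j x y) \<in> borel_measurable (borel \<Otimes>\<^sub>M borel)" for i j
    using borel_measurable_uminus[OF w[of i j]] by (simp add: case_prod_unfold)
  have Zm: "?Z \<in> borel_measurable M" "?Y \<in> borel_measurable M" 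
    by (rule weighted_noise(1)[OF w V], assumption) (rule weighted_noise(1)[where V = V, OF wm], simp add: V)
  have eq: "{\<omega> \<in> space M. t \<le> \<bar>?Z \<omega>\<bar>} = {\<omega> \<in> space M. t \<le> ?Z \<omega>} \<union> {\<omega> \<in> space M. t \<le> ?Y \<omega>}"
    by (auto simp: sum_negf)
  have "prob {\<omega> \<in> space M. t \<le> \<bar>?Z \<omega>\<bar>} \<le> prob {\<omega> \<in> space M. t \<le> ?Z \<omega>} + prob {\<omega> \<in> space M. t \<le> ?Y \<omega>}"
    unfolding eq using Zm by (intro measure_Un_le) auto
  also have "\<dots> \<le> exp (- 2 * t\<^sup>2 / V) + exp (- 2 * t\<^sup>2 / V)"
    by (intro add_mono weighted_noise_tail_one_sided[OF w V t V0] weighted_noise_tail_one_sided[OF wm _ t V0])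
      (simp_all add: V)
  finally show ?thesis by simp
qed

end

subsection \<open>The cut norm\<close>

text \<open>The cut norm in its sign form, the norm from l-infinity to l-1, which is equivalent to
  the version with subsets up to a constant. Replacing \<sigma> by its negative turns the one-sided
  bound into a bound on the absolute value.\<close>

definition cut_norm_le :: "nat \<Rightarrow> (nat \<Rightarrow> nat \<Rightarrow> real) \<Rightarrow> real \<Rightarrow> bool" where
  "cut_norm_le n r C \<longleftrightarrow> (\<forall>\<sigma> \<tau>. range \<sigma> \<subseteq> {-1, 1} \<and> range \<tau> \<subseteq> {-1, 1} \<longrightarrow>
     (\<Sum>i<n. \<Sum>j<n. \<sigma> i * \<tau> j * r i j) \<le> C)"

text \<open>A bilinear form on a product of two boxes is largest at vertices. The signs \<sigma> are
  read off the row sums weighted by \<open>b\<close>, and then \<tau> off the column sums weighted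
  by \<sigma>.\<close>

lemma bilinear_le_signs:
  fixes r :: "nat \<Rightarrow> nat \<Rightarrow> real"
  assumes C: "cut_norm_le n r C"
    and a: "\<And>i. i < n \<Longrightarrow> \<bar>a i\<bar> \<le> S" and b: "\<And>i. i < n \<Longrightarrow> \<bar>b i\<bar> \<le> T" and "0 \<le> S" "0 \<le> T"
  shows "\<bar>\<Sum>i<n. \<Sum>j<n. a i * b j * r i j\<bar> \<le> S * T * C"
proof -
  define \<sigma> where "\<sigma> i = (if 0 \<le> (\<Sum>j<n. b j * r i j) then 1 else -1 :: real)" for i
  define \<tau> where "\<tau> j = (if 0 \<le> (\<Sum>i<n. \<sigma> i * r i j) then 1 else -1 :: real)" for j
  have "\<bar>\<Sum>i<n. \<Sum>j<n. a i * b j * r i j\<bar> = \<bar>\<Sum>i<n. a i * (\<Sum>j<n. b j * r i j)\<bar>"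
    by (simp add: sum_distrib_left mult.assoc)
  also have "\<dots> \<le> (\<Sum>i<n. \<bar>a i\<bar> * \<bar>\<Sum>j<n. b j * r i j\<bar>)"
    by (rule order_trans[OF sum_abs]) (simp add: abs_mult)
  also have "\<dots> \<le> (\<Sum>i<n. S * (\<sigma> i * (\<Sum>j<n. b j * r i j)))"
    using a \<open>0 \<le> S\<close> by (intro sum_mono mult_mono) (auto simp: \<sigma>_def)
  also have "\<dots> = S * (\<Sum>j<n. b j * (\<Sum>i<n. \<sigma> i * r i j))"
    unfolding sum_distrib_left by (subst sum.swap) (intro sum.cong refl, simp)
  also have "\<dots> \<le> S * (\<Sum>j<n. T * (\<tau> j * (\<Sum>i<n. \<sigma> i * r i j)))"
  proof (intro mult_left_mono sum_mono \<open>0 \<le> S\<close>)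
    fix j assume "j \<in> {..<n}"
    have "b j * (\<Sum>i<n. \<sigma> i * r i j) \<le> \<bar>b j\<bar> * \<bar>\<Sum>i<n. \<sigma> i * r i j\<bar>"
      unfolding abs_mult[symmetric] by (rule abs_ge_self)
    also have "\<dots> \<le> T * (\<tau> j * (\<Sum>i<n. \<sigma> i * r i j))"
      using b \<open>j \<in> {..<n}\<close> \<open>0 \<le> T\<close> by (intro mult_mono) (auto simp: \<tau>_def)
    finally show "b j * (\<Sum>i<n. \<sigma> i * r i j) \<le> T * (\<tau> j * (\<Sum>i<n. \<sigma> i * r i j))" .
  qed
  also have "(\<Sum>j<n. T * (\<tau> j * (\<Sum>i<n. \<sigma> i * r i j))) = T * (\<Sum>i<n. \<Sum>j<n. \<sigma> i * \<tau> j * r i j)"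
    unfolding sum_distrib_left by (subst sum.swap) (intro sum.cong refl, simp)
  also have "S * (T * (\<Sum>i<n. \<Sum>j<n. \<sigma> i * \<tau> j * r i j)) \<le> S * (T * C)"
  proof (intro mult_left_mono)
    have "range \<sigma> \<subseteq> {-1, 1}" "range \<tau> \<subseteq> {-1, 1}" by (auto simp: \<sigma>_def \<tau>_def)
    then show "(\<Sum>i<n. \<Sum>j<n. \<sigma> i * \<tau> j * r i j) \<le> C" using C unfolding cut_norm_le_def by blast
  qed (use \<open>0 \<le> S\<close> \<open>0 \<le> T\<close> in auto)
  finally show ?thesis by (simp add: mult.assoc)
qed

text \<open>The fourth Schatten norm is a sum, over two of the four indices, of bilinear forms in the
  remaining two, each of which is controlled by the cut norm.\<close>

lemma operator_bound_of_signs: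
  fixes r :: "nat \<Rightarrow> nat \<Rightarrow> real"
  assumes C: "cut_norm_le n r C"
    and r: "\<And>i j. i < n \<Longrightarrow> j < n \<Longrightarrow> \<bar>r i j\<bar> \<le> 1"
    and K: "(real n)\<^sup>2 * C \<le> K ^ 4"
  shows "(\<Sum>i<n. (\<Sum>j<n. r i j * v j)\<^sup>2) \<le> K\<^sup>2 * (\<Sum>j<n. (v j)\<^sup>2)"
proof -
  \<comment> \<open>The matrix \<open>q\<close> is r^T r, and the sum of its squared entries is the
    fourth power of the Schatten norm.\<close>
  define q where "q j k = (\<Sum>i<n. r i j * r i k)" for j k
  define S where "S = (\<Sum>i<n. (\<Sum>j<n. r i j * v j)\<^sup>2)"
  define N where "N = (\<Sum>j<n. (v j)\<^sup>2)"
  have N0: "0 \<le> N" by (simp add: N_def sum_nonneg)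
  have "(\<Sum>j<n. \<Sum>k<n. (q j k)\<^sup>2) = (\<Sum>l<n. \<Sum>k<n. r l k * (\<Sum>i<n. \<Sum>j<n. r i k * r l j * r i j))"
  proof -
    have "(\<Sum>j<n. \<Sum>k<n. (q j k)\<^sup>2) = (\<Sum>j<n. \<Sum>k<n. \<Sum>i<n. \<Sum>l<n. r i j * r i k * (r l j * r l k))"
      by (simp add: q_def power2_eq_square sum_product)
    also have "\<dots> = (\<Sum>j<n. \<Sum>k<n. \<Sum>l<n. \<Sum>i<n. r i j * r i k * (r l j * r l k))"
      by (rule sum.cong[OF refl], rule sum.cong[OF refl], rule sum.swap)
    also have "\<dots> = (\<Sum>j<n. \<Sum>l<n. \<Sum>k<n. \<Sum>i<n. r i j * r i k * (r l j * r l k))"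
      by (rule sum.cong[OF refl], rule sum.swap)
    also have "\<dots> = (\<Sum>l<n. \<Sum>j<n. \<Sum>k<n. \<Sum>i<n. r i j * r i k * (r l j * r l k))"
      by (rule sum.swap)
    also have "\<dots> = (\<Sum>l<n. \<Sum>k<n. \<Sum>j<n. \<Sum>i<n. r i j * r i k * (r l j * r l k))"
      by (rule sum.cong[OF refl], rule sum.swap)
    also have "\<dots> = (\<Sum>l<n. \<Sum>k<n. \<Sum>i<n. \<Sum>j<n. r i j * r i k * (r l j * r l k))"
      by (rule sum.cong[OF refl], rule sum.cong[OF refl], rule sum.swap)
    also have "\<dots> = (\<Sum>l<n. \<Sum>k<n. r l k * (\<Sum>i<n. \<Sum>j<n. r i k * r l j * r i j))"
      unfolding sum_distrib_left by (intro sum.cong refl) (simp add: mult_ac)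
    finally show ?thesis .
  qed
  also have "\<dots> \<le> (\<Sum>l<n. \<Sum>k<n. C)"
  proof (intro sum_mono)
    fix l k assume "l \<in> {..<n}" "k \<in> {..<n}"
    then have lk: "\<bar>r l k\<bar> \<le> 1" using r by auto
    have 1: "\<bar>\<Sum>i<n. \<Sum>j<n. r i k * r l j * r i j\<bar> \<le> 1 * 1 * C"
      using \<open>l \<in> {..<n}\<close> \<open>k \<in> {..<n}\<close> r
      by (intro bilinear_le_signs[where a = "\<lambda>i. r i k" and b = "r l" and S = 1 and T = 1, OF C]) auto
    have "r l k * (\<Sum>i<n. \<Sum>j<n. r i k * r l j * r i j) \<le> \<bar>r l k\<bar> * \<bar>\<Sum>i<n. \<Sum>j<n. r i k * r l j * r i j\<bar>"
      unfolding abs_mult[symmetric] by (rule abs_ge_self)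
    also have "\<dots> \<le> 1 * (1 * 1 * C)" by (intro mult_mono lk 1) auto
    finally show "r l k * (\<Sum>i<n. \<Sum>j<n. r i k * r l j * r i j) \<le> C" by simp
  qed
  also have "\<dots> \<le> K ^ 4" using K by (simp add: power2_eq_square)
  finally have q: "(\<Sum>j<n. \<Sum>k<n. (q j k)\<^sup>2) \<le> K ^ 4" .
  have "S = (\<Sum>i<n. \<Sum>j<n. \<Sum>k<n. r i j * v j * (r i k * v k))"
    by (simp add: S_def power2_eq_square sum_product)
  also have "\<dots> = (\<Sum>j<n. \<Sum>i<n. \<Sum>k<n. r i j * v j * (r i k * v k))" by (rule sum.swap)
  also have "\<dots> = (\<Sum>j<n. \<Sum>k<n. \<Sum>i<n. r i j * v j * (r i k * v k))" by (rule sum.cong[OF refl], rule sum.swap)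
  also have "\<dots> = (\<Sum>j<n. v j * (\<Sum>k<n. q j k * v k))"
    by (simp add: q_def sum_distrib_left sum_distrib_right mult_ac)
  \<comment> \<open>\<open>S\<close> is the quadratic form of \<open>q\<close> at \<open>v\<close>.
    Two uses of the Cauchy-Schwarz inequality bound it by the Frobenius norm of
    \<open>q\<close>.\<close>
  finally have "S\<^sup>2 = (\<Sum>j<n. v j * (\<Sum>k<n. q j k * v k))\<^sup>2" by simp
  also have "\<dots> \<le> N * (\<Sum>j<n. (\<Sum>k<n. q j k * v k)\<^sup>2)"
    unfolding N_def by (rule Cauchy_Schwarz_ineq_sum)
  also have "\<dots> \<le> N * (\<Sum>j<n. (\<Sum>k<n. (q j k)\<^sup>2) * N)"
    unfolding N_def by (intro mult_left_mono sum_mono Cauchy_Schwarz_ineq_sum) (simp add: sum_nonneg)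
  also have "\<dots> = N\<^sup>2 * (\<Sum>j<n. \<Sum>k<n. (q j k)\<^sup>2)"
    by (simp add: power2_eq_square flip: sum_distrib_right)
  also have "\<dots> \<le> N\<^sup>2 * K ^ 4" by (intro mult_left_mono q) auto
  also have "\<dots> = (K\<^sup>2 * N)\<^sup>2" by (simp add: power_mult_distrib flip: power_mult)
  finally have "S \<le> K\<^sup>2 * N" by (rule power2_le_imp_le) (use N0 in simp)
  then show ?thesis by (simp add: S_def N_def)
qed

subsection \<open>Square matrices acting on finitely supported sequences\<close>

text \<open>A single inner product space that contains all the spaces of \<open>n\<close>-tuples.\<close>

typedef fseq = "{f :: nat \<Rightarrow> real. finite {i. f i \<noteq> 0}}"
  morphisms nth_seq Abs_fseq by (rule exI[of _ "\<lambda>_. 0"]) auto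

setup_lifting type_definition_fseq

lemma finite_support [simp]: "finite {i. nth_seq v i \<noteq> 0}"
  using nth_seq[of v] by simp

lemma fseq_eqI: "(\<And>i. nth_seq v i = nth_seq w i) \<Longrightarrow> v = w"
  by (simp add: nth_seq_inject[symmetric] fun_eq_iff)

instantiation fseq :: real_vector
begin

lift_definition zero_fseq :: fseq is "\<lambda>_. 0" by auto

lift_definition plus_fseq :: "fseq \<Rightarrow> fseq \<Rightarrow> fseq" is "\<lambda>f g i. f i + g i"
  subgoal for f g by (rule finite_subset[of _ "{i. f i \<noteq> 0} \<union> {i. g i \<noteq> 0}"]) auto
  done

lift_definition minus_fseq :: "fseq \<Rightarrow> fseq \<Rightarrow> fseq" is "\<lambda>f g i. f i - g i"
  subgoal for f g by (rule finite_subset[of _ "{i. f i \<noteq> 0} \<union> {i. g i \<noteq> 0}"]) auto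
  done

lift_definition uminus_fseq :: "fseq \<Rightarrow> fseq" is "\<lambda>f i. - f i" by simp

lift_definition scaleR_fseq :: "real \<Rightarrow> fseq \<Rightarrow> fseq" is "\<lambda>a f i. a * f i"
  subgoal for a f by (rule finite_subset[of _ "{i. f i \<noteq> 0}"]) auto
  done

lemmas nth_seq_simps = zero_fseq.rep_eq plus_fseq.rep_eq minus_fseq.rep_eq uminus_fseq.rep_eq scaleR_fseq.rep_eq

instance
proof
  fix u v w :: fseq and a b :: real
  show "u + v + w = u + (v + w)" "u + v = v + u" "0 + u = u" "- u + u = 0" "u - v = u + - v"
    "a *\<^sub>R (u + v) = a *\<^sub>R u + a *\<^sub>R v" "(a + b) *\<^sub>R u = a *\<^sub>R u + b *\<^sub>R u"
    "a *\<^sub>R b *\<^sub>R u = (a * b) *\<^sub>R u" "1 *\<^sub>R u = u"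
    by (rule fseq_eqI; simp add: nth_seq_simps algebra_simps)+
qed

end

instantiation fseq :: real_inner
begin

text \<open>Summing over the support of one argument avoids any reference to a dimension;
  \<open>inner_fseq_superset\<close> then allows a common finite index set for several
  vectors.\<close>

definition inner_fseq :: "fseq \<Rightarrow> fseq \<Rightarrow> real" where
  "inner_fseq v w = (\<Sum>i | nth_seq v i \<noteq> 0. nth_seq v i * nth_seq w i)"

definition norm_fseq :: "fseq \<Rightarrow> real" where "norm_fseq v = sqrt (inner v v)"
definition sgn_fseq :: "fseq \<Rightarrow> fseq" where "sgn_fseq v = v /\<^sub>R norm v"
definition dist_fseq :: "fseq \<Rightarrow> fseq \<Rightarrow> real" where "dist_fseq v w = norm (v - w)"
definition uniformity_fseq :: "(fseq \<times> fseq) filter" where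
  "uniformity_fseq = (INF e\<in>{0<..}. principal {(v, w). dist v w < e})"
definition open_fseq :: "fseq set \<Rightarrow> bool" where
  "open_fseq U \<longleftrightarrow> (\<forall>v\<in>U. eventually (\<lambda>(v', w). v' = v \<longrightarrow> w \<in> U) uniformity)"

lemma inner_fseq_superset:
  assumes "finite S" "{i. nth_seq v i \<noteq> 0} \<subseteq> S"
  shows "inner v w = (\<Sum>i\<in>S. nth_seq v i * nth_seq w i)"
  unfolding inner_fseq_def by (rule sum.mono_neutral_left[OF assms]) auto

instance
proof
  fix u v w :: fseq and a :: real
  define S where "S = {i. nth_seq u i \<noteq> 0} \<union> {i. nth_seq v i \<noteq> 0} \<union> {i. nth_seq w i \<noteq> 0}"
  have S: "finite S" by (simp add: S_def)
  have u: "inner u q = (\<Sum>i\<in>S. nth_seq u i * nth_seq q i)" for q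
    by (rule inner_fseq_superset[OF S]) (auto simp: S_def)
  have v: "inner v q = (\<Sum>i\<in>S. nth_seq v i * nth_seq q i)" for q
    by (rule inner_fseq_superset[OF S]) (auto simp: S_def)
  have uv: "inner (u + v) q = (\<Sum>i\<in>S. nth_seq (u + v) i * nth_seq q i)" for q
    by (rule inner_fseq_superset[OF S]) (auto simp: S_def nth_seq_simps)
  have au: "inner (a *\<^sub>R u) q = (\<Sum>i\<in>S. nth_seq (a *\<^sub>R u) i * nth_seq q i)" for q
    by (rule inner_fseq_superset[OF S]) (auto simp: S_def nth_seq_simps)
  show "inner u v = inner v u"
    unfolding u v by (simp add: mult.commute)
  show "inner (u + v) w = inner u w + inner v w"
    unfolding uv u v by (simp add: nth_seq_simps distrib_right sum.distrib)
  show "inner (a *\<^sub>R u) v = a * inner u v"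
    unfolding au u by (simp add: nth_seq_simps sum_distrib_left mult.assoc)
  show "0 \<le> inner u u" unfolding inner_fseq_def by (intro sum_nonneg) auto
  show "inner u u = 0 \<longleftrightarrow> u = 0"
  proof
    assume "inner u u = 0"
    then have "nth_seq u i * nth_seq u i = 0" if "nth_seq u i \<noteq> 0" for i
      using that unfolding inner_fseq_def by (subst (asm) sum_nonneg_eq_0_iff) auto
    then show "u = 0" by (intro fseq_eqI) (auto simp: nth_seq_simps)
  next
    assume "u = 0"
    then show "inner u u = 0" by (simp add: inner_fseq_def nth_seq_simps)
  qed
qed (simp_all only: norm_fseq_def sgn_fseq_def dist_fseq_def uniformity_fseq_def open_fseq_def)

end

section \<open>Tuples and square matrices as vectors and operators\<close>

lift_definition tup :: "nat \<Rightarrow> (nat \<Rightarrow> real) \<Rightarrow> fseq" is "\<lambda>n f i. if i < n then f i else 0"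
  subgoal for n f by (rule finite_subset[of _ "{..<n}"]) (auto split: if_splits)
  done

lemmas nth_tup = tup.rep_eq

lemma inner_tup_left: "tup n f \<bullet> v = (\<Sum>i<n. f i * nth_seq v i)"
proof -
  have "tup n f \<bullet> v = (\<Sum>i<n. nth_seq (tup n f) i * nth_seq v i)"
    by (rule inner_fseq_superset) (auto simp: nth_tup)
  then show ?thesis by (simp add: nth_tup)
qed

lemma inner_tup: "tup n f \<bullet> tup n g = (\<Sum>i<n. f i * g i)"
  by (simp add: inner_tup_left nth_tup)

lemma norm_tup: "(norm (tup n f))\<^sup>2 = (\<Sum>i<n. (f i)\<^sup>2)"
  unfolding power2_norm_eq_inner inner_tup by (simp add: power2_eq_square)

lemma norm_restrict_le: "(\<Sum>i<n. (nth_seq v i)\<^sup>2) \<le> (norm v)\<^sup>2"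
proof -
  let ?S = "{i. nth_seq v i \<noteq> 0} \<union> {..<n}"
  have "(norm v)\<^sup>2 = (\<Sum>i\<in>?S. nth_seq v i * nth_seq v i)"
    unfolding power2_norm_eq_inner by (rule inner_fseq_superset) auto
  then show ?thesis by (simp add: power2_eq_square) (rule sum_mono2, auto)
qed

lemma nth_sum: "nth_seq (\<Sum>k\<in>I. f k) i = (\<Sum>k\<in>I. nth_seq (f k) i)"
  by (induction I rule: infinite_finite_induct) (auto simp: nth_seq_simps)

text \<open>Coordinates from n on are annihilated, so a norm bound for n-tuples extends to the whole
  space by \<open>norm_restrict_le\<close>.\<close>

definition matop :: "nat \<Rightarrow> (nat \<Rightarrow> nat \<Rightarrow> real) \<Rightarrow> fseq \<Rightarrow> fseq" where
  "matop n m v = tup n (\<lambda>i. \<Sum>j<n. m i j * nth_seq v j)"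

lemma nth_matop: "nth_seq (matop n m v) i = (if i < n then \<Sum>j<n. m i j * nth_seq v j else 0)"
  by (simp add: matop_def nth_tup)

lemma matop_tup: "matop n m (tup n f) = tup n (\<lambda>i. \<Sum>j<n. m i j * f j)"
  by (rule fseq_eqI) (simp add: nth_matop nth_tup)

lemma linear_matop: "linear (matop n m)"
  by (rule linearI; rule fseq_eqI)
    (simp_all add: nth_matop nth_seq_simps distrib_left sum.distrib sum_distrib_left mult_ac)

lemma matop_compose:
  "matop n m (matop n m' v) = matop n (\<lambda>i k. \<Sum>j<n. m i j * m' j k) v"
proof (rule fseq_eqI)
  fix i
  have "(\<Sum>j<n. m i j * (\<Sum>k<n. m' j k * nth_seq v k)) = (\<Sum>k<n. (\<Sum>j<n. m i j * m' j k) * nth_seq v k)"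
    unfolding sum_distrib_left sum_distrib_right by (subst sum.swap) (simp add: mult.assoc)
  then show "nth_seq (matop n m (matop n m' v)) i = nth_seq (matop n (\<lambda>i k. \<Sum>j<n. m i j * m' j k) v) i"
    by (simp add: nth_matop)
qed

lemma inner_matop: "v \<bullet> matop n m w = (\<Sum>i<n. \<Sum>j<n. m i j * (nth_seq v i * nth_seq w j))"
  by (subst inner_commute) (simp add: matop_def inner_tup_left sum_distrib_left sum_distrib_right mult_ac)

lemma matop_sym:
  assumes "\<And>i j. i < n \<Longrightarrow> j < n \<Longrightarrow> m i j = m j i"
  shows "matop n m v \<bullet> w = v \<bullet> matop n m w"
proof -
  have "matop n m v \<bullet> w = (\<Sum>i<n. \<Sum>j<n. m i j * (nth_seq w i * nth_seq v j))"
    by (subst inner_commute) (rule inner_matop)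
  also have "\<dots> = (\<Sum>j<n. \<Sum>i<n. m i j * (nth_seq w i * nth_seq v j))" by (rule sum.swap)
  also have "\<dots> = v \<bullet> matop n m w"
    unfolding inner_matop by (intro sum.cong refl) (use assms in auto)
  finally show ?thesis .
qed

lemma matop_cong: "(\<And>i j. i < n \<Longrightarrow> j < n \<Longrightarrow> m i j = m' i j) \<Longrightarrow> matop n m = matop n m'"
  by (intro ext fseq_eqI) (auto simp: nth_matop)

text \<open>Serves twice: for the spectral decomposition of the modulus of the adjacency matrix, and
  for writing the signal matrix as a sum over the columns of the rotated positions.\<close>

lemma matop_rank_one_sum:
  assumes "\<And>i j. i < n \<Longrightarrow> j < n \<Longrightarrow> m i j = (\<Sum>k\<in>I. a k * (f k i * f k j))"
  shows "matop n m v = (\<Sum>k\<in>I. (a k * (tup n (f k) \<bullet> v)) *\<^sub>R tup n (f k))"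
proof (rule fseq_eqI)
  fix i
  have "(\<Sum>j<n. (\<Sum>k\<in>I. a k * (f k i * f k j)) * nth_seq v j) = (\<Sum>k\<in>I. a k * (\<Sum>j<n. f k j * nth_seq v j) * f k i)"
    unfolding sum_distrib_left sum_distrib_right by (subst sum.swap) (simp add: mult_ac)
  then show "nth_seq (matop n m v) i = nth_seq (\<Sum>k\<in>I. (a k * (tup n (f k) \<bullet> v)) *\<^sub>R tup n (f k)) i"
    using assms by (simp add: nth_matop nth_sum nth_seq_simps nth_tup inner_tup_left)
qed

text \<open>The embedding is built from the modulus of \<open>A\<close>, whose square is the square
  of \<open>A\<close>. What is retained are orthonormal eigenvectors of \<open>A\<close> squared;
  the signs of the eigenvalues of \<open>A\<close> are lost at this point and have to be recovered
  by other means.\<close>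

lemma ase_eigenstructure:
  fixes Xh :: "nat \<Rightarrow> real ^ 'd"
  assumes A: "A \<in> adjacency_matrices n" and ase: "is_ase pos n A Xh"
  obtains u lam where
    "\<And>k l. k < n \<Longrightarrow> l < n \<Longrightarrow> u k \<bullet> u l = (if k = l then 1 else 0)"
    "\<And>k. k < n \<Longrightarrow> 0 \<le> lam k" "\<And>i j. i \<le> j \<Longrightarrow> j < n \<Longrightarrow> lam j \<le> lam i"
    "\<And>v. matop n (\<lambda>i j. A $$ (i, j)) (matop n (\<lambda>i j. A $$ (i, j)) v) = (\<Sum>m<n. ((lam m)\<^sup>2 * (u m \<bullet> v)) *\<^sub>R u m)"
    "\<And>k. tup n (\<lambda>i. Xh i $ k) = sqrt (lam (pos k)) *\<^sub>R u (pos k)"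
proof -
  obtain B U lam where B: "is_abs_mat n A B" and U: "U \<in> carrier_mat n n" "transpose_mat U * U = 1\<^sub>m n"
    and BU: "B = U * mat_diag n lam * transpose_mat U"
    and dec: "\<forall>i j. i \<le> j \<and> j < n \<longrightarrow> lam j \<le> lam i"
    and Xh: "\<forall>i<n. Xh i = (\<chi> k. U $$ (i, pos k) * sqrt (lam (pos k)))"
    using ase unfolding is_ase_def by blast
  define u where "u m = tup n (\<lambda>i. U $$ (i, m))" for m
  have Ac: "A \<in> carrier_mat n n" and At: "transpose_mat A = A"
    using A by (auto simp: adjacency_matrices_def intro!: eq_matI)
  have Bc: "B \<in> carrier_mat n n" and BB: "B * B = A * A"
    and psd: "\<And>v. v \<in> carrier_vec n \<Longrightarrow> 0 \<le> scalar_prod v (B *\<^sub>v v)"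
    using B At by (auto simp: is_abs_mat_def)
  have orth: "u k \<bullet> u l = (if k = l then 1 else 0)" if "k < n" "l < n" for k l
  proof -
    have "u k \<bullet> u l = (transpose_mat U * U) $$ (k, l)"
      using that U(1) by (simp add: u_def inner_tup scalar_prod_def lessThan_atLeast0)
    then show ?thesis using U(2) that by simp
  qed
  have Bij: "B $$ (i, j) = (\<Sum>m<n. lam m * (U $$ (i, m) * U $$ (j, m)))" if "i < n" "j < n" for i j
    using that U(1) unfolding BU
    by (simp add: mat_diag_mult_right[OF U(1)] scalar_prod_def lessThan_atLeast0 mult_ac)
  let ?B = "matop n (\<lambda>i j. B $$ (i, j))" and ?A = "matop n (\<lambda>i j. A $$ (i, j))"
  have Bop: "?B v = (\<Sum>m<n. (lam m * (u m \<bullet> v)) *\<^sub>R u m)" for v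
    unfolding u_def by (rule matop_rank_one_sum) (rule Bij)
  have uB: "u k \<bullet> ?B v = lam k * (u k \<bullet> v)" if "k < n" for k v
    using that by (simp add: Bop inner_sum_right orth if_distrib cong: if_cong)
  have lam0: "0 \<le> lam k" if "k < n" for k
  proof -
    have "0 \<le> scalar_prod (vec n (\<lambda>i. U $$ (i, k))) (B *\<^sub>v vec n (\<lambda>i. U $$ (i, k)))" by (rule psd) simp
    also have "\<dots> = u k \<bullet> ?B (u k)"
      using Bc by (simp add: scalar_prod_def inner_matop u_def nth_tup lessThan_atLeast0 sum_distrib_left mult_ac)
    also have "\<dots> = lam k" using that by (simp add: uB orth)
    finally show ?thesis .
  qed
  have comp: "matop n (\<lambda>i j. C $$ (i, j)) (matop n (\<lambda>i j. C $$ (i, j)) v) = matop n (\<lambda>i j. (C * C) $$ (i, j)) v"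
    if "C \<in> carrier_mat n n" for C :: "real mat" and v
    unfolding matop_compose
    by (rule fun_cong[OF matop_cong]) (use that in \<open>simp add: scalar_prod_def lessThan_atLeast0\<close>)
  have "?A (?A v) = (\<Sum>m<n. ((lam m)\<^sup>2 * (u m \<bullet> v)) *\<^sub>R u m)" for v
  proof -
    have "?A (?A v) = ?B (?B v)" unfolding comp[OF Ac] comp[OF Bc] BB ..
    also have "\<dots> = (\<Sum>m<n. ((lam m)\<^sup>2 * (u m \<bullet> v)) *\<^sub>R u m)"
      by (subst (1) Bop) (intro sum.cong refl, simp add: uB power2_eq_square)
    finally show ?thesis .
  qed
  moreover have "tup n (\<lambda>i. Xh i $ k) = sqrt (lam (pos k)) *\<^sub>R u (pos k)" for k
    by (rule fseq_eqI) (use Xh in \<open>simp add: nth_tup nth_seq_simps u_def mult.commute\<close>)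
  ultimately show thesis using that[of u lam] orth lam0 dec by blast
qed

subsection \<open>The adjacency spectral embedding\<close>

abbreviation tp :: "real ^ 'd ^ 'd \<Rightarrow> real ^ 'd ^ 'd" where
  "tp \<equiv> Finite_Cartesian_Product.transpose"

lemma inner_transpose_orthogonal:
  fixes W :: "real ^ 'd ^ 'd"
  assumes "orthogonal_matrix W"
  shows "(tp W *v a) \<bullet> (tp W *v b) = a \<bullet> b"
proof -
  have "W ** tp W = Finite_Cartesian_Product.mat 1"
    using assms by (simp add: orthogonal_matrix_def)
  then have "W *v (tp W *v b) = b"
    by (simp add: matrix_vector_mul_assoc del: transpose_matrix_vector)
  moreover have "(tp W *v a) \<bullet> w = a \<bullet> (W *v w)" for w
    unfolding transpose_matrix_vector by (rule dot_lmul_matrix)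
  ultimately show ?thesis by simp
qed

text \<open>\<open>W\<close> diagonalizes the Gram matrix, and the Gram matrix of the rotated rows
  is its conjugate by \<open>W\<close>. So the columns of X W are orthogonal with squared norms
  \<open>s\<close>.\<close>

lemma gram_rotated:
  fixes x :: "nat \<Rightarrow> real ^ 'd" and W :: "real ^ 'd ^ 'd"
  assumes "orthogonal_matrix W"
    and eig: "W ** (\<chi> k l. if k = l then s $ k else 0) ** tp W = gram_matrix n x"
  shows "(\<Sum>i<n. (tp W *v x i) $ k * (tp W *v x i) $ l)
    = (if k = l then s $ k else 0)"
proof -
  let ?T = "tp W" and ?D = "(\<chi> k l. if k = l then s $ k else 0) :: real ^ 'd ^ 'd"
  have "(\<Sum>i<n. (?T *v x i) $ k * (?T *v x i) $ l) = (\<Sum>i<n. \<Sum>a\<in>UNIV. \<Sum>b\<in>UNIV. W $ a $ k * x i $ a * (W $ b $ l * x i $ b))"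
    by (simp add: matrix_vector_mult_def Finite_Cartesian_Product.transpose_def sum_product)
  also have "\<dots> = (\<Sum>a\<in>UNIV. \<Sum>i<n. \<Sum>b\<in>UNIV. W $ a $ k * x i $ a * (W $ b $ l * x i $ b))"
    by (rule sum.swap)
  also have "\<dots> = (\<Sum>a\<in>UNIV. \<Sum>b\<in>UNIV. \<Sum>i<n. W $ a $ k * x i $ a * (W $ b $ l * x i $ b))"
    by (rule sum.cong[OF refl], rule sum.swap)
  also have "\<dots> = (\<Sum>a\<in>UNIV. \<Sum>b\<in>UNIV. W $ a $ k * gram_matrix n x $ a $ b * W $ b $ l)"
    by (simp add: gram_matrix_def sum_distrib_left sum_distrib_right mult_ac)
  also have "\<dots> = (\<Sum>b\<in>UNIV. \<Sum>a\<in>UNIV. W $ a $ k * gram_matrix n x $ a $ b * W $ b $ l)"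
    by (rule sum.swap)
  also have "\<dots> = (?T ** gram_matrix n x ** W) $ k $ l"
    by (simp add: matrix_matrix_mult_def Finite_Cartesian_Product.transpose_def sum_distrib_right)
  also have "?T ** gram_matrix n x ** W = (?T ** W) ** ?D ** (?T ** W)"
    unfolding eig[symmetric] by (simp add: matrix_mul_assoc)
  also have "\<dots> = ?D" using assms(1) by (simp add: orthogonal_matrix_def)
  finally show ?thesis by simp
qed

text \<open>This instantiates the perturbation result for a concrete graph after rescaling. The
  third conclusion bounds the entries of the embedding by a constant independent of n; it later
  confines the embedded points to a fixed ball on which the Taylor remainder is uniform.\<close>

lemma embedding_expansion:
  fixes Xh x :: "nat \<Rightarrow> real ^ 'd" and W :: "real ^ 'd ^ 'd" and s :: "real ^ 'd" and pos :: "'d \<Rightarrow> nat"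
  assumes pos: "bij_betw pos UNIV {..<CARD('d)}" and n: "CARD('d) \<le> n"
    and A: "A \<in> adjacency_matrices n" and ase: "is_ase pos n A Xh"
    and W: "orthogonal_matrix W"
    and eig: "W ** (\<chi> k l. if k = l then s $ k else 0) ** tp W = gram_matrix n x"
    and sdec: "\<And>k l. pos k \<le> pos l \<Longrightarrow> s $ l \<le> s $ k"
    and sign: "sign_compatible n Xh x W"
    and y: "\<And>k i. y k i = (tp W *v x i) $ k / sqrt n"
    and c: "0 < c" and s_ge: "\<And>k. c \<le> s $ k / n" and s_le: "\<And>k. s $ k / n \<le> 1"
    and gap: "\<And>k l. k \<noteq> l \<Longrightarrow> c \<le> \<bar>s $ k / n - s $ l / n\<bar>"
    and e: "0 \<le> e" "e \<le> c\<^sup>2 / 20"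
    and op: "\<And>v. (\<Sum>i<n. (\<Sum>j<n. residual A x i j * v j)\<^sup>2) \<le> (e * n)\<^sup>2 * (\<Sum>j<n. (v j)\<^sup>2)"
    and \<beta>: "0 \<le> \<beta>" "\<beta> \<le> 1" and By: "\<And>k. (\<Sum>i<n. (\<Sum>j<n. residual A x i j * y k j)\<^sup>2) \<le> (\<beta> * n)\<^sup>2"
    and yBy: "\<And>k l. \<bar>\<Sum>i<n. \<Sum>j<n. y k i * y l j * residual A x i j\<bar> \<le> \<gamma> * n"
  shows "(\<Sum>i<n. (Xh i $ k / sqrt n - y k i)\<^sup>2) \<le> (first_order_const CARD('d) c * \<beta>)\<^sup>2" (is ?first)
    and "(\<Sum>i<n. (Xh i $ k / sqrt n - y k i - (\<Sum>j<n. residual A x i j * y k j) / s $ k)\<^sup>2)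
      \<le> (second_order_const CARD('d) c * (\<gamma> + \<beta>\<^sup>2 + e * \<beta>))\<^sup>2" (is ?second)
    and "i < n \<Longrightarrow> \<bar>Xh i $ k\<bar> \<le> sqrt (2 / c)" (is "_ \<Longrightarrow> ?bd")
proof -
  have n0: "0 < real n" using n zero_less_card_finite[where 'a = 'd] by linarith
  obtain u lam where u: "\<And>k l. k < n \<Longrightarrow> l < n \<Longrightarrow> u k \<bullet> u l = (if k = l then 1 else 0)"
    and lam0: "\<And>k. k < n \<Longrightarrow> 0 \<le> lam k" and ldec: "\<And>i j. i \<le> j \<Longrightarrow> j < n \<Longrightarrow> lam j \<le> lam i"
    and AA: "\<And>v. matop n (\<lambda>i j. A $$ (i, j)) (matop n (\<lambda>i j. A $$ (i, j)) v) = (\<Sum>m<n. ((lam m)\<^sup>2 * (u m \<bullet> v)) *\<^sub>R u m)"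
    and Xhu: "\<And>k. tup n (\<lambda>i. Xh i $ k) = sqrt (lam (pos k)) *\<^sub>R u (pos k)"
    using ase_eigenstructure[OF A ase] by blast
  have Asym: "A $$ (i, j) = A $$ (j, i)" if "i < n" "j < n" for i j
    using A that by (auto simp: adjacency_matrices_def)
  have A01: "\<bar>A $$ (i, j)\<bar> \<le> 1" if "i < n" "j < n" for i j
  proof -
    have "A $$ (i, j) = 0 \<or> A $$ (i, j) = 1" using A that by (auto simp: adjacency_matrices_def)
    then show ?thesis by auto
  qed
  let ?A = "matop n (\<lambda>i j. A $$ (i, j))"
  define A' where "A' = matop n (\<lambda>i j. A $$ (i, j) / n)"
  define B where "B = matop n (\<lambda>i j. residual A x i j / n)"
  define yv where "yv k = tup n (y k)" for k
  define P where "P v = (\<Sum>l\<in>UNIV. (yv l \<bullet> v) *\<^sub>R yv l)" for v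
  define xv where "xv k = tup n (\<lambda>i. Xh i $ k / sqrt n)" for k
  define t where "t k = s $ k / n" for k
  have A'eq: "A' v = (1 / n) *\<^sub>R ?A v" for v
    by (rule fseq_eqI) (simp add: A'_def nth_matop nth_seq_simps sum_divide_distrib)
  have A'norm: "(norm (A' v))\<^sup>2 = (\<Sum>m<n. (lam m / n)\<^sup>2 * (u m \<bullet> v)\<^sup>2)" for v
  proof -
    have "(norm (?A v))\<^sup>2 = v \<bullet> ?A (?A v)"
      unfolding power2_norm_eq_inner by (rule matop_sym) (rule Asym)
    also have "\<dots> = (\<Sum>m<n. (lam m)\<^sup>2 * (u m \<bullet> v)\<^sup>2)"
      unfolding AA inner_sum_right by (intro sum.cong refl) (simp add: power2_eq_square inner_commute)
    finally show ?thesis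
      by (simp add: A'eq power_divide sum_divide_distrib)
  qed
  have A'A': "A' (A' (u m)) = (lam m / n)\<^sup>2 *\<^sub>R u m" if "m < n" for m
  proof -
    have "?A (?A (u m)) = (lam m)\<^sup>2 *\<^sub>R u m"
      unfolding AA using that by (simp add: u if_distrib[of "\<lambda>q. q *\<^sub>R _"] if_distrib[of "\<lambda>q. _ * q"] cong: if_cong)
    then show ?thesis
      by (simp add: A'eq linear_scale[OF linear_matop] power2_eq_square)
  qed
  have yy: "yv k \<bullet> yv l = (if k = l then t k else 0)" for k l
  proof -
    have "yv k \<bullet> yv l = (\<Sum>i<n. (tp W *v x i) $ k * (tp W *v x i) $ l) / n"
      unfolding yv_def inner_tup y sum_divide_distrib using n0 by (intro sum.cong) auto
    also have "\<dots> = (if k = l then t k else 0)" unfolding gram_rotated[OF W eig] by (simp add: t_def)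
    finally show ?thesis .
  qed
  have t0: "0 < t k" for k using s_ge[of k] c by (simp add: t_def)
  have split: "A' v = P v + B v" for v
  proof -
    \<comment> \<open>Orthogonality of \<open>W\<close> preserves the inner products of the latent
      positions, so the signal is the sum of the rank-one operators given by the rotated
      columns.\<close>
    have "P v = matop n (\<lambda>i j. x i \<bullet> x j / n) v"
    proof -
      have "matop n (\<lambda>i j. x i \<bullet> x j / n) v = (\<Sum>k\<in>UNIV. (1 * (tup n (y k) \<bullet> v)) *\<^sub>R tup n (y k))"
      proof (rule matop_rank_one_sum)
        fix i j
        have "x i \<bullet> x j / n = ((tp W *v x i) \<bullet> (tp W *v x j)) / n"
          by (simp only: inner_transpose_orthogonal[OF W])
        also have "\<dots> = (\<Sum>k\<in>UNIV. 1 * (y k i * y k j))"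
          unfolding y inner_vec_def sum_divide_distrib using n0 by (intro sum.cong) auto
        finally show "x i \<bullet> x j / n = (\<Sum>k\<in>UNIV. 1 * (y k i * y k j))" .
      qed
      then show ?thesis by (simp add: P_def yv_def)
    qed
    then show ?thesis
      by (intro fseq_eqI) (simp add: A'_def B_def nth_matop nth_seq_simps residual_def diff_divide_distrib
          left_diff_distrib sum_subtractf)
  qed
  have Bnorm: "norm (B v) \<le> e * norm v" for v
  proof -
    have "(norm (B v))\<^sup>2 = (\<Sum>i<n. (\<Sum>j<n. residual A x i j * nth_seq v j)\<^sup>2) / n\<^sup>2"
      by (simp add: B_def matop_def norm_tup power_divide flip: sum_divide_distrib)
    also have "\<dots> \<le> (e * n)\<^sup>2 * (\<Sum>j<n. (nth_seq v j)\<^sup>2) / n\<^sup>2"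
      by (intro divide_right_mono op) auto
    also have "\<dots> = e\<^sup>2 * (\<Sum>j<n. (nth_seq v j)\<^sup>2)" using n0 by (simp add: power_mult_distrib)
    also have "\<dots> \<le> e\<^sup>2 * (norm v)\<^sup>2" by (intro mult_left_mono norm_restrict_le) auto
    finally have "(norm (B v))\<^sup>2 \<le> (e * norm v)\<^sup>2" by (simp add: power_mult_distrib)
    then show ?thesis by (rule power2_le_imp_le) (use e in simp)
  qed
  \<comment> \<open>Inverting \<open>pos\<close> numbers the columns of P by 0, ..., d - 1, as the
    comparison of ordered singular values requires; \<open>h\<close> below normalizes these
    columns.\<close>
  define q where "q = the_inv_into UNIV pos"
  have qpos: "q (pos k) = k" for k
    unfolding q_def using pos by (intro the_inv_into_f_f) (auto simp: bij_betw_def)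
  have posq: "pos (q j) = j" if "j < CARD('d)" for j
    unfolding q_def using pos that by (intro f_the_inv_into_f) (auto simp: bij_betw_def)
  have posn: "pos k < CARD('d)" "pos k < n" for k
  proof -
    show "pos k < CARD('d)" using pos by (auto simp: bij_betw_def)
    then show "pos k < n" using n by linarith
  qed
  define h where "h j = (1 / sqrt (t (q j))) *\<^sub>R yv (q j)" for j
  have h: "h i \<bullet> h j = (if i = j then 1 else 0)" if "i < CARD('d)" "j < CARD('d)" for i j
  proof (cases "i = j")
    case True
    then show ?thesis using t0[of "q i"] by (simp add: h_def yy real_sqrt_mult_self flip: power2_eq_square)
  next
    case False
    then have "q i \<noteq> q j" using posq that by metis
    then show ?thesis using False by (simp add: h_def yy)
  qed
  have Pnorm: "(norm (P v))\<^sup>2 = (\<Sum>j<CARD('d). (t (q j))\<^sup>2 * (h j \<bullet> v)\<^sup>2)" for v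
  proof -
    have "yv k \<bullet> P v = t k * (yv k \<bullet> v)" for k
      by (simp add: P_def inner_sum_right yy if_distrib cong: if_cong)
    then have "(norm (P v))\<^sup>2 = (\<Sum>k\<in>UNIV. t k * (yv k \<bullet> v)\<^sup>2)"
      unfolding power2_norm_eq_inner by (subst (1) P_def) (simp add: inner_sum_left power2_eq_square mult_ac)
    also have "\<dots> = (\<Sum>k\<in>UNIV. (t (q (pos k)))\<^sup>2 * (h (pos k) \<bullet> v)\<^sup>2)"
    proof (intro sum.cong refl)
      fix k
      show "t k * (yv k \<bullet> v)\<^sup>2 = (t (q (pos k)))\<^sup>2 * (h (pos k) \<bullet> v)\<^sup>2"
        using t0[of k] by (simp add: h_def qpos power_divide power2_eq_square[of "t k"])
    qed
    also have "\<dots> = (\<Sum>j<CARD('d). (t (q j))\<^sup>2 * (h j \<bullet> v)\<^sup>2)"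
      by (rule sum.reindex_bij_betw[OF pos])
    finally show ?thesis .
  qed
  have close: "norm (A' v - P v) \<le> e * norm v" "norm (P v - A' v) \<le> e * norm v" for v
    using Bnorm[of v] by (simp_all add: split norm_minus_commute)
  have tdec: "t (q j) \<le> t (q i)" if "i \<le> j" "j < CARD('d)" for i j
    unfolding t_def using n0 that posq by (intro divide_right_mono sdec) auto
  have lam_close: "\<bar>lam (pos k) / n - t k\<bar> \<le> e" for k
  proof -
    have l: "0 \<le> lam i / n" if "i < n" for i using lam0[OF that] by simp
    have ld: "lam j / n \<le> lam i / n" if "i \<le> j" "j < n" for i j
      using ldec[OF that] n0 by (intro divide_right_mono) auto
    \<comment> \<open>Weyl's inequality is used in both directions. The two families of singular
      vectors have lengths n and d, and \<open>pos k\<close> is a valid index in both.\<close>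
    have "lam (pos k) / n \<le> t (q (pos k)) + e"
      by (rule singular_value_le[where u = u and h = h and A = A' and P = P, OF u A'norm l ld h Pnorm _ tdec close(1)])
        (use t0 posn in \<open>auto intro: less_imp_le\<close>)
    moreover have "t (q (pos k)) \<le> lam (pos k) / n + e"
      by (rule singular_value_le[where u = h and h = u and A = P and P = A', OF h Pnorm _ tdec u A'norm l ld close(2)])
        (use t0 posn in \<open>auto intro: less_imp_le\<close>)
    ultimately show ?thesis by (simp add: qpos)
  qed
  have c1: "c \<le> 1" using s_ge s_le order_trans by blast
  have c2: "c\<^sup>2 \<le> c" using c c1 by (simp add: power2_eq_square mult_left_le)
  have lam_big: "c / 2 \<le> lam (pos k) / n" "e < lam (pos k) / n" for k
    using lam_close[of k] s_ge[of k] e c2 c unfolding t_def by linarith+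
  have xvu: "xv k = sqrt (lam (pos k) / n) *\<^sub>R u (pos k)" for k
  proof -
    have "xv k = (1 / sqrt n) *\<^sub>R tup n (\<lambda>i. Xh i $ k)"
      by (rule fseq_eqI) (simp add: xv_def nth_tup nth_seq_simps)
    then show ?thesis by (simp add: Xhu real_sqrt_divide)
  qed
  \<comment> \<open>The eigenvalue sign lost in the modulus is recovered here: the eigenvalue
    exceeds the noise level \<open>e\<close>, whereas the signal is positive semidefinite.\<close>
  have A'u: "A' (u (pos k)) = (lam (pos k) / n) *\<^sub>R u (pos k)" for k
  proof (rule eigenvector_of_square[where P = P and B = B and e = e])
    show "linear A'" unfolding A'_def by (rule linear_matop)
    show "0 \<le> P v \<bullet> v" for v by (simp add: P_def inner_sum_left sum_nonneg)
  qed (use split Bnorm lam_big A'A' posn in auto)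
  have x_norm: "xv k \<bullet> xv k = lam (pos k) / n" for k
    using lam0[OF posn(2)[of k]] posn by (simp add: xvu u)
  have xB: "P (xv k) + B (xv k) = (lam (pos k) / n) *\<^sub>R xv k" for k
    unfolding split[symmetric] xvu using A'u[of k] linear_scale[of A'] by (simp add: A'_def linear_matop)
  have Bynorm: "norm (B (yv k)) \<le> \<beta>" for k
  proof -
    have "(norm (B (yv k)))\<^sup>2 = (\<Sum>i<n. (\<Sum>j<n. residual A x i j * y k j)\<^sup>2) / n\<^sup>2"
      by (simp add: B_def yv_def matop_tup norm_tup power_divide flip: sum_divide_distrib)
    also have "\<dots> \<le> (\<beta> * n)\<^sup>2 / n\<^sup>2" by (intro divide_right_mono By) auto
    also have "\<dots> = \<beta>\<^sup>2" using n0 by (simp add: power_mult_distrib)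
    finally show ?thesis by (rule power2_le_imp_le) (rule \<beta>)
  qed
  have res_sym: "residual A x i j = residual A x j i" if "i < n" "j < n" for i j
    using Asym[OF that] by (simp add: residual_def inner_commute)
  interpret S: spectral_perturbation xv yv t "\<lambda>k. lam (pos k) / n" B c e \<beta> \<gamma> "real CARD('d)"
  proof (rule spectral_perturbation.intro)
    show "t k \<le> 1" "c \<le> t k" for k using s_le[of k] s_ge[of k] by (simp_all add: t_def)
    show "c \<le> \<bar>t k - t l\<bar>" if "k \<noteq> l" for k l using gap[OF that] by (simp add: t_def)
    show "linear B" unfolding B_def by (rule linear_matop)
    show "B v \<bullet> w = v \<bullet> B w" for v w unfolding B_def by (rule matop_sym) (simp add: res_sym)
    show "\<bar>yv k \<bullet> B (yv l)\<bar> \<le> \<gamma>" for k l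
    proof -
      have "yv k \<bullet> B (yv l) = (\<Sum>i<n. \<Sum>j<n. y k i * y l j * residual A x i j) / n"
        by (simp add: B_def inner_matop yv_def nth_tup sum_divide_distrib mult_ac)
      then have "\<bar>yv k \<bullet> B (yv l)\<bar> = \<bar>\<Sum>i<n. \<Sum>j<n. y k i * y l j * residual A x i j\<bar> / n" by simp
      then show ?thesis using yBy[of k l] n0 by (simp only: pos_divide_le_eq)
    qed
    show "0 \<le> xv k \<bullet> yv k" for k
    proof -
      have "xv k \<bullet> yv k = (\<Sum>i<n. Xh i $ k * (tp W *v x i) $ k) / n"
        unfolding xv_def yv_def inner_tup y sum_divide_distrib using n0 by (intro sum.cong) auto
      then show ?thesis using sign by (simp add: sign_compatible_def)
    qed
    show "(\<Sum>l\<in>UNIV. (yv l \<bullet> xv k) *\<^sub>R yv l) + B (xv k) = (lam (pos k) / n) *\<^sub>R xv k" for k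
      using xB[of k] by (simp add: P_def)
  qed (use c yy Bnorm Bynorm x_norm lam_close e \<beta> in auto)
  have diff: "xv k - yv k = tup n (\<lambda>i. Xh i $ k / sqrt n - y k i)"
    by (rule fseq_eqI) (simp add: xv_def yv_def nth_tup nth_seq_simps)
  show ?first
    unfolding norm_tup[symmetric] diff[symmetric] using S.first_order[of k] by (intro power_mono) auto
  have diff2: "xv k - yv k - (1 / t k) *\<^sub>R B (yv k) = tup n (\<lambda>i. Xh i $ k / sqrt n - y k i - (\<Sum>j<n. residual A x i j * y k j) / s $ k)"
    using n0 by (intro fseq_eqI) (simp add: xv_def yv_def nth_tup nth_seq_simps B_def matop_tup t_def flip: sum_divide_distrib)
  show ?second
    unfolding norm_tup[symmetric] diff2[symmetric] using S.second_order[of k] by (intro power_mono) auto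
  show ?bd if i: "i < n"
  proof -
    \<comment> \<open>Each entry of a unit eigenvector equals the product of a row of A/n with that
      vector, divided by the eigenvalue \<open>L\<close>. Such a row has norm at most 1 / sqrt n,
      and \<open>L\<close> is bounded below, so no entry of the eigenvector is much larger than 1 /
      sqrt n.\<close>
    define U where "U = u (pos k)"
    define L where "L = lam (pos k) / n"
    have L: "c / 2 \<le> L" "0 < L" using lam_big(1)[of k] c unfolding L_def by linarith+
    have "L * \<bar>nth_seq U i\<bar> = \<bar>nth_seq (A' U) i\<bar>"
      using A'u[of k] L by (simp add: U_def L_def[symmetric] nth_seq_simps abs_mult)
    also have "\<dots> = \<bar>\<Sum>j<n. A $$ (i, j) / n * nth_seq U j\<bar>" using i by (simp add: A'_def nth_matop)
    also have "\<dots> \<le> sqrt (1 / n)"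
    proof -
      have "(\<Sum>j<n. A $$ (i, j) / n * nth_seq U j)\<^sup>2 \<le> (\<Sum>j<n. (A $$ (i, j) / n)\<^sup>2) * (\<Sum>j<n. (nth_seq U j)\<^sup>2)"
        by (rule Cauchy_Schwarz_ineq_sum)
      also have "\<dots> \<le> (1 / n) * 1"
      proof (intro mult_mono)
        have "(\<Sum>j<n. (A $$ (i, j) / n)\<^sup>2) \<le> (\<Sum>j<n. (1 / n)\<^sup>2)"
        proof (intro sum_mono)
          fix j assume "j \<in> {..<n}"
          then have "\<bar>A $$ (i, j) / n\<bar> \<le> 1 / n" using A01[OF i, of j] n0 by (simp add: divide_right_mono)
          then show "(A $$ (i, j) / n)\<^sup>2 \<le> (1 / n)\<^sup>2" using n0 by (simp add: abs_le_square_iff[symmetric])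
        qed
        also have "\<dots> = 1 / n" using n0 by (simp add: power2_eq_square)
        finally show "(\<Sum>j<n. (A $$ (i, j) / n)\<^sup>2) \<le> 1 / n" .
        have "(norm U)\<^sup>2 = 1" using u[OF posn(2)[of k] posn(2)[of k]] by (simp add: U_def power2_norm_eq_inner)
        then show "(\<Sum>j<n. (nth_seq U j)\<^sup>2) \<le> 1" using norm_restrict_le[where v = U and n = n] by simp
      qed (auto intro: sum_nonneg)
      finally show ?thesis by (intro real_le_rsqrt) simp
    qed
    finally have "L * \<bar>nth_seq U i\<bar> \<le> sqrt (1 / n)" .
    then have 1: "\<bar>nth_seq U i\<bar> \<le> sqrt (1 / n) / L" using L by (simp add: field_simps)
    have "Xh i $ k / sqrt n = nth_seq (xv k) i" using i by (simp add: xv_def nth_tup)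
    also have "\<dots> = sqrt L * nth_seq U i" by (simp add: xvu U_def L_def nth_seq_simps)
    finally have "Xh i $ k = sqrt n * (sqrt L * nth_seq U i)"
      using n0 by (simp add: divide_eq_eq mult.commute)
    then have "\<bar>Xh i $ k\<bar> = sqrt n * (sqrt L * \<bar>nth_seq U i\<bar>)"
      using n0 L by (simp add: abs_mult)
    also have "\<dots> \<le> sqrt n * (sqrt L * (sqrt (1 / n) / L))"
      using L by (intro mult_left_mono 1) auto
    also have "\<dots> = sqrt (1 / L)"
    proof -
      have "sqrt L / L = 1 / sqrt L" using L real_div_sqrt[of L] by (simp add: field_simps)
      then show ?thesis using n0 by (simp add: real_sqrt_divide)
    qed
    also have "\<dots> \<le> sqrt (2 / c)"
      using L c by (intro real_sqrt_le_mono) (simp add: field_simps)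
    finally show ?bd .
  qed
qed

subsection \<open>Eigenvalue gaps of the second moment matrix\<close>

lemma orthogonal_matrix_columns:
  fixes W :: "real ^ 'd ^ 'd"
  shows "orthogonal_matrix W \<longleftrightarrow> (\<forall>a b. (\<Sum>c\<in>UNIV. W $ c $ a * W $ c $ b) = (if a = b then 1 else 0))"
  by (simp add: orthogonal_matrix Finite_Cartesian_Product.vec_eq_iff matrix_matrix_mult_def Finite_Cartesian_Product.transpose_def
      Finite_Cartesian_Product.mat_def)

lemma orthogonal_matrix_entry_le:
  fixes W :: "real ^ 'd ^ 'd"
  assumes "orthogonal_matrix W"
  shows "\<bar>W $ a $ b\<bar> \<le> 1"
proof -
  have "(W $ a $ b)\<^sup>2 \<le> (\<Sum>c\<in>UNIV. (W $ c $ b)\<^sup>2)"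
    by (rule member_le_sum) auto
  also have "\<dots> = 1" using assms by (simp add: orthogonal_matrix_columns power2_eq_square)
  finally show ?thesis by (simp add: abs_square_le_1)
qed

lemma diagonal_conjugation_entry:
  fixes W :: "real ^ 'd ^ 'd" and s :: "real ^ 'd"
  shows "(W ** (\<chi> k l. if k = l then s $ k else 0) ** tp W) $ a $ b
    = (\<Sum>k\<in>UNIV. W $ a $ k * s $ k * W $ b $ k)"
  by (simp add: matrix_matrix_mult_def Finite_Cartesian_Product.transpose_def if_distrib cong: if_cong)

text \<open>Compactness in place of a perturbation bound for eigenvalues: a sequence of
  counterexamples has a limit that diagonalizes \<Delta> itself, where a vanishing or repeated
  diagonal entry contradicts the rank or the number of eigenvalues.\<close>

lemma eigenvalue_gap:
  fixes \<Delta> :: "real ^ 'd ^ 'd"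
  assumes rank: "rank \<Delta> = CARD('d)"
    and card: "card {\<mu>::real. \<exists>v. v \<noteq> 0 \<and> \<Delta> *v v = \<mu> *\<^sub>R v} = CARD('d)"
  obtains c \<epsilon> where "0 < c" "0 < \<epsilon>"
    "\<And>W s G. orthogonal_matrix W \<Longrightarrow>
      W ** (\<chi> k l. if k = l then s $ k else 0) ** tp W = G \<Longrightarrow>
      (\<forall>k l. \<bar>G $ k $ l - \<Delta> $ k $ l\<bar> < \<epsilon>) \<Longrightarrow>
      (\<forall>k. c \<le> \<bar>s $ k\<bar>) \<and> (\<forall>k l. k \<noteq> l \<longrightarrow> c \<le> \<bar>s $ k - s $ l\<bar>)"
proof (rule ccontr)
  note that' = that
  let ?D = "\<lambda>s :: real ^ 'd. (\<chi> k l. if k = l then s $ k else 0) :: real ^ 'd ^ 'd"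
  let ?T = "tp :: real ^ 'd ^ 'd \<Rightarrow> real ^ 'd ^ 'd"
  let ?bad = "\<lambda>\<epsilon> W s. orthogonal_matrix W \<and> (\<forall>k l. \<bar>(W ** ?D s ** ?T W) $ k $ l - \<Delta> $ k $ l\<bar> < \<epsilon>) \<and>
      ((\<exists>k. \<bar>s $ k\<bar> < \<epsilon>) \<or> (\<exists>k l. k \<noteq> l \<and> \<bar>s $ k - s $ l\<bar> < \<epsilon>))"
  assume contr: "\<not> thesis"
  \<comment> \<open>If the claim fails with the same number as tolerance and as gap, there is a
    diagonalized matrix within \<epsilon> of \<Delta> that has an eigenvalue or a gap below
    \<epsilon>.\<close>
  have "\<exists>W s. ?bad \<epsilon> W s" if "0 < \<epsilon>" for \<epsilon>
  proof (rule ccontr)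
    assume no: "\<not> (\<exists>W s. ?bad \<epsilon> W s)"
    have thesis
    proof (rule that'[of \<epsilon> \<epsilon>])
      fix W :: "real ^ 'd ^ 'd" and s G
      assume W: "orthogonal_matrix W" "W ** ?D s ** ?T W = G" "\<forall>k l. \<bar>G $ k $ l - \<Delta> $ k $ l\<bar> < \<epsilon>"
      have "\<not> ?bad \<epsilon> W s" using no by blast
      then show "(\<forall>k. \<epsilon> \<le> \<bar>s $ k\<bar>) \<and> (\<forall>k l. k \<noteq> l \<longrightarrow> \<epsilon> \<le> \<bar>s $ k - s $ l\<bar>)"
        using W by (meson not_le)
    qed (fact \<open>0 < \<epsilon>\<close>)+
    with contr show False ..
  qed
  then have ex: "\<forall>m. \<exists>W s. ?bad (1 / real (Suc m)) W s" by simp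
  obtain W where "\<forall>m. \<exists>s. ?bad (1 / real (Suc m)) (W m) s" using choice[OF ex] by (rule exE)
  then obtain s where bad: "\<forall>m. ?bad (1 / real (Suc m)) (W m) (s m)" by (rule choice[THEN exE])
  have orth: "orthogonal_matrix (W m)" for m using bad by blast
  \<comment> \<open>The entries of \<open>s\<close> are recovered as diagonal entries of W^T G W,
    with G close to \<Delta>; this bounds them uniformly and gives compactness.\<close>
  have Ws: "\<bar>s m $ k\<bar> \<le> (\<Sum>a\<in>UNIV. \<Sum>b\<in>UNIV. \<bar>\<Delta> $ a $ b\<bar> + 1)" for m k
  proof -
    let ?G = "W m ** ?D (s m) ** ?T (W m)"
    have "?T (W m) ** ?G ** W m = (?T (W m) ** W m) ** ?D (s m) ** (?T (W m) ** W m)"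
      by (simp add: matrix_mul_assoc)
    also have "\<dots> = ?D (s m)" using orth[of m] by (simp add: orthogonal_matrix_def)
    finally have "s m $ k = (?T (W m) ** ?G ** W m) $ k $ k" by simp
    also have "\<dots> = (\<Sum>b\<in>UNIV. (\<Sum>a\<in>UNIV. W m $ a $ k * ?G $ a $ b) * W m $ b $ k)"
      by (simp add: matrix_matrix_mult_def Finite_Cartesian_Product.transpose_def)
    also have "\<dots> = (\<Sum>a\<in>UNIV. \<Sum>b\<in>UNIV. W m $ a $ k * ?G $ a $ b * W m $ b $ k)"
      unfolding sum_distrib_right by (rule sum.swap)
    finally have "\<bar>s m $ k\<bar> \<le> (\<Sum>a\<in>UNIV. \<Sum>b\<in>UNIV. \<bar>W m $ a $ k * ?G $ a $ b * W m $ b $ k\<bar>)"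
      by (auto intro!: order_trans[OF sum_abs] sum_mono)
    also have "\<dots> \<le> (\<Sum>a\<in>UNIV. \<Sum>b\<in>UNIV. 1 * (\<bar>\<Delta> $ a $ b\<bar> + 1) * 1)"
      unfolding abs_mult
    proof (intro sum_mono mult_mono orthogonal_matrix_entry_le[OF orth])
      fix a b
      have "\<bar>?G $ a $ b - \<Delta> $ a $ b\<bar> < 1 / real (Suc m)" using bad by blast
      also have "\<dots> \<le> 1" by simp
      finally show "\<bar>?G $ a $ b\<bar> \<le> \<bar>\<Delta> $ a $ b\<bar> + 1" by linarith
    qed auto
    finally show ?thesis by simp
  qed
  have "bounded (range (\<lambda>m. (W m, s m)))"
  proof -
    have "bounded (range W)"
    proof (rule boundedI)
      fix x assume "x \<in> range W"
      then obtain m where x: "x = W m" by blast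
      have "norm (W m) \<le> (\<Sum>a\<in>UNIV. norm (W m $ a))"
        unfolding norm_vec_def by (rule L2_set_le_sum) auto
      also have "\<dots> \<le> (\<Sum>a\<in>(UNIV :: 'd set). \<Sum>b\<in>(UNIV :: 'd set). 1)"
        using orthogonal_matrix_entry_le[OF orth[of m]]
        by (intro sum_mono order_trans[OF norm_le_l1_cart]) auto
      finally show "norm x \<le> (\<Sum>a\<in>(UNIV :: 'd set). \<Sum>b\<in>(UNIV :: 'd set). 1)" unfolding x .
    qed
    moreover have "bounded (range s)"
    proof (rule boundedI)
      fix x assume "x \<in> range s"
      then obtain m where x: "x = s m" by blast
      show "norm x \<le> (\<Sum>k\<in>(UNIV :: 'd set). \<Sum>a\<in>UNIV. \<Sum>b\<in>UNIV. \<bar>\<Delta> $ a $ b\<bar> + 1)"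
        unfolding x by (rule order_trans[OF norm_le_l1_cart]) (intro sum_mono Ws)
    qed
    ultimately show ?thesis
      by (rule bounded_subset[OF bounded_Times]) auto
  qed
  then obtain r p where r: "strict_mono (r :: nat \<Rightarrow> nat)" and lim: "((\<lambda>m. (W m, s m)) \<circ> r) \<longlonglongrightarrow> p"
    using bounded_imp_convergent_subsequence by blast
  define V t where "V = fst p" and "t = snd p"
  have W_lim: "(\<lambda>m. W (r m) $ a $ b) \<longlonglongrightarrow> V $ a $ b" for a b
    using tendsto_fst[OF lim] by (auto simp: V_def o_def intro!: tendsto_vec_nth)
  have s_lim: "(\<lambda>m. s (r m) $ k) \<longlonglongrightarrow> t $ k" for k
    using tendsto_snd[OF lim] by (auto simp: t_def o_def intro!: tendsto_vec_nth)
  have inv_lim: "(\<lambda>m. 1 / real (Suc (r m))) \<longlonglongrightarrow> 0"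
    using LIMSEQ_subseq_LIMSEQ[OF LIMSEQ_Suc[OF lim_1_over_n] r] by (simp add: o_def)
  have orthV: "orthogonal_matrix V"
    unfolding orthogonal_matrix_columns
  proof (intro allI)
    fix a b
    have "(\<lambda>m. \<Sum>c\<in>UNIV. W (r m) $ c $ a * W (r m) $ c $ b) \<longlonglongrightarrow> (\<Sum>c\<in>UNIV. V $ c $ a * V $ c $ b)"
      by (intro tendsto_sum tendsto_mult W_lim)
    then have "(\<lambda>m. if a = b then 1 else 0) \<longlonglongrightarrow> (\<Sum>c\<in>UNIV. V $ c $ a * V $ c $ b)"
      using orth unfolding orthogonal_matrix_columns by simp
    then show "(\<Sum>c\<in>UNIV. V $ c $ a * V $ c $ b) = (if a = b then 1 else 0)"
      by (simp add: LIMSEQ_const_iff split: if_splits)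
  qed
  have \<Delta>: "\<Delta> = V ** ?D t ** ?T V"
  proof -
    have eq: "(V ** ?D t ** ?T V) $ a $ b = \<Delta> $ a $ b" for a b
    proof (rule LIMSEQ_unique)
      show "(\<lambda>m. (W (r m) ** ?D (s (r m)) ** ?T (W (r m))) $ a $ b) \<longlonglongrightarrow> (V ** ?D t ** ?T V) $ a $ b"
        unfolding diagonal_conjugation_entry by (intro tendsto_sum tendsto_mult W_lim s_lim)
      have "(\<lambda>m. (W (r m) ** ?D (s (r m)) ** ?T (W (r m))) $ a $ b - \<Delta> $ a $ b) \<longlonglongrightarrow> 0"
        by (rule Lim_null_comparison[OF _ inv_lim]) (use bad in \<open>auto intro!: always_eventually less_imp_le\<close>)
      then show "(\<lambda>m. (W (r m) ** ?D (s (r m)) ** ?T (W (r m))) $ a $ b) \<longlonglongrightarrow> \<Delta> $ a $ b"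
        by (simp add: LIM_zero_iff)
    qed
    show ?thesis
      by (rule Finite_Cartesian_Product.vec_eq_iff[THEN iffD2], rule allI, rule Finite_Cartesian_Product.vec_eq_iff[THEN iffD2], rule allI) (rule eq[symmetric])
  qed
  have VT: "?T V ** V = Finite_Cartesian_Product.mat 1" "V ** ?T V = Finite_Cartesian_Product.mat 1"
    using orthV by (auto simp: orthogonal_matrix_def)
  have Dv: "(?D t *v w) $ k = t $ k * w $ k" for w k
    by (simp add: matrix_vector_mult_def if_distrib[of "\<lambda>q. q * _"] cong: if_cong)
  have sub: "{\<mu>::real. \<exists>v. v \<noteq> 0 \<and> \<Delta> *v v = \<mu> *\<^sub>R v} \<subseteq> range (($) t)"
  proof
    fix \<mu> assume "\<mu> \<in> {\<mu>::real. \<exists>v. v \<noteq> 0 \<and> \<Delta> *v v = \<mu> *\<^sub>R v}"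
    then obtain v where v: "v \<noteq> 0" "\<Delta> *v v = \<mu> *\<^sub>R v" by blast
    define w where "w = ?T V *v v"
    have Vw: "V *v w = v" unfolding w_def matrix_vector_mul_assoc VT by simp
    then have "w \<noteq> 0" using v by auto
    then obtain k where k: "w $ k \<noteq> 0" by (auto simp: Finite_Cartesian_Product.vec_eq_iff)
    have "?D t *v w = ?T V *v (\<Delta> *v v)"
      unfolding \<Delta> w_def matrix_vector_mul_assoc matrix_mul_assoc VT by simp
    also have "\<dots> = \<mu> *\<^sub>R w" unfolding v w_def by (simp add: matrix_vector_mult_scaleR del: transpose_matrix_vector)
    finally have "(?D t *v w) $ k = (\<mu> *\<^sub>R w) $ k" by (rule arg_cong)
    then have "\<mu> = t $ k" unfolding Dv using k by simp
    then show "\<mu> \<in> range (($) t)" by blast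
  qed
  \<comment> \<open>All d distinct eigenvalues occur among the d entries of \<open>t\<close>, hence
    no two entries agree.\<close>
  have "CARD('d) \<le> card (range (($) t))"
    using card_mono[OF _ sub] card by simp
  moreover have "card (range (($) t)) \<le> CARD('d)" by (rule card_image_le) simp
  ultimately have inj: "inj (($) t)" by (intro eq_card_imp_inj_on) auto
  have t0: "t $ k \<noteq> 0" for k
  proof
    assume "t $ k = 0"
    have "\<Delta> *v (V *v axis k 1) = V *v (?D t *v (?T V ** V *v axis k 1))"
      unfolding \<Delta> by (simp add: matrix_vector_mul_assoc matrix_mul_assoc)
    also have "?D t *v (?T V ** V *v axis k 1) = 0"
      unfolding VT using \<open>t $ k = 0\<close> by (simp add: Finite_Cartesian_Product.vec_eq_iff Dv axis_def)
    finally have eq: "\<Delta> *v (V *v axis k 1) = \<Delta> *v 0" by simp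
    have inj_\<Delta>: "inj ((*v) \<Delta>)" using rank full_rank_injective by blast
    have "V *v axis k 1 = 0" by (rule injD[OF inj_\<Delta> eq])
    then have "(?T V ** V) *v axis k 1 = 0" by (simp add: matrix_vector_mul_assoc[symmetric] del: transpose_matrix_vector)
    then show False unfolding VT by simp
  qed
  \<comment> \<open>The entries of \<open>t\<close> are nonzero and distinct while the tolerance
    shrinks to 0, so far along the subsequence the counterexample property fails.\<close>
  have "\<forall>\<^sub>F m in sequentially. 1 / real (Suc (r m)) < \<bar>s (r m) $ k\<bar>" for k
  proof -
    have "(\<lambda>m. \<bar>s (r m) $ k\<bar> - 1 / real (Suc (r m))) \<longlonglongrightarrow> \<bar>t $ k\<bar> - 0"
      by (intro tendsto_diff tendsto_rabs s_lim inv_lim)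
    then have "\<forall>\<^sub>F m in sequentially. 0 < \<bar>s (r m) $ k\<bar> - 1 / real (Suc (r m))"
      using t0[of k] by (intro order_tendstoD(1)) auto
    then show ?thesis by simp
  qed
  then have 1: "\<forall>\<^sub>F m in sequentially. \<forall>k. 1 / real (Suc (r m)) < \<bar>s (r m) $ k\<bar>"
    by (intro eventually_all_finite)
  have "\<forall>\<^sub>F m in sequentially. k \<noteq> l \<longrightarrow> 1 / real (Suc (r m)) < \<bar>s (r m) $ k - s (r m) $ l\<bar>" for k l
  proof (cases "k = l")
    case False
    then have "t $ k \<noteq> t $ l" using inj by (auto dest: injD)
    have "(\<lambda>m. \<bar>s (r m) $ k - s (r m) $ l\<bar> - 1 / real (Suc (r m))) \<longlonglongrightarrow> \<bar>t $ k - t $ l\<bar> - 0"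
      by (intro tendsto_diff tendsto_rabs s_lim inv_lim)
    then have "\<forall>\<^sub>F m in sequentially. 0 < \<bar>s (r m) $ k - s (r m) $ l\<bar> - 1 / real (Suc (r m))"
      using \<open>t $ k \<noteq> t $ l\<close> by (intro order_tendstoD(1)) auto
    then show ?thesis by eventually_elim simp
  qed simp
  then have 2: "\<forall>\<^sub>F m in sequentially. \<forall>k l. k \<noteq> l \<longrightarrow> 1 / real (Suc (r m)) < \<bar>s (r m) $ k - s (r m) $ l\<bar>"
    by (intro eventually_all_finite)
  have "\<forall>\<^sub>F m in sequentially. False"
    using 1 2
  proof eventually_elim
    fix m
    assume a: "\<forall>k. 1 / real (Suc (r m)) < \<bar>s (r m) $ k\<bar>"
      "\<forall>k l. k \<noteq> l \<longrightarrow> 1 / real (Suc (r m)) < \<bar>s (r m) $ k - s (r m) $ l\<bar>"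
    from bad[rule_format, of "r m"] have "(\<exists>k. \<bar>s (r m) $ k\<bar> < 1 / real (Suc (r m))) \<or>
        (\<exists>k l. k \<noteq> l \<and> \<bar>s (r m) $ k - s (r m) $ l\<bar> < 1 / real (Suc (r m)))" by blast
    then show False using a by (meson less_asym)
  qed
  then show False by simp
qed

subsection \<open>Almost sure bounds\<close>

text \<open>A union bound within each n, followed by the first Borel-Cantelli lemma, which requires
  no independence between different n. The index 0 is set aside because the model is given only from
  n = 1 on.\<close>

lemma (in prob_space) borel_cantelli_family:
  fixes E :: "nat \<Rightarrow> 'i \<Rightarrow> 'a set"
  assumes fin: "\<And>n. finite (I n)"
    and meas: "\<And>n \<kappa>. 1 \<le> n \<Longrightarrow> \<kappa> \<in> I n \<Longrightarrow> E n \<kappa> \<in> sets M"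
    and bound: "\<And>n \<kappa>. 1 \<le> n \<Longrightarrow> \<kappa> \<in> I n \<Longrightarrow> prob (E n \<kappa>) \<le> b n"
    and sum: "summable (\<lambda>n. real (card (I n)) * b n)"
  shows "AE \<omega> in M. \<forall>\<^sub>F n in sequentially. \<forall>\<kappa>\<in>I n. \<omega> \<notin> E n \<kappa>"
proof -
  define E' where "E' n = (if 1 \<le> n then \<Union>\<kappa>\<in>I n. E n \<kappa> else {})" for n
  have E'm: "E' n \<in> sets M" for n
    unfolding E'_def using meas fin by (auto intro!: sets.finite_UN)
  have le: "prob (E' n) \<le> real (card (I n)) * b n" if "1 \<le> n" for n
  proof -
    have "prob (\<Union>\<kappa>\<in>I n. E n \<kappa>) \<le> (\<Sum>\<kappa>\<in>I n. prob (E n \<kappa>))"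
      using meas[OF that] fin by (intro finite_measure_subadditive_finite) auto
    also have "\<dots> \<le> (\<Sum>\<kappa>\<in>I n. b n)" by (intro sum_mono bound that)
    finally show ?thesis using that by (simp add: E'_def)
  qed
  have "summable (\<lambda>n. prob (E' n))"
    by (rule summable_comparison_test'[OF sum, of 1]) (use le in auto)
  then have "AE \<omega> in M. \<forall>\<^sub>F n in sequentially. \<omega> \<in> space M - E' n"
    by (intro borel_cantelli_AE1 E'm) (auto simp: emeasure_eq_measure)
  then show ?thesis
  proof eventually_elim
    case (elim \<omega>)
    show ?case using elim eventually_ge_at_top[of 1]
      by eventually_elim (auto simp: E'_def)
  qed
qed

text \<open>Reduces the summability of tails to an asymptotic comparison.\<close>

lemma summable_bigo_inverse_square:
  fixes f :: "nat \<Rightarrow> real"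
  assumes "f \<in> O(\<lambda>n. 1 / real n ^ 2)"
  shows "summable f"
proof (rule summable_comparison_test_bigo[OF _ assms])
  show "summable (\<lambda>n. norm (1 / real n ^ 2))"
    using inverse_power_summable[of 2, where 'a = real] by (simp add: divide_inverse)
qed

lemma sum_square_split:
  fixes f :: "nat \<Rightarrow> nat \<Rightarrow> real"
  shows "(\<Sum>i<n. \<Sum>j<n. f i j) = (\<Sum>j<n. \<Sum>i<j. f i j + f j i) + (\<Sum>i<n. f i i)"
  by (induction n) (simp_all add: sum.distrib)

context rdpg_space
begin

lemma norm_le_1: "x \<in> \<Omega> \<Longrightarrow> norm x \<le> 1"
proof -
  assume "x \<in> \<Omega>"
  then have "x \<bullet> x \<le> 1" using latent by (auto simp: latent_space_def)
  then show ?thesis by (simp add: norm_eq_sqrt_inner)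
qed

text \<open>Both orientations of a pair carry the same noise, so the form folds onto independent
  edges with weights \<phi>_i \<psi>_j + \<phi>_j \<psi>_i. The uncentred diagonal is bounded
  deterministically by \<open>D\<close> and added to the threshold. Coefficients may depend on the
  vertex, which covers sign vectors and the selection of a single row.\<close>

lemma bilinear_tail:
  fixes \<phi> \<psi> :: "nat \<Rightarrow> real ^ 'd \<Rightarrow> real"
  assumes \<phi>: "\<And>i. \<phi> i \<in> borel_measurable borel" and \<psi>: "\<And>i. \<psi> i \<in> borel_measurable borel"
    and V: "\<And>x. \<forall>i<n. x i \<in> \<Omega> \<Longrightarrow>
      (\<Sum>j<n. \<Sum>i<j. (\<phi> i (x i) * \<psi> j (x j) + \<phi> j (x j) * \<psi> i (x i))\<^sup>2) \<le> V"
    and diag: "\<And>x. \<forall>i<n. x i \<in> \<Omega> \<Longrightarrow> (\<Sum>i<n. \<bar>\<phi> i (x i) * \<psi> i (x i)\<bar>) \<le> D"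
    and t: "0 < t" and V0: "0 < V"
  defines "Q \<equiv> \<lambda>\<omega>. \<Sum>i<n. \<Sum>j<n. \<phi> i (X \<omega> i) * \<psi> j (X \<omega> j) * R \<omega> i j"
  shows "{\<omega> \<in> space M. t + D \<le> \<bar>Q \<omega>\<bar>} \<in> sets M"
    and "prob {\<omega> \<in> space M. t + D \<le> \<bar>Q \<omega>\<bar>} \<le> 2 * exp (- 2 * t\<^sup>2 / V)"
proof -
  define w where "w i j x y = \<phi> i x * \<psi> j y + \<phi> j y * \<psi> i x" for i j x y
  have w: "case_prod (w i j) \<in> borel_measurable (borel \<Otimes>\<^sub>M borel)" for i j
    unfolding w_def case_prod_unfold
    using measurable_compose[OF measurable_fst \<phi>] measurable_compose[OF measurable_fst \<psi>]
      measurable_compose[OF measurable_snd \<phi>] measurable_compose[OF measurable_snd \<psi>]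
    by (intro borel_measurable_add borel_measurable_times)
  let ?Z = "\<lambda>\<omega>. \<Sum>j<n. \<Sum>i<j. w i j (X \<omega> i) (X \<omega> j) * R \<omega> i j"
  have Vw: "(\<Sum>j<n. \<Sum>i<j. (w i j (x i) (x j))\<^sup>2) \<le> V" if "\<forall>i<n. x i \<in> \<Omega>" for x
    using V[OF that] by (simp add: w_def)
  have Zm: "?Z \<in> borel_measurable M" by (rule weighted_noise(1)[OF w Vw])
  have Qm: "Q \<in> borel_measurable M"
    unfolding Q_def residual_def using measurable_compose[OF X_meas \<phi>] measurable_compose[OF X_meas \<psi>] X_meas A_meas
    by (intro borel_measurable_sum borel_measurable_times borel_measurable_diff borel_measurable_inner) auto
  then show Qs: "{\<omega> \<in> space M. t + D \<le> \<bar>Q \<omega>\<bar>} \<in> sets M" by measurable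
  have QZ: "\<bar>Q \<omega>\<bar> \<le> \<bar>?Z \<omega>\<bar> + D" if x: "\<forall>i<n. X \<omega> i \<in> \<Omega>" and \<omega>: "\<omega> \<in> space M" for \<omega>
  proof -
    have sym: "R \<omega> i j = R \<omega> j i" if "i < n" "j < n" for i j
      using A_adj[OF \<omega>] that by (auto simp: residual_def adjacency_matrices_def inner_commute)
    have "Q \<omega> = ?Z \<omega> + (\<Sum>i<n. \<phi> i (X \<omega> i) * \<psi> i (X \<omega> i) * R \<omega> i i)"
      unfolding Q_def sum_square_split
    proof (intro arg_cong2[where f = "(+)"] sum.cong refl)
      fix j i assume "j \<in> {..<n}" "i \<in> {..<j}"
      then show "\<phi> i (X \<omega> i) * \<psi> j (X \<omega> j) * R \<omega> i j + \<phi> j (X \<omega> j) * \<psi> i (X \<omega> i) * R \<omega> j i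
        = w i j (X \<omega> i) (X \<omega> j) * R \<omega> i j"
        using sym[of i j] by (simp add: w_def distrib_right)
    qed
    moreover have "\<bar>\<Sum>i<n. \<phi> i (X \<omega> i) * \<psi> i (X \<omega> i) * R \<omega> i i\<bar> \<le> D"
    proof -
      have "\<bar>\<Sum>i<n. \<phi> i (X \<omega> i) * \<psi> i (X \<omega> i) * R \<omega> i i\<bar>
          \<le> (\<Sum>i<n. \<bar>\<phi> i (X \<omega> i) * \<psi> i (X \<omega> i)\<bar> * 1)"
      proof (intro order_trans[OF sum_abs] sum_mono)
        fix i assume i: "i \<in> {..<n}"
        have "A \<omega> $$ (i, i) = 0" using A_adj[OF \<omega>] i by (auto simp: adjacency_matrices_def)
        moreover have "0 \<le> X \<omega> i \<bullet> X \<omega> i" "X \<omega> i \<bullet> X \<omega> i \<le> 1"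
          using x i latent by (auto simp: latent_space_def)
        ultimately have "\<bar>R \<omega> i i\<bar> \<le> 1" by (simp add: residual_def)
        then show "\<bar>\<phi> i (X \<omega> i) * \<psi> i (X \<omega> i) * R \<omega> i i\<bar> \<le> \<bar>\<phi> i (X \<omega> i) * \<psi> i (X \<omega> i)\<bar> * 1"
          unfolding abs_mult[of "\<phi> i (X \<omega> i) * \<psi> i (X \<omega> i)"] by (intro mult_left_mono) auto
      qed
      also have "\<dots> \<le> D" using diag[OF x] by simp
      finally show ?thesis .
    qed
    ultimately show ?thesis by linarith
  qed
  have "prob {\<omega> \<in> space M. t + D \<le> \<bar>Q \<omega>\<bar>} \<le> prob {\<omega> \<in> space M. t \<le> \<bar>?Z \<omega>\<bar>}"
  proof (rule finite_measure_mono_AE)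
    show "{\<omega> \<in> space M. t \<le> \<bar>?Z \<omega>\<bar>} \<in> sets M" using Zm by measurable
    show "AE \<omega> in M. \<omega> \<in> {\<omega> \<in> space M. t + D \<le> \<bar>Q \<omega>\<bar>} \<longrightarrow> \<omega> \<in> {\<omega> \<in> space M. t \<le> \<bar>?Z \<omega>\<bar>}"
      using X_in by eventually_elim (use QZ in fastforce)
  qed
  also have "\<dots> \<le> 2 * exp (- 2 * t\<^sup>2 / V)"
    by (rule weighted_noise_tail[OF w Vw t V0])
  finally show "prob {\<omega> \<in> space M. t + D \<le> \<bar>Q \<omega>\<bar>} \<le> 2 * exp (- 2 * t\<^sup>2 / V)" .
qed

end

text \<open>The graphs live on one probability space, but their joint law is left open: the latent
  positions of the n-th graph need not extend those of the preceding ones.\<close>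

locale rdpg_sequence = prob_space M for M :: "'w measure" +
  fixes \<Omega> :: "(real ^ 'd) set" and F :: "(real ^ 'd) measure"
    and X :: "nat \<Rightarrow> 'w \<Rightarrow> nat \<Rightarrow> real ^ 'd" and A :: "nat \<Rightarrow> 'w \<Rightarrow> real mat"
  assumes latent: "latent_space \<Omega>" and dist: "latent_distribution \<Omega> F"
    and rdpg: "\<And>n. 1 \<le> n \<Longrightarrow> rdpg n F M (X n) (A n)"
begin

lemma rdpg_space: "1 \<le> n \<Longrightarrow> rdpg_space M n \<Omega> F (X n) (A n)"
  by unfold_locales (auto simp: latent dist rdpg)

abbreviation "R n \<omega> \<equiv> residual (A n \<omega>) (X n \<omega>)"

lemma norm_le_1: "x \<in> \<Omega> \<Longrightarrow> norm x \<le> 1"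
  using rdpg_space.norm_le_1[OF rdpg_space] by blast

lemma component_le_1: "x \<in> \<Omega> \<Longrightarrow> \<bar>x $ k\<bar> \<le> 1"
  using norm_le_1 component_le_norm_cart order_trans by blast

lemma AE_latent: "AE \<omega> in M. \<forall>n\<ge>1. \<forall>i<n. X n \<omega> i \<in> \<Omega>"
proof -
  have "AE \<omega> in M. 1 \<le> n \<longrightarrow> (\<forall>i<n. X n \<omega> i \<in> \<Omega>)" for n
    using rdpg_space.X_in[OF rdpg_space, of n] by (cases "1 \<le> n") auto
  then show ?thesis by (subst AE_all_countable) blast
qed

text \<open>For fixed coefficient functions the form fluctuates at scale n, far below n^(3/2). A
  single exceptional event per n is enough, hence the index type \<open>unit\<close>.\<close>

lemma AE_bilinear:
  assumes g: "g \<in> borel_measurable borel" and h: "h \<in> borel_measurable borel"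
    and G: "\<And>x. x \<in> \<Omega> \<Longrightarrow> \<bar>g x\<bar> \<le> G" and H: "\<And>x. x \<in> \<Omega> \<Longrightarrow> \<bar>h x\<bar> \<le> H"
  shows "AE \<omega> in M. (\<lambda>n. (\<Sum>i<n. \<Sum>j<n. g (X n \<omega> i) * h (X n \<omega> j) * R n \<omega> i j) / n powr (3/2)) \<longlonglongrightarrow> 0"
proof -
  \<comment> \<open>The maxima with 1 keep the variance proxy strictly positive.\<close>
  define K where "K = max 1 \<bar>G\<bar> * max 1 \<bar>H\<bar>"
  have K1: "1 \<le> K" unfolding K_def using mult_mono[of 1 "max 1 \<bar>G\<bar>" 1 "max 1 \<bar>H\<bar>"] by simp
  have gh: "\<bar>g x * h y\<bar> \<le> K" if "x \<in> \<Omega>" "y \<in> \<Omega>" for x y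
    unfolding K_def abs_mult using G[OF that(1)] H[OF that(2)] by (intro mult_mono) auto
  let ?Q = "\<lambda>n \<omega>. \<Sum>i<n. \<Sum>j<n. g (X n \<omega> i) * h (X n \<omega> j) * R n \<omega> i j"
  \<comment> \<open>The level n^(5/4) lies strictly between the fluctuation scale n and the
    normalization n^(3/2), giving a tail exponent of order sqrt n; the term K n pays for the
    diagonal.\<close>
  define E where "E n (u::unit) = {\<omega> \<in> space M. real n powr (5/4) + K * real n \<le> \<bar>?Q n \<omega>\<bar>}" for n u
  have E: "E n u \<in> sets M \<and> prob (E n u) \<le> 2 * exp (- 2 * (real n powr (5/4))\<^sup>2 / (4 * K\<^sup>2 * (real n)\<^sup>2))"
    if n: "1 \<le> n" for n u
  proof -
    interpret S: rdpg_space M n \<Omega> F "X n" "A n" by (rule rdpg_space[OF n])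
    have V: "(\<Sum>j<n. \<Sum>i<j. (g (x i) * h (x j) + g (x j) * h (x i))\<^sup>2) \<le> 4 * K\<^sup>2 * (real n)\<^sup>2" if x: "\<forall>i<n. x i \<in> \<Omega>" for x
    proof -
      have "(\<Sum>j<n. \<Sum>i<j. (g (x i) * h (x j) + g (x j) * h (x i))\<^sup>2) \<le> (\<Sum>j<n. \<Sum>i<j. (2 * K)\<^sup>2)"
      proof (intro sum_mono)
        fix j i assume "j \<in> {..<n}" "i \<in> {..<j}"
        then have "\<bar>g (x i) * h (x j) + g (x j) * h (x i)\<bar> \<le> 2 * K"
          using gh[of "x i" "x j"] gh[of "x j" "x i"] x by auto
        then show "(g (x i) * h (x j) + g (x j) * h (x i))\<^sup>2 \<le> (2 * K)\<^sup>2"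
          using power_mono[of "\<bar>g (x i) * h (x j) + g (x j) * h (x i)\<bar>" "2 * K" 2] by simp
      qed
      also have "\<dots> \<le> (\<Sum>j<n. real n * (2 * K)\<^sup>2)" by (intro sum_mono) (auto intro!: mult_right_mono)
      finally show ?thesis by (simp add: power2_eq_square mult_ac)
    qed
    have D: "(\<Sum>i<n. \<bar>g (x i) * h (x i)\<bar>) \<le> K * real n" if x: "\<forall>i<n. x i \<in> \<Omega>" for x
    proof -
      have "(\<Sum>i<n. \<bar>g (x i) * h (x i)\<bar>) \<le> (\<Sum>i<n. K)" using x by (intro sum_mono gh) auto
      then show ?thesis by (simp add: mult.commute)
    qed
    have p: "0 < real n powr (5/4)" "0 < 4 * K\<^sup>2 * (real n)\<^sup>2" using n K1 by auto
    show ?thesis unfolding E_def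
      using S.bilinear_tail[of "\<lambda>_. g" "\<lambda>_. h", OF g h V D p] by blast
  qed
  have "AE \<omega> in M. \<forall>\<^sub>F n in sequentially. \<forall>u\<in>(UNIV::unit set). \<omega> \<notin> E n u"
  proof (rule borel_cantelli_family)
    have "(\<lambda>n. exp (- 2 * (real n powr (5/4))\<^sup>2 / (4 * K\<^sup>2 * (real n)\<^sup>2))) \<in> O(\<lambda>n. 1 / real n ^ 2)"
      using K1 by real_asymp
    then show "summable (\<lambda>n. real (card (UNIV::unit set)) * (2 * exp (- 2 * (real n powr (5/4))\<^sup>2 / (4 * K\<^sup>2 * (real n)\<^sup>2))))"
      by (intro summable_mult summable_bigo_inverse_square)
  qed (use E in auto)
  then show ?thesis
  proof (rule AE_mp, intro AE_I2 impI)
    fix \<omega> assume \<omega>: "\<omega> \<in> space M" and ev: "\<forall>\<^sub>F n in sequentially. \<forall>u\<in>(UNIV::unit set). \<omega> \<notin> E n u"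
    have "(\<lambda>n. (real n powr (5/4) + K * real n) / real n powr (3/2)) \<longlonglongrightarrow> 0" by real_asymp
    then show "(\<lambda>n. ?Q n \<omega> / n powr (3/2)) \<longlonglongrightarrow> 0"
    proof (rule Lim_null_comparison[rotated])
      show "\<forall>\<^sub>F n in sequentially. norm (?Q n \<omega> / n powr (3/2)) \<le> (real n powr (5/4) + K * real n) / real n powr (3/2)"
        using ev
      proof eventually_elim
        case (elim n)
        then have "\<bar>?Q n \<omega>\<bar> \<le> real n powr (5/4) + K * real n" using \<omega> by (auto simp: E_def)
        then show ?case by (simp add: divide_right_mono)
      qed
    qed
  qed
qed

text \<open>Only the first n signs matter, so sign vectors are encoded by subsets, and there are 4^n
  pairs. At level 3 n^(3/2) with variance proxy 4 n^2 the tail exponent is (9/2) n, rounded down to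
  4 n; as exp 4 is at least 5, the union bound is a convergent geometric series. The diagonal adds
  at most n, which turns the factor 3 into 4.\<close>

lemma AE_cut_norm:
  "AE \<omega> in M. \<forall>\<^sub>F n in sequentially. cut_norm_le n (R n \<omega>) (4 * n powr (3/2))"
proof -
  define \<sigma> where "\<sigma> S i = (if i \<in> S then 1 else -1 :: real)" for S and i :: nat
  have \<sigma>1: "\<bar>\<sigma> S i\<bar> \<le> 1" for S i by (simp add: \<sigma>_def)
  let ?Q = "\<lambda>n S T \<omega>. \<Sum>i<n. \<Sum>j<n. \<sigma> S i * \<sigma> T j * R n \<omega> i j"
  define E where "E n = (\<lambda>(S, T). {\<omega> \<in> space M. 3 * real n powr (3/2) + real n \<le> \<bar>?Q n S T \<omega>\<bar>})" for n
  have E: "E n p \<in> sets M \<and> prob (E n p) \<le> 2 * exp (- 4 * real n)"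
    if n: "1 \<le> n" for n p
  proof -
    obtain S T where p: "p = (S, T)" by fastforce
    interpret S: rdpg_space M n \<Omega> F "X n" "A n" by (rule rdpg_space[OF n])
    have "(\<Sum>j<n. \<Sum>i<j. (\<sigma> S i * \<sigma> T j + \<sigma> S j * \<sigma> T i)\<^sup>2) \<le> (\<Sum>j<n. \<Sum>i<j. 4)"
      by (intro sum_mono) (auto simp: \<sigma>_def)
    also have "\<dots> \<le> (\<Sum>j<n. real n * 4)" by (intro sum_mono) auto
    finally have V: "(\<Sum>j<n. \<Sum>i<j. (\<sigma> S i * \<sigma> T j + \<sigma> S j * \<sigma> T i)\<^sup>2) \<le> 4 * (real n)\<^sup>2"
      by (simp add: power2_eq_square mult_ac)
    have D: "(\<Sum>i<n. \<bar>\<sigma> S i * \<sigma> T i\<bar>) \<le> real n"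
      by (rule order_trans[OF sum_mono[where g = "\<lambda>_. 1"]]) (auto simp: \<sigma>_def)
    have pos: "0 < 3 * real n powr (3/2)" "0 < 4 * (real n)\<^sup>2" using n by auto
    note B = S.bilinear_tail[of "\<lambda>i _. \<sigma> S i" "\<lambda>j _. \<sigma> T j", OF borel_measurable_const borel_measurable_const V D pos]
    have "(real n powr (3/2))\<^sup>2 = (real n powr (3/2)) powr 2" using n by simp
    also have "\<dots> = real n powr 3" unfolding powr_powr by simp
    also have "\<dots> = real n ^ 3" using n by simp
    finally have "- 2 * (3 * real n powr (3/2))\<^sup>2 / (4 * (real n)\<^sup>2) \<le> - 4 * real n"
      using n by (simp add: power_mult_distrib field_simps power2_eq_square power3_eq_cube)
    then have "2 * exp (- 2 * (3 * real n powr (3/2))\<^sup>2 / (4 * (real n)\<^sup>2)) \<le> 2 * exp (- 4 * real n)"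
      by (intro mult_left_mono) auto
    then show ?thesis unfolding E_def p prod.case using B(1) order_trans[OF B(2)] by blast
  qed
  have "AE \<omega> in M. \<forall>\<^sub>F n in sequentially. \<forall>p\<in>Pow {..<n} \<times> Pow {..<n}. \<omega> \<notin> E n p"
  proof (rule borel_cantelli_family)
    have "real (card (Pow {..<n} \<times> Pow {..<n})) * (2 * exp (- 4 * real n)) = 2 * (4 * exp (- 4)) ^ n" for n
    proof -
      have "real (card (Pow {..<n} \<times> Pow {..<n})) = 4 ^ n"
        by (simp add: card_cartesian_product card_Pow flip: power_mult_distrib)
      moreover have "exp (- 4 * real n) = exp (- 4) ^ n" by (simp add: exp_of_nat_mult[symmetric] mult.commute)
      ultimately show ?thesis by (simp add: power_mult_distrib)
    qed
    moreover have "summable (\<lambda>n. 2 * (4 * exp (- 4) :: real) ^ n)"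
    proof (intro summable_mult summable_geometric)
      have "5 \<le> exp (4::real)" using exp_ge_add_one_self[of 4] by simp
      then show "norm (4 * exp (- 4) :: real) < 1" by (simp add: exp_minus field_simps)
    qed
    ultimately show "summable (\<lambda>n. real (card (Pow {..<n} \<times> Pow {..<n})) * (2 * exp (- 4 * real n)))"
      by (simp only:)
  qed (use E in auto)
  then show ?thesis
  proof (rule AE_mp, intro AE_I2 impI)
    fix \<omega> assume \<omega>: "\<omega> \<in> space M"
      and ev: "\<forall>\<^sub>F n in sequentially. \<forall>p\<in>Pow {..<n} \<times> Pow {..<n}. \<omega> \<notin> E n p"
    show "\<forall>\<^sub>F n in sequentially. cut_norm_le n (R n \<omega>) (4 * n powr (3/2))"
      using ev eventually_ge_at_top[of 1]
    proof eventually_elim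
      case (elim n)
      show ?case unfolding cut_norm_le_def
      proof (intro allI impI)
        fix s t :: "nat \<Rightarrow> real" assume st: "range s \<subseteq> {-1, 1} \<and> range t \<subseteq> {-1, 1}"
        define S T where "S = {i \<in> {..<n}. s i = 1}" and "T = {i \<in> {..<n}. t i = 1}"
        have s: "\<sigma> S i = s i" "\<sigma> T i = t i" if "i < n" for i
        proof -
          have "s i \<in> {-1, 1}" "t i \<in> {-1, 1}" using st by blast+
          then show "\<sigma> S i = s i" "\<sigma> T i = t i" using that by (auto simp: \<sigma>_def S_def T_def)
        qed
        have eq: "(\<Sum>i<n. \<Sum>j<n. s i * t j * R n \<omega> i j) = ?Q n S T \<omega>"
          by (intro sum.cong refl) (simp add: s)
        have "(S, T) \<in> Pow {..<n} \<times> Pow {..<n}" by (auto simp: S_def T_def)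
        then have "\<omega> \<notin> E n (S, T)" using elim(1) by blast
        then have "\<bar>?Q n S T \<omega>\<bar> \<le> 3 * real n powr (3/2) + real n"
          using \<omega> by (simp add: E_def)
        moreover have "real n \<le> real n powr (3/2)"
          using elim(2) powr_mono[of 1 "3/2" "real n"] by simp
        ultimately show "(\<Sum>i<n. \<Sum>j<n. s i * t j * R n \<omega> i j) \<le> 4 * n powr (3/2)"
          unfolding eq by linarith
      qed
    qed
  qed
qed

text \<open>A row sum fluctuates at scale sqrt n. The exponent 9/16 leaves room for a union bound
  over n d events, with tails of order exp(- n^(1/8)), and is still small enough for the error e
  \<beta> of the expansion.\<close>

lemma AE_rows:
  "AE \<omega> in M. \<forall>\<^sub>F n in sequentially. \<forall>i<n. \<forall>l. \<bar>\<Sum>j<n. R n \<omega> i j * X n \<omega> j $ l\<bar> \<le> 2 * n powr (9/16)"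
proof -
  define \<delta> where "\<delta> m i = (if i = m then 1 else 0 :: real)" for m i :: nat
  let ?Q = "\<lambda>n m l \<omega>. \<Sum>i<n. \<Sum>j<n. \<delta> m i * X n \<omega> j $ l * R n \<omega> i j"
  define E where "E n = (\<lambda>(m, l). {\<omega> \<in> space M. real n powr (9/16) + 1 \<le> \<bar>?Q n m l \<omega>\<bar>})" for n
  have E: "E n p \<in> sets M \<and> prob (E n p) \<le> 2 * exp (- 2 * (real n powr (9/16))\<^sup>2 / (2 * real n))"
    if n: "1 \<le> n" and p: "p \<in> {..<n} \<times> UNIV" for n p
  proof -
    obtain m l where p: "p = (m, l)" "m < n" using p by fastforce
    interpret S: rdpg_space M n \<Omega> F "X n" "A n" by (rule rdpg_space[OF n])
    have V: "(\<Sum>j<n. \<Sum>i<j. (\<delta> m i * x j $ l + \<delta> m j * x i $ l)\<^sup>2) \<le> 2 * real n" if x: "\<forall>i<n. x i \<in> \<Omega>" for x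
    proof -
      \<comment> \<open>As i < j, at most one of the two indicators is 1, so there is no cross term
        and only edges at the vertex m contribute.\<close>
      have "(\<Sum>j<n. \<Sum>i<j. (\<delta> m i * x j $ l + \<delta> m j * x i $ l)\<^sup>2) \<le> (\<Sum>j<n. \<Sum>i<j. \<delta> m i + \<delta> m j)"
      proof (intro sum_mono)
        fix j i assume ji: "j \<in> {..<n}" "i \<in> {..<j}"
        have "(x j $ l)\<^sup>2 \<le> 1" "(x i $ l)\<^sup>2 \<le> 1"
          using component_le_1[of "x j" l] component_le_1[of "x i" l] x ji by (auto simp: abs_square_le_1)
        then show "(\<delta> m i * x j $ l + \<delta> m j * x i $ l)\<^sup>2 \<le> \<delta> m i + \<delta> m j"
          using ji by (auto simp: \<delta>_def)
      qed
      also have "\<dots> \<le> (\<Sum>j<n. 1 + real n * \<delta> m j)"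
      proof (intro sum_mono)
        fix j assume j: "j \<in> {..<n}"
        have "(\<Sum>i<j. \<delta> m i + \<delta> m j) = (\<Sum>i<j. \<delta> m i) + real j * \<delta> m j" by (simp add: sum.distrib)
        moreover have "(\<Sum>i<j. \<delta> m i) \<le> 1" by (simp add: \<delta>_def)
        moreover have "real j * \<delta> m j \<le> real n * \<delta> m j" using j by (intro mult_right_mono) (auto simp: \<delta>_def)
        ultimately show "(\<Sum>i<j. \<delta> m i + \<delta> m j) \<le> 1 + real n * \<delta> m j" by linarith
      qed
      also have "\<dots> = 2 * real n" using p(2) by (simp add: sum.distrib \<delta>_def flip: sum_distrib_left)
      finally show ?thesis .
    qed
    have D: "(\<Sum>i<n. \<bar>\<delta> m i * x i $ l\<bar>) \<le> 1" if x: "\<forall>i<n. x i \<in> \<Omega>" for x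
    proof -
      have "(\<Sum>i<n. \<bar>\<delta> m i * x i $ l\<bar>) \<le> (\<Sum>i<n. \<delta> m i)"
        using component_le_1 x by (intro sum_mono) (auto simp: \<delta>_def)
      also have "\<dots> \<le> 1" by (simp add: \<delta>_def)
      finally show ?thesis .
    qed
    have pos: "0 < real n powr (9/16)" "0 < 2 * real n" using n by auto
    have nth: "(\<lambda>x :: real ^ 'd. x $ l) \<in> borel_measurable borel" by measurable
    show ?thesis unfolding E_def p prod.case
      using S.bilinear_tail[of "\<lambda>i _. \<delta> m i" "\<lambda>j x. x $ l", OF borel_measurable_const nth V D pos] by blast
  qed
  have "AE \<omega> in M. \<forall>\<^sub>F n in sequentially. \<forall>p\<in>{..<n} \<times> UNIV. \<omega> \<notin> E n p"
  proof (rule borel_cantelli_family)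
    have "(\<lambda>n. (real n * real CARD('d)) * (2 * exp (- 2 * (real n powr (9/16))\<^sup>2 / (2 * real n)))) \<in> O(\<lambda>n. 1 / real n ^ 2)"
      by real_asymp
    moreover have "real (card ({..<n} \<times> (UNIV :: 'd set))) = real n * real CARD('d)" for n
      by (simp add: card_cartesian_product)
    ultimately show "summable (\<lambda>n. real (card ({..<n} \<times> (UNIV :: 'd set))) * (2 * exp (- 2 * (real n powr (9/16))\<^sup>2 / (2 * real n))))"
      by (simp only: summable_bigo_inverse_square)
  qed (use E in auto)
  then show ?thesis
  proof (rule AE_mp, intro AE_I2 impI)
    fix \<omega> assume \<omega>: "\<omega> \<in> space M"
      and ev: "\<forall>\<^sub>F n in sequentially. \<forall>p\<in>{..<n} \<times> UNIV. \<omega> \<notin> E n p"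
    show "\<forall>\<^sub>F n in sequentially. \<forall>i<n. \<forall>l. \<bar>\<Sum>j<n. R n \<omega> i j * X n \<omega> j $ l\<bar> \<le> 2 * n powr (9/16)"
      using ev eventually_ge_at_top[of 1]
    proof eventually_elim
      case (elim n)
      show ?case
      proof (intro allI impI)
        fix m l assume m: "m < n"
        have "?Q n m l \<omega> = (\<Sum>i<n. if i = m then \<Sum>j<n. X n \<omega> j $ l * R n \<omega> i j else 0)"
          by (intro sum.cong) (auto simp: \<delta>_def)
        also have "\<dots> = (\<Sum>j<n. R n \<omega> m j * X n \<omega> j $ l)" using m by (simp add: mult.commute)
        finally have eq: "?Q n m l \<omega> = (\<Sum>j<n. R n \<omega> m j * X n \<omega> j $ l)" .
        have "\<omega> \<notin> E n (m, l)" using elim(1) m by blast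
        then have "\<bar>?Q n m l \<omega>\<bar> \<le> real n powr (9/16) + 1" using \<omega> by (simp add: E_def)
        also have "1 \<le> real n powr (9/16)" using elim(2) by (intro ge_one_powr_ge_zero) auto
        finally show "\<bar>\<Sum>j<n. R n \<omega> m j * X n \<omega> j $ l\<bar> \<le> 2 * n powr (9/16)" unfolding eq by simp
      qed
    qed
  qed
qed

text \<open>The positions form a triangular array with i.i.d. rows and no prescribed relation
  between them. The law of large numbers therefore comes from Hoeffding's inequality at level
  n^(3/4) and summability, applied to products of coordinates in [-1, 1].\<close>

lemma AE_gram:
  "AE \<omega> in M. (\<lambda>n. gram_matrix n (X n \<omega>) $ k $ l / n) \<longlonglongrightarrow> second_moment_matrix F $ k $ l"
proof -
  let ?m = "second_moment_matrix F $ k $ l"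
  define E where "E n (u::unit) = {\<omega> \<in> space M. real n powr (3/4) \<le> \<bar>(\<Sum>i<n. X n \<omega> i $ k * X n \<omega> i $ l) - real n * ?m\<bar>}" for n u
  have E: "E n u \<in> sets M \<and> prob (E n u) \<le> 2 * exp (- 2 * (real n powr (3/4))\<^sup>2 / (4 * real n))"
    if n: "1 \<le> n" for n u
  proof -
    interpret S: rdpg_space M n \<Omega> F "X n" "A n" by (rule rdpg_space[OF n])
    have nth: "(\<lambda>x :: real ^ 'd. x $ k * x $ l) \<in> borel_measurable borel" by measurable
    have Xm: "(\<lambda>\<omega>. X n \<omega> i $ k * X n \<omega> i $ l) \<in> borel_measurable M" if "i < n" for i
      by (rule measurable_compose[OF S.X_meas[OF that] nth])
    have ex: "expectation (\<lambda>\<omega>. X n \<omega> i $ k * X n \<omega> i $ l) = ?m" if "i < n" for i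
    proof -
      have "F = distr M borel (\<lambda>\<omega>. X n \<omega> i)" using rdpg[OF n] that by (auto simp: rdpg_def)
      then have "?m = (\<integral>x. x $ k * x $ l \<partial>distr M borel (\<lambda>\<omega>. X n \<omega> i))" by (simp add: second_moment_matrix_def)
      also have "\<dots> = expectation (\<lambda>\<omega>. X n \<omega> i $ k * X n \<omega> i $ l)"
        by (rule integral_distr[OF S.X_meas[OF that] nth])
      finally show ?thesis ..
    qed
    interpret H: Hoeffding_ineq M "{..<n}" "\<lambda>i \<omega>. X n \<omega> i $ k * X n \<omega> i $ l" "\<lambda>_. -1" "\<lambda>_. 1" "real n * ?m"
    proof unfold_locales
      have "indep_vars (\<lambda>_. borel) (\<lambda>i \<omega>. X n \<omega> i) {..<n}" using rdpg[OF n] by (auto simp: rdpg_def)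
      then show "indep_vars (\<lambda>_. borel) (\<lambda>i \<omega>. X n \<omega> i $ k * X n \<omega> i $ l) {..<n}"
        by (rule indep_vars_compose2[where Y = "\<lambda>_ x. x $ k * x $ l"]) (rule nth)
      show "AE \<omega> in M. X n \<omega> i $ k * X n \<omega> i $ l \<in> {-1..1}" if "i \<in> {..<n}" for i
        using S.X_in
      proof eventually_elim
        case (elim \<omega>)
        then have "\<bar>X n \<omega> i $ k\<bar> \<le> 1" "\<bar>X n \<omega> i $ l\<bar> \<le> 1" using component_le_1 that by auto
        then have "\<bar>X n \<omega> i $ k * X n \<omega> i $ l\<bar> \<le> 1" unfolding abs_mult by (intro mult_le_one) auto
        then show ?case by (simp add: abs_le_iff)
      qed
      show "real n * ?m \<equiv> \<Sum>i<n. expectation (\<lambda>\<omega>. X n \<omega> i $ k * X n \<omega> i $ l)"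
        by (rule eq_reflection) (simp add: ex)
    qed auto
    have m: "E n u \<in> sets M" unfolding E_def using Xm by measurable
    have "prob (E n u) \<le> 2 * exp (- 2 * (real n powr (3/4))\<^sup>2 / (\<Sum>i<n. (1 - - 1)\<^sup>2))"
      unfolding E_def using n by (intro H.Hoeffding_ineq_abs_ge) auto
    then show ?thesis using m by (simp add: mult.commute)
  qed
  have "AE \<omega> in M. \<forall>\<^sub>F n in sequentially. \<forall>u\<in>(UNIV::unit set). \<omega> \<notin> E n u"
  proof (rule borel_cantelli_family)
    have "(\<lambda>n. exp (- 2 * (real n powr (3/4))\<^sup>2 / (4 * real n))) \<in> O(\<lambda>n. 1 / real n ^ 2)"
      by real_asymp
    then show "summable (\<lambda>n. real (card (UNIV::unit set)) * (2 * exp (- 2 * (real n powr (3/4))\<^sup>2 / (4 * real n))))"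
      by (intro summable_mult summable_bigo_inverse_square)
  qed (use E in auto)
  then show ?thesis
  proof (rule AE_mp, intro AE_I2 impI)
    fix \<omega> assume \<omega>: "\<omega> \<in> space M" and ev: "\<forall>\<^sub>F n in sequentially. \<forall>u\<in>(UNIV::unit set). \<omega> \<notin> E n u"
    have "(\<lambda>n. gram_matrix n (X n \<omega>) $ k $ l / n - ?m) \<longlonglongrightarrow> 0"
    proof (rule Lim_null_comparison)
      show "(\<lambda>n. real n powr (3/4) / real n) \<longlonglongrightarrow> 0" by real_asymp
      show "\<forall>\<^sub>F n in sequentially. norm (gram_matrix n (X n \<omega>) $ k $ l / n - ?m) \<le> real n powr (3/4) / real n"
        using ev eventually_ge_at_top[of 1]
      proof eventually_elim
        case (elim n)
        then have b: "\<bar>(\<Sum>i<n. X n \<omega> i $ k * X n \<omega> i $ l) - real n * ?m\<bar> \<le> real n powr (3/4)"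
          using \<omega> by (auto simp: E_def)
        have "gram_matrix n (X n \<omega>) $ k $ l / n - ?m = ((\<Sum>i<n. X n \<omega> i $ k * X n \<omega> i $ l) - real n * ?m) / n"
          using elim(2) by (simp add: gram_matrix_def diff_divide_distrib)
        then show ?case using b by (simp add: divide_right_mono)
      qed
    qed
    then show "(\<lambda>n. gram_matrix n (X n \<omega>) $ k $ l / n) \<longlonglongrightarrow> ?m" by (simp add: LIM_zero_iff)
  qed
qed

end

subsection \<open>Smooth functions of the embedding\<close>

lemma twice_continuously_differentiable_taylor:
  fixes \<kappa> :: "real ^ 'd \<Rightarrow> real ^ 'd \<Rightarrow> real"
  assumes "twice_continuously_differentiable (\<lambda>(x, y). \<kappa> x y)"
  obtains g where "\<And>m. continuous_on UNIV (\<lambda>(x, z). g m x z :: real)"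
    "\<And>r. \<exists>K\<ge>0. \<forall>a b z. norm a \<le> r \<longrightarrow> norm b \<le> r \<longrightarrow> norm z \<le> r \<longrightarrow>
       \<bar>\<kappa> b z - \<kappa> a z - (\<Sum>m\<in>UNIV. g m a z * (b - a) $ m)\<bar> \<le> K * (norm (b - a))\<^sup>2"
proof -
  obtain f' :: "(real ^ 'd) \<times> (real ^ 'd) \<Rightarrow> (((real ^ 'd) \<times> (real ^ 'd)) \<Rightarrow>\<^sub>L real)" and f''
    where f': "\<And>p. ((\<lambda>(x, y). \<kappa> x y) has_derivative blinfun_apply (f' p)) (at p)"
      and f'': "\<And>p. (f' has_derivative blinfun_apply (f'' p)) (at p)" and cont: "continuous_on UNIV f''"
    using assms unfolding twice_continuously_differentiable_def by blast
  define g where "g m x z = f' (x, z) (axis m 1, 0)" for m x z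
  have cont': "continuous_on UNIV f'"
    by (rule has_derivative_continuous_on) (rule has_derivative_at_withinI[OF f''])
  have g_cont: "continuous_on UNIV (\<lambda>(x, z). g m x z)" for m
    unfolding g_def case_prod_unfold prod.collapse
    by (intro continuous_intros continuous_on_subset[OF cont']) auto
  have g_sum: "f' (x, z) (v, 0) = (\<Sum>m\<in>UNIV. g m x z * v $ m)" for x z v
  proof -
    have "(v, 0) = (\<Sum>m\<in>UNIV. v $ m *\<^sub>R (axis m 1, 0 :: real ^ 'd))"
      using basis_expansion[of v] by (simp add: sum_prod scalar_mult_eq_scaleR prod_eq_iff fst_sum snd_sum)
    then have "f' (x, z) (v, 0) = f' (x, z) (\<Sum>m\<in>UNIV. v $ m *\<^sub>R (axis m 1, 0))" by (rule arg_cong)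
    also have "\<dots> = (\<Sum>m\<in>UNIV. g m x z * v $ m)"
      by (simp only: blinfun.sum_right blinfun.scaleR_right g_def) (simp add: mult.commute)
    finally show ?thesis .
  qed
  have "\<exists>K\<ge>0. \<forall>a b z. norm a \<le> r \<longrightarrow> norm b \<le> r \<longrightarrow> norm z \<le> r \<longrightarrow>
       \<bar>\<kappa> b z - \<kappa> a z - (\<Sum>m\<in>UNIV. g m a z * (b - a) $ m)\<bar> \<le> K * (norm (b - a))\<^sup>2" for r
  proof -
    \<comment> \<open>The norm of a pair is at most the sum of the two norms, hence the radius r +
      r.\<close>
    let ?S = "cball 0 (r + r) :: ((real ^ 'd) \<times> (real ^ 'd)) set"
    have "compact (f'' ` ?S)"
      by (intro compact_continuous_image continuous_on_subset[OF cont]) auto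
    then obtain K where K: "\<And>p. p \<in> ?S \<Longrightarrow> norm (f'' p) \<le> K"
      using compact_imp_bounded bounded_iff by (metis imageI)
    have lip: "norm (f' p - f' q) \<le> \<bar>K\<bar> * norm (p - q)" if "p \<in> ?S" "q \<in> ?S" for p q
    proof (rule differentiable_bound[where S = ?S])
      show "(f' has_derivative blinfun_apply (f'' x)) (at x within ?S)" for x
        by (rule has_derivative_at_withinI[OF f''])
      show "onorm (blinfun_apply (f'' x)) \<le> \<bar>K\<bar>" if "x \<in> ?S" for x
        using K[OF that] by (simp add: norm_blinfun.rep_eq)
    qed (use that in auto)
    have "\<bar>\<kappa> b z - \<kappa> a z - (\<Sum>m\<in>UNIV. g m a z * (b - a) $ m)\<bar> \<le> \<bar>K\<bar> * (norm (b - a))\<^sup>2"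
      if n: "norm a \<le> r" "norm b \<le> r" "norm z \<le> r" for a b z
    proof -
      \<comment> \<open>After subtraction of the linearization at \<open>a\<close>, the derivative
        on the segment is at most a multiple of \<open>norm (b - a)\<close>; the mean value
        inequality supplies the second factor.\<close>
      define h where "h x = \<kappa> x z - f' (a, z) (x, 0)" for x
      have in_S: "(x, z) \<in> ?S" if "norm x \<le> r" for x
        using norm_Pair_le[of x z] that n(3) by simp
      have seg: "norm x \<le> r" "norm (x - a) \<le> norm (b - a)" if "x \<in> closed_segment a b" for x
      proof -
        have "closed_segment a b \<subseteq> cball 0 r" using n by (intro closed_segment_subset) auto
        then show "norm x \<le> r" using that by auto
        show "norm (x - a) \<le> norm (b - a)"
          using dist_in_closed_segment[OF that] by (simp add: dist_norm norm_minus_commute)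
      qed
      have "norm (h b - h a) \<le> (\<bar>K\<bar> * norm (b - a)) * norm (b - a)"
      proof (rule differentiable_bound[where S = "closed_segment a b"])
        fix x assume x: "x \<in> closed_segment a b"
        have "((\<lambda>x. (x, z)) has_derivative (\<lambda>v. (v, 0))) (at x)"
          by (auto intro!: derivative_eq_intros)
        from has_derivative_compose[OF this f']
        have "((\<lambda>x. \<kappa> x z) has_derivative (\<lambda>v. f' (x, z) (v, 0))) (at x)" by simp
        moreover have "((\<lambda>x. f' (a, z) (x, 0)) has_derivative (\<lambda>v. f' (a, z) (v, 0))) (at x)"
          by (auto intro!: derivative_eq_intros)
        ultimately have "(h has_derivative (\<lambda>v. f' (x, z) (v, 0) - f' (a, z) (v, 0))) (at x)"
          unfolding h_def by (rule has_derivative_diff)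
        then show "(h has_derivative (\<lambda>v. f' (x, z) (v, 0) - f' (a, z) (v, 0))) (at x within closed_segment a b)"
          by (rule has_derivative_at_withinI)
        show "onorm (\<lambda>v. f' (x, z) (v, 0) - f' (a, z) (v, 0)) \<le> \<bar>K\<bar> * norm (b - a)"
        proof (rule onorm_bound)
          fix v
          have "norm (f' (x, z) (v, 0) - f' (a, z) (v, 0)) = norm ((f' (x, z) - f' (a, z)) (v, 0))"
            by (simp add: blinfun.diff_left)
          also have "\<dots> \<le> norm (f' (x, z) - f' (a, z)) * norm (v, 0 :: real ^ 'd)" by (rule norm_blinfun)
          also have "\<dots> \<le> (\<bar>K\<bar> * norm ((x, z) - (a, z))) * norm (v, 0 :: real ^ 'd)"
            using lip[OF in_S in_S] seg(1)[OF x] n(1) by (intro mult_right_mono) auto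
          also have "\<dots> = (\<bar>K\<bar> * norm (x - a)) * norm v" by (simp add: norm_Pair)
          also have "\<dots> \<le> (\<bar>K\<bar> * norm (b - a)) * norm v"
            using seg(2)[OF x] by (intro mult_right_mono mult_left_mono) auto
          finally show "norm (f' (x, z) (v, 0) - f' (a, z) (v, 0)) \<le> (\<bar>K\<bar> * norm (b - a)) * norm v" .
        qed auto
      qed auto
      moreover have "h b - h a = \<kappa> b z - \<kappa> a z - (\<Sum>m\<in>UNIV. g m a z * (b - a) $ m)"
      proof -
        have "f' (a, z) (b, 0) - f' (a, z) (a, 0) = f' (a, z) (b - a, 0)"
          by (simp flip: blinfun.diff_right)
        then show ?thesis unfolding h_def g_sum[symmetric] by simp
      qed
      ultimately show ?thesis by (simp add: power2_eq_square mult.assoc)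
    qed
    then show ?thesis by (intro exI[of _ "\<bar>K\<bar>"]) auto
  qed
  then show thesis using that[of g] g_cont by blast
qed

text \<open>The quadratic Taylor term costs sqrt n times the squared first-order error. In the
  linear term the second-order expansion is inserted: its main part is a bilinear noise form of size
  \<tau> n^(3/2), divided by sqrt n and by \<open>s k\<close>, which is at least c n; its error is
  handled by the Cauchy-Schwarz inequality.\<close>

lemma embedding_functional_bound:
  fixes Xh x :: "nat \<Rightarrow> real ^ 'd" and W :: "real ^ 'd ^ 'd" and s :: "real ^ 'd"
    and f :: "real ^ 'd \<Rightarrow> real" and r :: "nat \<Rightarrow> nat \<Rightarrow> real"
  assumes n: "0 < n" and W: "orthogonal_matrix W" and W1: "\<And>a b. \<bar>W $ a $ b\<bar> \<le> 1"
    and y: "\<And>k i. y k i = (tp W *v x i) $ k / sqrt n"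
    and first: "\<And>k. (\<Sum>i<n. (Xh i $ k / sqrt n - y k i)\<^sup>2) \<le> b\<^sup>2"
    and second: "\<And>k. (\<Sum>i<n. (Xh i $ k / sqrt n - y k i - (\<Sum>j<n. r i j * y k j) / s $ k)\<^sup>2) \<le> \<rho>\<^sup>2"
    and \<rho>: "0 \<le> \<rho>" and c: "0 < c" and s: "\<And>k. c \<le> s $ k / n"
    and K: "0 \<le> K" and taylor: "\<And>i. i < n \<Longrightarrow>
      \<bar>f (W *v Xh i) - f (x i) - (\<Sum>m\<in>UNIV. g m (x i) * (W *v Xh i - x i) $ m)\<bar> \<le> K * (norm (W *v Xh i - x i))\<^sup>2"
    and G: "\<And>m i. i < n \<Longrightarrow> \<bar>g m (x i)\<bar> \<le> G" and G0: "0 \<le> G"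
    and T: "\<And>m l. \<bar>\<Sum>i<n. \<Sum>j<n. g m (x i) * x j $ l * r i j\<bar> \<le> \<tau> * n powr (3/2)"
  defines "D \<equiv> real CARD('d)"
  shows "\<bar>1 / sqrt n * (\<Sum>i<n. f (W *v Xh i) - f (x i))\<bar>
    \<le> K * sqrt n * (D * b\<^sup>2) + D * D * (D * \<tau> / c + G * sqrt n * \<rho>)"
proof -
  let ?T = "tp W"
  have n0: "0 < real n" using n by simp
  define a where "a k i = Xh i $ k / sqrt n - y k i" for k i
  define v where "v i = Xh i - ?T *v x i" for i
  have v: "v i $ k = sqrt n * a k i" for i k
    using n0 by (simp add: v_def a_def y field_simps)
  \<comment> \<open>The deviation in the original coordinates is the rotated deviation from W^T x,
    hence of the same norm, and it is linear in the columns \<open>a k\<close> with entries of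
    \<open>W\<close> as coefficients.\<close>
  have Wv: "W *v Xh i - x i = W *v v i" for i
  proof -
    have "W *v (?T *v x i) = x i"
      using W unfolding matrix_vector_mul_assoc by (simp add: orthogonal_matrix_def)
    then show ?thesis by (simp add: v_def matrix_vector_mult_diff_distrib del: transpose_matrix_vector)
  qed
  have nWv: "(norm (W *v v i))\<^sup>2 = real n * (\<Sum>k\<in>UNIV. (a k i)\<^sup>2)" for i
  proof -
    have WT: "tp ?T = W" by (simp add: transpose_transpose)
    have "orthogonal_matrix ?T" using W by (simp add: orthogonal_matrix_transpose)
    from inner_transpose_orthogonal[OF this, of "v i" "v i"]
    have "(W *v v i) \<bullet> (W *v v i) = v i \<bullet> v i" by (simp only: WT)
    also have "\<dots> = real n * (\<Sum>k\<in>UNIV. (a k i)\<^sup>2)"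
    proof -
      have "(sqrt n * t) * (sqrt n * t) = (sqrt n)\<^sup>2 * t\<^sup>2" for t
        by (simp only: power2_eq_square mult_ac)
      then show ?thesis unfolding inner_vec_def v by (simp add: sum_distrib_left)
    qed
    finally show ?thesis by (simp add: power2_norm_eq_inner)
  qed
  define L where "L i = (\<Sum>m\<in>UNIV. g m (x i) * (W *v v i) $ m)" for i
  have rem: "\<bar>\<Sum>i<n. (f (W *v Xh i) - f (x i)) - L i\<bar> \<le> K * (real n * (D * b\<^sup>2))"
  proof -
    have "\<bar>\<Sum>i<n. (f (W *v Xh i) - f (x i)) - L i\<bar> \<le> (\<Sum>i<n. K * (real n * (\<Sum>k\<in>UNIV. (a k i)\<^sup>2)))"
      using taylor unfolding Wv nWv L_def by (intro order_trans[OF sum_abs] sum_mono) auto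
    also have "\<dots> = K * (real n * (\<Sum>k\<in>UNIV. \<Sum>i<n. (a k i)\<^sup>2))"
    proof -
      have sw: "(\<Sum>k\<in>UNIV. \<Sum>i<n. (a k i)\<^sup>2) = (\<Sum>i<n. \<Sum>k\<in>UNIV. (a k i)\<^sup>2)" by (rule sum.swap)
      show ?thesis unfolding sw by (simp only: sum_distrib_left)
    qed
    also have "\<dots> \<le> K * (real n * (\<Sum>k\<in>(UNIV :: 'd set). b\<^sup>2))"
      using K first unfolding a_def by (intro mult_left_mono sum_mono) auto
    finally show ?thesis by (simp add: D_def)
  qed
  have lin: "1 / sqrt n * (\<Sum>i<n. L i) = (\<Sum>m\<in>UNIV. \<Sum>k\<in>UNIV. W $ m $ k * (\<Sum>i<n. g m (x i) * a k i))"
  proof -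
    have "1 / sqrt n * L i = (\<Sum>m\<in>UNIV. \<Sum>k\<in>UNIV. W $ m $ k * (g m (x i) * a k i))" for i
      using n0 by (simp add: L_def matrix_vector_mult_def v sum_distrib_left mult_ac)
    then have "1 / sqrt n * (\<Sum>i<n. L i) = (\<Sum>i<n. \<Sum>m\<in>UNIV. \<Sum>k\<in>UNIV. W $ m $ k * (g m (x i) * a k i))"
      unfolding sum_distrib_left by simp
    also have "\<dots> = (\<Sum>m\<in>UNIV. \<Sum>i<n. \<Sum>k\<in>UNIV. W $ m $ k * (g m (x i) * a k i))" by (rule sum.swap)
    also have "\<dots> = (\<Sum>m\<in>UNIV. \<Sum>k\<in>UNIV. \<Sum>i<n. W $ m $ k * (g m (x i) * a k i))"
      by (rule sum.cong[OF refl], rule sum.swap)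
    finally show ?thesis by (simp add: sum_distrib_left)
  qed
  have Q: "\<bar>\<Sum>i<n. g m (x i) * a k i\<bar> \<le> D * \<tau> / c + G * sqrt n * \<rho>" for m k
  proof -
    \<comment> \<open>The part of the column that is not explained by the noise applied to
      \<open>y k\<close>.\<close>
    define \<epsilon> where "\<epsilon> i = a k i - (\<Sum>j<n. r i j * y k j) / s $ k" for i
    have sk: "c * n \<le> s $ k" "0 < s $ k"
    proof -
      show "c * n \<le> s $ k" using s[of k] n0 by (simp add: field_simps)
      moreover have "0 < c * n" using c n0 by simp
      ultimately show "0 < s $ k" by linarith
    qed
    have div_le: "\<bar>p / sqrt n / s $ k\<bar> \<le> q / sqrt n / s $ k" if "\<bar>p\<bar> \<le> q" for p q
    proof -
      have "\<bar>p / sqrt n / s $ k\<bar> = \<bar>p\<bar> / sqrt n / s $ k" using sk by simp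
      also have "\<dots> \<le> q / sqrt n / s $ k" using sk by (intro divide_right_mono that) auto
      finally show ?thesis .
    qed
    have "(\<Sum>i<n. g m (x i) * a k i) = (\<Sum>i<n. g m (x i) * (\<Sum>j<n. r i j * y k j)) / s $ k + (\<Sum>i<n. g m (x i) * \<epsilon> i)"
    proof -
      have "g m (x i) * a k i = g m (x i) * (\<Sum>j<n. r i j * y k j) / s $ k + g m (x i) * \<epsilon> i" for i
        by (simp add: \<epsilon>_def right_diff_distrib)
      then show ?thesis by (simp only: sum.distrib sum_divide_distrib[symmetric])
    qed
    also have "(\<Sum>i<n. g m (x i) * (\<Sum>j<n. r i j * y k j))
      = (\<Sum>l\<in>UNIV. W $ l $ k * (\<Sum>i<n. \<Sum>j<n. g m (x i) * x j $ l * r i j)) / sqrt n"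
    proof -
      have yk: "y k j = (\<Sum>l\<in>UNIV. W $ l $ k * x j $ l) / sqrt n" for j
        by (simp add: y matrix_vector_mult_def Finite_Cartesian_Product.transpose_def del: transpose_matrix_vector)
      have "(\<Sum>i<n. g m (x i) * (\<Sum>j<n. r i j * y k j))
        = (\<Sum>i<n. \<Sum>j<n. \<Sum>l\<in>UNIV. W $ l $ k * (g m (x i) * x j $ l * r i j)) / sqrt n"
        unfolding yk by (simp add: sum_distrib_left sum_divide_distrib mult_ac)
      also have "(\<Sum>i<n. \<Sum>j<n. \<Sum>l\<in>UNIV. W $ l $ k * (g m (x i) * x j $ l * r i j))
        = (\<Sum>i<n. \<Sum>l\<in>UNIV. \<Sum>j<n. W $ l $ k * (g m (x i) * x j $ l * r i j))"
        by (rule sum.cong[OF refl], rule sum.swap)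
      also have "\<dots> = (\<Sum>l\<in>UNIV. \<Sum>i<n. \<Sum>j<n. W $ l $ k * (g m (x i) * x j $ l * r i j))"
        by (rule sum.swap)
      finally show ?thesis by (simp add: sum_distrib_left)
    qed
    finally have eq: "(\<Sum>i<n. g m (x i) * a k i)
      = (\<Sum>l\<in>UNIV. W $ l $ k * (\<Sum>i<n. \<Sum>j<n. g m (x i) * x j $ l * r i j)) / sqrt n / s $ k + (\<Sum>i<n. g m (x i) * \<epsilon> i)" .
    have "\<bar>\<Sum>l\<in>UNIV. W $ l $ k * (\<Sum>i<n. \<Sum>j<n. g m (x i) * x j $ l * r i j)\<bar> \<le> (\<Sum>l\<in>(UNIV :: 'd set). 1 * (\<tau> * n powr (3/2)))"
      using T W1 by (intro order_trans[OF sum_abs] sum_mono) (simp only: abs_mult, intro mult_mono, auto)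
    also have "\<dots> = D * \<tau> * (n * sqrt n)"
    proof -
      have "n powr (3/2) = n powr (1 + 1/2)" by simp
      also have "\<dots> = n * sqrt n" unfolding powr_add using n0 by (simp add: powr_half_sqrt)
      finally show ?thesis by (simp add: D_def)
    qed
    finally have "\<bar>(\<Sum>l\<in>UNIV. W $ l $ k * (\<Sum>i<n. \<Sum>j<n. g m (x i) * x j $ l * r i j)) / sqrt n / s $ k\<bar>
      \<le> D * \<tau> * (n * sqrt n) / sqrt n / s $ k"
      by (rule div_le)
    also have "\<dots> = D * \<tau> * n / s $ k" using n0 by simp
    also have "\<dots> \<le> D * \<tau> * n / (c * n)"
    proof -
      have "0 \<le> \<tau> * n powr (3/2)" using T[of undefined undefined] by linarith
      then have "0 \<le> \<tau>" using n0 by (simp add: zero_le_mult_iff)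
      then show ?thesis using sk c n0 by (intro divide_left_mono) (auto simp: D_def)
    qed
    also have "\<dots> = D * \<tau> / c" using n0 by simp
    finally have 1: "\<bar>(\<Sum>l\<in>UNIV. W $ l $ k * (\<Sum>i<n. \<Sum>j<n. g m (x i) * x j $ l * r i j)) / sqrt n / s $ k\<bar> \<le> D * \<tau> / c" .
    have "(\<Sum>i<n. g m (x i) * \<epsilon> i)\<^sup>2 \<le> (\<Sum>i<n. (g m (x i))\<^sup>2) * (\<Sum>i<n. (\<epsilon> i)\<^sup>2)"
      by (rule Cauchy_Schwarz_ineq_sum)
    also have "\<dots> \<le> (\<Sum>i<n. G\<^sup>2) * \<rho>\<^sup>2"
    proof (intro mult_mono sum_mono)
      show "(g m (x i))\<^sup>2 \<le> G\<^sup>2" if "i \<in> {..<n}" for i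
        using power_mono[OF G[of i m], of 2] that by simp
      show "(\<Sum>i<n. (\<epsilon> i)\<^sup>2) \<le> \<rho>\<^sup>2" using second[of k] by (simp add: \<epsilon>_def a_def)
    qed (auto intro: sum_nonneg)
    also have "\<dots> = (G * sqrt n * \<rho>)\<^sup>2" by (simp add: power_mult_distrib)
    finally have "\<bar>\<Sum>i<n. g m (x i) * \<epsilon> i\<bar>\<^sup>2 \<le> (G * sqrt n * \<rho>)\<^sup>2" by simp
    then have "\<bar>\<Sum>i<n. g m (x i) * \<epsilon> i\<bar> \<le> G * sqrt n * \<rho>"
      by (rule power2_le_imp_le) (use G0 \<rho> in simp)
    then show ?thesis unfolding eq using 1 by linarith
  qed
  have "\<bar>1 / sqrt n * (\<Sum>i<n. L i)\<bar> \<le> (\<Sum>m\<in>(UNIV :: 'd set). \<Sum>k\<in>(UNIV :: 'd set). 1 * (D * \<tau> / c + G * sqrt n * \<rho>))"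
    unfolding lin using W1 Q
    by (intro order_trans[OF sum_abs] sum_mono) (simp only: abs_mult, intro mult_mono, auto)
  then have l: "\<bar>1 / sqrt n * (\<Sum>i<n. L i)\<bar> \<le> D * D * (D * \<tau> / c + G * sqrt n * \<rho>)"
    by (simp add: D_def mult.assoc)
  have "1 / sqrt n * (\<Sum>i<n. f (W *v Xh i) - f (x i))
    = 1 / sqrt n * (\<Sum>i<n. (f (W *v Xh i) - f (x i)) - L i) + 1 / sqrt n * (\<Sum>i<n. L i)"
    by (simp add: sum_subtractf right_diff_distrib)
  moreover have "\<bar>1 / sqrt n * (\<Sum>i<n. (f (W *v Xh i) - f (x i)) - L i)\<bar> \<le> K * sqrt n * (D * b\<^sup>2)"
  proof -
    have "\<bar>1 / sqrt n * (\<Sum>i<n. (f (W *v Xh i) - f (x i)) - L i)\<bar> \<le> 1 / sqrt n * (K * (real n * (D * b\<^sup>2)))"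
      using rem n0 by (simp add: abs_mult divide_right_mono)
    also have "\<dots> = K * (real n / sqrt n) * (D * b\<^sup>2)" by simp
    also have "\<dots> = K * sqrt n * (D * b\<^sup>2)" by (subst real_div_sqrt) auto
    finally show ?thesis .
  qed
  ultimately show ?thesis using l by linarith
qed

text \<open>Compactness reduces \<Omega> to a finite net inside \<open>D\<close>, on which
  convergence is simultaneous. Moving from a parameter to the nearest net point changes the
  coefficients by at most \<epsilon>/8, hence the form by at most \<epsilon>/8 times the cut norm
  bound 4 n^(3/2). The other half of \<epsilon> is left for the net.\<close>

lemma bilinear_uniform:
  fixes x :: "nat \<Rightarrow> nat \<Rightarrow> real ^ 'd" and r :: "nat \<Rightarrow> nat \<Rightarrow> nat \<Rightarrow> real"
    and g :: "real ^ 'd \<Rightarrow> real ^ 'd \<Rightarrow> real"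
  assumes comp: "compact \<Omega>" and D: "D \<subseteq> \<Omega>" "\<Omega> \<subseteq> closure D"
    and g: "continuous_on (\<Omega> \<times> \<Omega>) (\<lambda>(x, z). g x z)"
    and x: "\<And>n i. 1 \<le> n \<Longrightarrow> i < n \<Longrightarrow> x n i \<in> \<Omega>" and h: "\<And>x. x \<in> \<Omega> \<Longrightarrow> \<bar>h x\<bar> \<le> 1"
    and lim: "\<And>z. z \<in> D \<Longrightarrow> (\<lambda>n. (\<Sum>i<n. \<Sum>j<n. g (x n i) z * h (x n j) * r n i j) / n powr (3/2)) \<longlonglongrightarrow> 0"
    and cut: "\<forall>\<^sub>F n in sequentially. cut_norm_le n (r n) (4 * n powr (3/2))"
    and \<epsilon>: "0 < \<epsilon>"
  shows "\<forall>\<^sub>F n in sequentially. \<forall>z\<in>\<Omega>. \<bar>\<Sum>i<n. \<Sum>j<n. g (x n i) z * h (x n j) * r n i j\<bar> \<le> \<epsilon> * n powr (3/2)"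
proof -
  let ?T = "\<lambda>n z. \<Sum>i<n. \<Sum>j<n. g (x n i) z * h (x n j) * r n i j"
  have "uniformly_continuous_on (\<Omega> \<times> \<Omega>) (\<lambda>(x, z). g x z)"
    by (intro compact_uniformly_continuous g compact_Times comp)
  then obtain \<delta> where \<delta>: "0 < \<delta>" and uc: "\<And>p q. p \<in> \<Omega> \<times> \<Omega> \<Longrightarrow> q \<in> \<Omega> \<times> \<Omega> \<Longrightarrow> dist q p < \<delta> \<Longrightarrow>
      dist (case q of (x, z) \<Rightarrow> g x z) (case p of (x, z) \<Rightarrow> g x z) < \<epsilon> / 8"
    using \<epsilon> unfolding uniformly_continuous_on_def by (metis zero_less_divide_iff zero_less_numeral)
  have "\<Omega> \<subseteq> (\<Union>z\<in>D. ball z \<delta>)"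
  proof
    fix w assume "w \<in> \<Omega>"
    then have "w \<in> closure D" using D by blast
    then obtain z where "z \<in> D" "dist z w < \<delta>" using \<delta> unfolding closure_approachable by blast
    then show "w \<in> (\<Union>z\<in>D. ball z \<delta>)" by auto
  qed
  then obtain N where N: "N \<subseteq> D" "finite N" "\<Omega> \<subseteq> (\<Union>z\<in>N. ball z \<delta>)"
    by (rule compactE_image[OF comp, rotated]) auto
  have "\<forall>\<^sub>F n in sequentially. \<bar>?T n z / n powr (3/2)\<bar> < \<epsilon> / 2" if "z \<in> N" for z
    using tendsto_rabs[OF lim[of z]] N(1) that \<epsilon> by (intro order_tendstoD(2)[where y = "\<bar>0\<bar>"]) auto
  then have "\<forall>\<^sub>F n in sequentially. \<forall>z\<in>N. \<bar>?T n z / n powr (3/2)\<bar> < \<epsilon> / 2"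
    using N(2) by (simp add: eventually_ball_finite)
  then show ?thesis using cut eventually_ge_at_top[of 1]
  proof eventually_elim
    case (elim n)
    have n0: "0 < real n powr (3/2)" using elim(3) by simp
    show ?case
    proof
      fix w assume w: "w \<in> \<Omega>"
      then obtain z where z: "z \<in> N" "dist z w < \<delta>" using N(3) by auto
      have zO: "z \<in> \<Omega>" using z N D by blast
      have "?T n w - ?T n z = (\<Sum>i<n. \<Sum>j<n. (g (x n i) w - g (x n i) z) * h (x n j) * r n i j)"
        by (simp add: left_diff_distrib sum_subtractf)
      also have "\<bar>\<dots>\<bar> \<le> \<epsilon> / 8 * 1 * (4 * n powr (3/2))"
      proof (rule bilinear_le_signs[OF elim(2)])
        fix i assume "i < n"
        then have xi: "x n i \<in> \<Omega>" using x elim(3) by blast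
        then show "\<bar>h (x n i)\<bar> \<le> 1" by (rule h)
        have "dist (x n i, w) (x n i, z) < \<delta>" using z by (simp add: dist_Pair_Pair dist_commute)
        from uc[OF _ _ this] xi w zO show "\<bar>g (x n i) w - g (x n i) z\<bar> \<le> \<epsilon> / 8" by (simp add: dist_real_def)
      qed (use \<epsilon> in auto)
      finally have 1: "\<bar>?T n w - ?T n z\<bar> \<le> \<epsilon> / 2 * n powr (3/2)" by simp
      have "\<bar>?T n z\<bar> / n powr (3/2) < \<epsilon> / 2" using elim(1) z n0 by auto
      then have "\<bar>?T n z\<bar> \<le> \<epsilon> / 2 * n powr (3/2)" using n0 by (simp add: pos_divide_less_eq)
      then show "\<bar>?T n w\<bar> \<le> \<epsilon> * n powr (3/2)" using 1 by linarith
    qed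
  qed
qed

section \<open>Passing between rotated and original coordinates\<close>

lemma norm_orthogonal_matrix_mult:
  fixes W :: "real ^ 'd ^ 'd"
  assumes "orthogonal_matrix W"
  shows "norm (W *v v) = norm v" "norm (tp W *v v) = norm v"
proof -
  have *: "norm (tp V *v v) = norm v" if "orthogonal_matrix V" for V :: "real ^ 'd ^ 'd"
    unfolding norm_eq_sqrt_inner inner_transpose_orthogonal[OF that] ..
  show "norm (tp W *v v) = norm v" by (rule *[OF assms])
  have "orthogonal_matrix (tp W)" using assms by (simp add: orthogonal_matrix_transpose)
  moreover have "tp (tp W) = W" by simp
  ultimately show "norm (W *v v) = norm v" using *[of "tp W"] by (simp only:)
qed

lemma gram_eigenvalue_bounds:
  fixes x :: "nat \<Rightarrow> real ^ 'd" and W :: "real ^ 'd ^ 'd"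
  assumes W: "orthogonal_matrix W"
    and eig: "W ** (\<chi> k l. if k = l then s $ k else 0) ** tp W = gram_matrix n x"
    and x: "\<And>i. i < n \<Longrightarrow> norm (x i) \<le> 1"
  shows "0 \<le> s $ k" "s $ k \<le> n"
proof -
  let ?T = "tp W"
  have s: "s $ k = (\<Sum>i<n. ((?T *v x i) $ k)\<^sup>2)"
    using gram_rotated[OF W eig, of k k] by (simp only: power2_eq_square refl if_True)
  show "0 \<le> s $ k" unfolding s by (intro sum_nonneg) auto
  have "(\<Sum>i<n. ((?T *v x i) $ k)\<^sup>2) \<le> (\<Sum>i<n. 1)"
  proof (intro sum_mono)
    fix i assume "i \<in> {..<n}"
    then have "\<bar>(?T *v x i) $ k\<bar> \<le> 1"
      using component_le_norm_cart[of "?T *v x i" k] x[of i] norm_orthogonal_matrix_mult(2)[OF W, of "x i"] by simp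
    then show "((?T *v x i) $ k)\<^sup>2 \<le> 1" by (simp only: abs_square_le_1)
  qed
  then show "s $ k \<le> n" unfolding s by simp
qed

text \<open>The rotation varies with the sample, so concentration is available only for the
  coordinates of \<open>x\<close>. Expanding \<open>y\<close> in them leaves entries of
  \<open>W\<close>, bounded by 1, as coefficients.\<close>

lemma rotated_bilinear_le:
  fixes x :: "nat \<Rightarrow> real ^ 'd" and W :: "real ^ 'd ^ 'd"
  assumes W1: "\<And>a b. \<bar>W $ a $ b\<bar> \<le> 1"
    and y: "\<And>k i. y k i = (tp W *v x i) $ k / sqrt n"
  shows "\<bar>\<Sum>i<n. \<Sum>j<n. y k i * y l j * r i j\<bar> \<le> (\<Sum>a\<in>UNIV. \<Sum>b\<in>UNIV. \<bar>\<Sum>i<n. \<Sum>j<n. x i $ a * x j $ b * r i j\<bar>) / n"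
proof -
  have yk: "y k j = (\<Sum>l\<in>UNIV. W $ l $ k * x j $ l) / sqrt n" for j k
    by (simp add: y matrix_vector_mult_def Finite_Cartesian_Product.transpose_def del: transpose_matrix_vector)
  have "y k i * y l j * r i j = (\<Sum>a\<in>UNIV. \<Sum>b\<in>UNIV. W $ a $ k * W $ b $ l * (x i $ a * x j $ b * r i j)) / n" for i j
    unfolding yk times_divide_times_eq real_sqrt_mult_self sum_product
    by (simp add: sum_distrib_right) (simp add: mult_ac)
  then have "(\<Sum>i<n. \<Sum>j<n. y k i * y l j * r i j)
    = (\<Sum>i<n. \<Sum>j<n. \<Sum>a\<in>UNIV. \<Sum>b\<in>UNIV. W $ a $ k * W $ b $ l * (x i $ a * x j $ b * r i j)) / n"
    by (simp only: sum_divide_distrib[symmetric])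
  also have "(\<Sum>i<n. \<Sum>j<n. \<Sum>a\<in>UNIV. \<Sum>b\<in>UNIV. W $ a $ k * W $ b $ l * (x i $ a * x j $ b * r i j))
    = (\<Sum>a\<in>UNIV. \<Sum>b\<in>UNIV. W $ a $ k * W $ b $ l * (\<Sum>i<n. \<Sum>j<n. x i $ a * x j $ b * r i j))"
  proof -
    let ?q = "\<lambda>i j a b. W $ a $ k * W $ b $ l * (x i $ a * x j $ b * r i j)"
    have "(\<Sum>i<n. \<Sum>j<n. \<Sum>a\<in>UNIV. \<Sum>b\<in>UNIV. ?q i j a b) = (\<Sum>i<n. \<Sum>a\<in>UNIV. \<Sum>j<n. \<Sum>b\<in>UNIV. ?q i j a b)"
      by (rule sum.cong[OF refl], rule sum.swap)
    also have "\<dots> = (\<Sum>a\<in>UNIV. \<Sum>i<n. \<Sum>j<n. \<Sum>b\<in>UNIV. ?q i j a b)" by (rule sum.swap)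
    also have "\<dots> = (\<Sum>a\<in>UNIV. \<Sum>i<n. \<Sum>b\<in>UNIV. \<Sum>j<n. ?q i j a b)"
      by (rule sum.cong[OF refl], rule sum.cong[OF refl], rule sum.swap)
    also have "\<dots> = (\<Sum>a\<in>UNIV. \<Sum>b\<in>UNIV. \<Sum>i<n. \<Sum>j<n. ?q i j a b)"
      by (rule sum.cong[OF refl], rule sum.swap)
    finally show ?thesis by (simp only: sum_distrib_left)
  qed
  finally have eq: "(\<Sum>i<n. \<Sum>j<n. y k i * y l j * r i j) =
    (\<Sum>a\<in>UNIV. \<Sum>b\<in>UNIV. W $ a $ k * W $ b $ l * (\<Sum>i<n. \<Sum>j<n. x i $ a * x j $ b * r i j)) / n" .
  have "\<bar>\<Sum>a\<in>UNIV. \<Sum>b\<in>UNIV. W $ a $ k * W $ b $ l * (\<Sum>i<n. \<Sum>j<n. x i $ a * x j $ b * r i j)\<bar>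
    \<le> (\<Sum>a\<in>UNIV. \<Sum>b\<in>UNIV. 1 * 1 * \<bar>\<Sum>i<n. \<Sum>j<n. x i $ a * x j $ b * r i j\<bar>)"
  proof (rule order_trans[OF sum_abs], rule sum_mono, rule order_trans[OF sum_abs], rule sum_mono)
    fix a b
    show "\<bar>W $ a $ k * W $ b $ l * (\<Sum>i<n. \<Sum>j<n. x i $ a * x j $ b * r i j)\<bar>
      \<le> 1 * 1 * \<bar>\<Sum>i<n. \<Sum>j<n. x i $ a * x j $ b * r i j\<bar>"
      unfolding abs_mult using W1 by (intro mult_mono) auto
  qed
  then show ?thesis unfolding eq by (simp add: divide_right_mono)
qed

text \<open>The same expansion for row sums: the factor d counts the coordinates, and the n rows
  cancel the factor 1/n that the squares of the rescaled \<open>y\<close> carry.\<close>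

lemma rotated_rows_le:
  fixes x :: "nat \<Rightarrow> real ^ 'd" and W :: "real ^ 'd ^ 'd"
  assumes W1: "\<And>a b. \<bar>W $ a $ b\<bar> \<le> 1"
    and y: "\<And>k i. y k i = (tp W *v x i) $ k / sqrt n"
    and rows: "\<And>i l. i < n \<Longrightarrow> \<bar>\<Sum>j<n. r i j * x j $ l\<bar> \<le> t" and n: "0 < n"
  shows "(\<Sum>i<n. (\<Sum>j<n. r i j * y k j)\<^sup>2) \<le> (real CARD('d) * t)\<^sup>2"
proof -
  have yk: "y k j = (\<Sum>l\<in>UNIV. W $ l $ k * x j $ l) / sqrt n" for j k
    by (simp add: y matrix_vector_mult_def Finite_Cartesian_Product.transpose_def del: transpose_matrix_vector)
  have "(\<Sum>j<n. r i j * y k j)\<^sup>2 \<le> (real CARD('d) * t)\<^sup>2 / n" if i: "i < n" for i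
  proof -
    have "(\<Sum>j<n. r i j * y k j) = (\<Sum>j<n. \<Sum>l\<in>UNIV. W $ l $ k * (r i j * x j $ l)) / sqrt n"
      unfolding yk by (simp add: sum_distrib_left sum_divide_distrib mult_ac)
    also have "(\<Sum>j<n. \<Sum>l\<in>UNIV. W $ l $ k * (r i j * x j $ l)) = (\<Sum>l\<in>UNIV. W $ l $ k * (\<Sum>j<n. r i j * x j $ l))"
      unfolding sum_distrib_left by (rule sum.swap)
    finally have eq: "(\<Sum>j<n. r i j * y k j) = (\<Sum>l\<in>UNIV. W $ l $ k * (\<Sum>j<n. r i j * x j $ l)) / sqrt n" .
    have "\<bar>\<Sum>l\<in>UNIV. W $ l $ k * (\<Sum>j<n. r i j * x j $ l)\<bar> \<le> (\<Sum>l\<in>(UNIV :: 'd set). 1 * t)"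
    proof (rule order_trans[OF sum_abs], rule sum_mono)
      show "\<bar>W $ l $ k * (\<Sum>j<n. r i j * x j $ l)\<bar> \<le> 1 * t" for l
        unfolding abs_mult using W1 rows[OF i] by (intro mult_mono) auto
    qed
    then have "\<bar>\<Sum>l\<in>UNIV. W $ l $ k * (\<Sum>j<n. r i j * x j $ l)\<bar>\<^sup>2 \<le> (real CARD('d) * t)\<^sup>2"
      by (intro power_mono) auto
    then show ?thesis unfolding eq by (simp add: power_divide divide_right_mono)
  qed
  then have "(\<Sum>i<n. (\<Sum>j<n. r i j * y k j)\<^sup>2) \<le> (\<Sum>i<n. (real CARD('d) * t)\<^sup>2 / n)"
    by (intro sum_mono) auto
  then show ?thesis using n by simp
qed

text \<open>A deterministic statement about one sample point: the almost sure facts appear as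
  hypotheses, and embedding and rotation are any sequences that satisfy the defining
  relations.\<close>

lemma embedding_functional_uniform:
  fixes x Xh :: "nat \<Rightarrow> nat \<Rightarrow> real ^ 'd" and W :: "nat \<Rightarrow> real ^ 'd ^ 'd" and a :: "nat \<Rightarrow> real mat"
    and \<kappa> :: "real ^ 'd \<Rightarrow> real ^ 'd \<Rightarrow> real" and \<Delta> :: "real ^ 'd ^ 'd"
  assumes latent: "latent_space \<Omega>" and pos: "bij_betw pos UNIV {..<CARD('d)}"
    and distinct: "rank \<Delta> = CARD('d)" "card {\<mu>::real. \<exists>v. v \<noteq> 0 \<and> \<Delta> *v v = \<mu> *\<^sub>R v} = CARD('d)"
    and g_cont: "\<And>m. continuous_on UNIV (\<lambda>(x, z). g m x z :: real)"
    and taylor: "\<And>r. \<exists>K\<ge>0. \<forall>a b z. norm a \<le> r \<longrightarrow> norm b \<le> r \<longrightarrow> norm z \<le> r \<longrightarrow>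
       \<bar>\<kappa> b z - \<kappa> a z - (\<Sum>m\<in>UNIV. g m a z * (b - a) $ m)\<bar> \<le> K * (norm (b - a))\<^sup>2"
    and D: "D \<subseteq> \<Omega>" "\<Omega> \<subseteq> closure D"
    and xO: "\<And>n i. 1 \<le> n \<Longrightarrow> i < n \<Longrightarrow> x n i \<in> \<Omega>"
    and adj: "\<And>n. 1 \<le> n \<Longrightarrow> a n \<in> adjacency_matrices n"
    and eig: "\<And>n. 1 \<le> n \<Longrightarrow> is_ordered_eigendecomposition pos (W n) (gram_matrix n (x n))"
    and ase: "\<And>n. CARD('d) \<le> n \<Longrightarrow> is_ase pos n (a n) (Xh n)"
    and sign: "\<And>n. CARD('d) \<le> n \<Longrightarrow> sign_compatible n (Xh n) (x n) (W n)"
    and gram: "\<And>k l. (\<lambda>n. gram_matrix n (x n) $ k $ l / n) \<longlonglongrightarrow> \<Delta> $ k $ l"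
    and cut: "\<forall>\<^sub>F n in sequentially. cut_norm_le n (residual (a n) (x n)) (4 * n powr (3/2))"
    and rows: "\<forall>\<^sub>F n in sequentially. \<forall>i<n. \<forall>l. \<bar>\<Sum>j<n. residual (a n) (x n) i j * x n j $ l\<bar> \<le> 2 * n powr (9/16)"
    and coord: "\<And>k l. (\<lambda>n. (\<Sum>i<n. \<Sum>j<n. x n i $ k * x n j $ l * residual (a n) (x n) i j) / n powr (3/2)) \<longlonglongrightarrow> 0"
    and grad: "\<And>z m l. z \<in> D \<Longrightarrow>
      (\<lambda>n. (\<Sum>i<n. \<Sum>j<n. g m (x n i) z * x n j $ l * residual (a n) (x n) i j) / n powr (3/2)) \<longlonglongrightarrow> 0"
    and \<epsilon>: "0 < \<epsilon>"
  shows "\<forall>\<^sub>F n in sequentially. \<forall>z\<in>\<Omega>. \<bar>1 / sqrt n * (\<Sum>i<n. \<kappa> (W n *v Xh n i) z - \<kappa> (x n i) z)\<bar> \<le> \<epsilon>"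
proof -
  obtain c \<epsilon>\<^sub>0 where c: "0 < c" and \<epsilon>\<^sub>0: "0 < \<epsilon>\<^sub>0" and gap: "\<And>W s G. orthogonal_matrix W \<Longrightarrow>
      W ** (\<chi> k l. if k = l then s $ k else 0) ** tp W = G \<Longrightarrow>
      (\<forall>k l. \<bar>G $ k $ l - \<Delta> $ k $ l\<bar> < \<epsilon>\<^sub>0) \<Longrightarrow>
      (\<forall>k. c \<le> \<bar>s $ k\<bar>) \<and> (\<forall>k l. k \<noteq> l \<longrightarrow> c \<le> \<bar>s $ k - s $ l\<bar>)"
    using eigenvalue_gap[OF distinct] by blast
  have comp: "compact \<Omega>" using latent by (simp add: latent_space_def)
  have norm1: "norm v \<le> 1" if "v \<in> \<Omega>" for v
    using latent that by (auto simp: latent_space_def norm_eq_sqrt_inner)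
  have comp1: "\<bar>v $ k\<bar> \<le> 1" if "v \<in> \<Omega>" for v k
    using component_le_norm_cart[of v k] norm1[OF that] by linarith
  define d where "d = real CARD('d)"
  have d1: "1 \<le> d" by (simp add: d_def Suc_le_eq)
  \<comment> \<open>The 1 covers \<Omega>, and the other summand covers the embedded points, whose d
    entries are at most sqrt (2/c).\<close>
  define rad where "rad = 1 + d * sqrt (2 / c)"
  obtain K where K: "0 \<le> K" "\<And>a b z. norm a \<le> rad \<Longrightarrow> norm b \<le> rad \<Longrightarrow> norm z \<le> rad \<Longrightarrow>
       \<bar>\<kappa> b z - \<kappa> a z - (\<Sum>m\<in>UNIV. g m a z * (b - a) $ m)\<bar> \<le> K * (norm (b - a))\<^sup>2"
    using taylor[of rad] by blast
  have rad1: "1 \<le> rad" using c d1 by (simp add: rad_def)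
  have "\<exists>B. \<forall>p\<in>\<Omega> \<times> \<Omega>. norm (case p of (x, z) \<Rightarrow> g m x z) \<le> B" for m
  proof -
    have "compact ((\<lambda>(x, z). g m x z) ` (\<Omega> \<times> \<Omega>))"
      by (intro compact_continuous_image continuous_on_subset[OF g_cont] compact_Times comp) auto
    then show ?thesis by (auto dest!: compact_imp_bounded simp: bounded_iff)
  qed
  then obtain B where B: "\<And>m p. p \<in> \<Omega> \<times> \<Omega> \<Longrightarrow> norm (case p of (x, z) \<Rightarrow> g m x z) \<le> B m" by metis
  define G where "G = (\<Sum>m\<in>UNIV. \<bar>B m\<bar>)"
  have G0: "0 \<le> G" by (simp add: G_def sum_nonneg)
  have G: "\<bar>g m v z\<bar> \<le> G" if "v \<in> \<Omega>" "z \<in> \<Omega>" for m v z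
  proof -
    have "\<bar>g m v z\<bar> \<le> \<bar>B m\<bar>" using B[of "(v, z)" m] that by auto
    also have "\<dots> \<le> G" unfolding G_def by (rule member_le_sum) auto
    finally show ?thesis .
  qed
  define r where "r n = residual (a n) (x n)" for n
  define U where "U n k l = (\<Sum>i<n. \<Sum>j<n. x n i $ k * x n j $ l * r n i j)" for n k l
  define S where "S n = (\<Sum>k\<in>UNIV. \<Sum>l\<in>UNIV. \<bar>U n k l\<bar>)" for n
  \<comment> \<open>The scales match the noise bounds: (e n)^4 = 16 n^(7/2) exceeds n^2 times the
    cut norm bound 4 n^(3/2), and \<beta> n is d times the row bound 2 n^(9/16).\<close>
  define e where "e n = 2 * real n powr (-1/8)" for n
  define \<beta> where "\<beta> n = 2 * d * real n powr (-7/16)" for n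
  define \<gamma> where "\<gamma> n = S n / (real n)\<^sup>2" for n
  let ?K1 = "first_order_const d c" and ?K2 = "second_order_const d c"
  define \<rho> where "\<rho> n = ?K2 * (\<gamma> n + (\<beta> n)\<^sup>2 + e n * \<beta> n)" for n
  \<comment> \<open>Chosen so that the term d^3 \<tau> / c of the final bound equals \<epsilon> /
    2.\<close>
  define \<tau> where "\<tau> = \<epsilon> * c / (2 * d ^ 3)"
  have \<tau>: "0 < \<tau>" using \<epsilon> c d1 by (simp add: \<tau>_def)
  \<comment> \<open>All remaining terms of the final bound. The absolute value of \<rho> provides
    the nonnegative radius that \<open>embedding_functional_bound\<close> expects.\<close>
  define rest where "rest n = K * sqrt n * (d * (?K1 * \<beta> n)\<^sup>2) + d * d * (G * sqrt n * \<bar>\<rho> n\<bar>)" for n :: nat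
  have "(\<lambda>n. S n / n powr (3/2)) \<longlonglongrightarrow> 0"
  proof -
    have "(\<lambda>n. \<Sum>k\<in>UNIV. \<Sum>l\<in>UNIV. \<bar>U n k l / n powr (3/2)\<bar>) \<longlonglongrightarrow> (\<Sum>k\<in>(UNIV::'d set). \<Sum>l\<in>(UNIV::'d set). \<bar>0\<bar>)"
      unfolding U_def r_def by (intro tendsto_sum tendsto_rabs coord)
    then show ?thesis by (simp add: S_def sum_divide_distrib)
  qed
  moreover have "sqrt n * \<gamma> n = S n / n powr (3/2)" if "1 \<le> n" for n
  proof -
    have "real n powr (3/2) * sqrt n = real n powr (3/2) * real n powr (1/2)" by (simp add: powr_half_sqrt)
    also have "\<dots> = real n powr (3/2 + 1/2)" by (simp only: powr_add)
    also have "\<dots> = (real n)\<^sup>2" using that by simp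
    finally show ?thesis using that by (simp add: \<gamma>_def field_simps)
  qed
  ultimately have g_lim: "(\<lambda>n. sqrt n * \<gamma> n) \<longlonglongrightarrow> 0"
    by (rule_tac Lim_transform_eventually[where f = "\<lambda>n. S n / n powr (3/2)"])
      (auto intro!: eventually_sequentiallyI[of 1])
  \<comment> \<open>Here the exponents meet: \<beta>^2 decays like n^(-7/8) and e \<beta> like
    n^(-9/16), so after multiplication by sqrt n the latter still decays like n^(-1/16).\<close>
  have b_lim: "(\<lambda>n. sqrt n * ((\<beta> n)\<^sup>2 + e n * \<beta> n)) \<longlonglongrightarrow> 0"
    unfolding \<beta>_def e_def using d1 by real_asymp
  have "(\<lambda>n. ?K2 * (sqrt n * \<gamma> n + sqrt n * ((\<beta> n)\<^sup>2 + e n * \<beta> n))) \<longlonglongrightarrow> ?K2 * (0 + 0)"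
    by (intro tendsto_intros g_lim b_lim)
  then have "(\<lambda>n. sqrt n * \<rho> n) \<longlonglongrightarrow> 0" by (simp add: \<rho>_def algebra_simps)
  from tendsto_rabs[OF this] have rho_lim: "(\<lambda>n. sqrt n * \<bar>\<rho> n\<bar>) \<longlonglongrightarrow> 0" by (simp add: abs_mult)
  have b2_lim: "(\<lambda>n. sqrt n * (\<beta> n)\<^sup>2) \<longlonglongrightarrow> 0"
    unfolding \<beta>_def using d1 by real_asymp
  have "(\<lambda>n. K * d * ?K1\<^sup>2 * (sqrt n * (\<beta> n)\<^sup>2) + d * d * G * (sqrt n * \<bar>\<rho> n\<bar>)) \<longlonglongrightarrow> K * d * ?K1\<^sup>2 * 0 + d * d * G * 0"
    by (intro tendsto_intros rho_lim b2_lim)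
  then have rest_lim: "rest \<longlonglongrightarrow> 0" by (simp add: rest_def[abs_def] power_mult_distrib mult_ac)
  have ev_rest: "\<forall>\<^sub>F n in sequentially. rest n < \<epsilon> / 2"
    using \<epsilon> by (intro order_tendstoD(2)[OF rest_lim]) auto
  have ev_e: "\<forall>\<^sub>F n in sequentially. e n < c\<^sup>2 / 20"
  proof -
    have "e \<longlonglongrightarrow> 0" unfolding e_def by real_asymp
    then show ?thesis using c by (intro order_tendstoD(2)) auto
  qed
  have ev_b: "\<forall>\<^sub>F n in sequentially. \<beta> n < 1"
  proof -
    have "\<beta> \<longlonglongrightarrow> 0" unfolding \<beta>_def using d1 by real_asymp
    then show ?thesis by (intro order_tendstoD(2)) auto
  qed
  have "\<forall>\<^sub>F n in sequentially. \<bar>gram_matrix n (x n) $ k $ l / n - \<Delta> $ k $ l\<bar> < \<epsilon>\<^sub>0" for k l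
    using tendstoD[OF gram \<epsilon>\<^sub>0] by (simp add: dist_real_def)
  then have ev_gram: "\<forall>\<^sub>F n in sequentially. \<forall>k l. \<bar>gram_matrix n (x n) $ k $ l / n - \<Delta> $ k $ l\<bar> < \<epsilon>\<^sub>0"
    by (intro eventually_all_finite)
  have "\<forall>\<^sub>F n in sequentially. \<forall>z\<in>\<Omega>. \<bar>\<Sum>i<n. \<Sum>j<n. g m (x n i) z * x n j $ l * r n i j\<bar> \<le> \<tau> * n powr (3/2)" for m l
    unfolding r_def
    by (rule bilinear_uniform[where h = "\<lambda>v. v $ l", OF comp D continuous_on_subset[OF g_cont] xO comp1 grad cut \<tau>]) auto
  then have ev_T: "\<forall>\<^sub>F n in sequentially. \<forall>m l. \<forall>z\<in>\<Omega>. \<bar>\<Sum>i<n. \<Sum>j<n. g m (x n i) z * x n j $ l * r n i j\<bar> \<le> \<tau> * n powr (3/2)"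
    by (intro eventually_all_finite)
  show ?thesis
    using ev_rest ev_e ev_b ev_gram ev_T cut rows eventually_ge_at_top[of "CARD('d)"]
  proof eventually_elim
    case (elim n)
    note rest = elim(1) and e = elim(2) and b = elim(3) and gr = elim(4) and T = elim(5)
      and cut = elim(6)[folded r_def] and rows = elim(7)[folded r_def] and nd = elim(8)
    have n1: "1 \<le> n" using nd zero_less_card_finite[where 'a = 'd] by linarith
    then have n0: "0 < real n" by simp
    obtain s where W: "orthogonal_matrix (W n)"
      and Weig: "W n ** (\<chi> k l. if k = l then s $ k else 0) ** tp (W n) = gram_matrix n (x n)"
      and sdec: "\<And>k l. pos k \<le> pos l \<Longrightarrow> s $ l \<le> s $ k"
      using eig[OF n1] unfolding is_ordered_eigendecomposition_def by blast
    have W1: "\<bar>W n $ p $ q\<bar> \<le> 1" for p q by (rule orthogonal_matrix_entry_le[OF W])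
    define s' where "s' = (\<chi> k. s $ k / n)"
    \<comment> \<open>The gap statement is applied to the rescaled eigenvalues of the Gram matrix
      over n. They are nonnegative, which afterwards removes the absolute value in the lower
      bound.\<close>
    have "(\<forall>k. c \<le> \<bar>s' $ k\<bar>) \<and> (\<forall>k l. k \<noteq> l \<longrightarrow> c \<le> \<bar>s' $ k - s' $ l\<bar>)"
    proof (rule gap[OF W refl], intro allI)
      fix k l
      have "(W n ** (\<chi> k l. if k = l then s' $ k else 0) ** tp (W n)) $ k $ l
        = gram_matrix n (x n) $ k $ l / n"
        unfolding Weig[symmetric] diagonal_conjugation_entry by (simp add: s'_def sum_divide_distrib)
      then show "\<bar>(W n ** (\<chi> k l. if k = l then s' $ k else 0) ** tp (W n)) $ k $ l - \<Delta> $ k $ l\<bar> < \<epsilon>\<^sub>0"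
        using gr by simp
    qed
    moreover have sb: "0 \<le> s $ k" "s $ k \<le> n" for k
      using gram_eigenvalue_bounds[OF W Weig] norm1 xO[OF n1] by blast+
    ultimately have s_ge: "\<And>k. c \<le> s $ k / n" and s_gap: "\<And>k l. k \<noteq> l \<Longrightarrow> c \<le> \<bar>s $ k / n - s $ l / n\<bar>"
      by (auto simp: s'_def)
    have s_le: "s $ k / n \<le> 1" for k using sb(2)[of k] n0 by simp
    define y where "y k i = (tp (W n) *v x n i) $ k / sqrt n" for k i
    have r1: "\<bar>r n i j\<bar> \<le> 1" if "i < n" "j < n" for i j
    proof -
      have "a n $$ (i, j) = 0 \<or> a n $$ (i, j) = 1" using adj[OF n1] that by (auto simp: adjacency_matrices_def)
      moreover have "0 \<le> x n i \<bullet> x n j" "x n i \<bullet> x n j \<le> 1"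
        using latent xO[OF n1 that(1)] xO[OF n1 that(2)] by (auto simp: latent_space_def)
      ultimately show ?thesis by (auto simp: r_def residual_def)
    qed
    have op: "(\<Sum>i<n. (\<Sum>j<n. r n i j * v j)\<^sup>2) \<le> (e n * n)\<^sup>2 * (\<Sum>j<n. (v j)\<^sup>2)" for v
    proof (rule operator_bound_of_signs[OF cut r1])
      have "e n * n = 2 * (real n powr (-1/8) * real n powr 1)" using n0 by (simp add: e_def)
      also have "\<dots> = 2 * real n powr (7/8)" unfolding powr_add[symmetric] by simp
      finally have "(e n * n) ^ 4 = 16 * (real n powr (7/8)) ^ 4" by (simp add: power_mult_distrib)
      also have "(real n powr (7/8)) ^ 4 = (real n powr (7/8)) powr 4" using n0 by simp
      also have "\<dots> = real n powr (7/2)" unfolding powr_powr by simp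
      also have "\<dots> = real n powr (2 + 3/2)" by simp
      also have "\<dots> = (real n)\<^sup>2 * real n powr (3/2)" unfolding powr_add using n0 by simp
      finally show "(real n)\<^sup>2 * (4 * n powr (3/2)) \<le> (e n * n) ^ 4" by simp
    qed
    have bn: "\<beta> n * n = d * (2 * n powr (9/16))"
    proof -
      have "\<beta> n * n = 2 * d * (real n powr (-7/16) * real n powr 1)" using n0 by (simp add: \<beta>_def)
      also have "\<dots> = 2 * d * real n powr (9/16)" unfolding powr_add[symmetric] by simp
      finally show ?thesis by simp
    qed
    have By: "(\<Sum>i<n. (\<Sum>j<n. r n i j * y k j)\<^sup>2) \<le> (\<beta> n * n)\<^sup>2" for k
      unfolding bn unfolding d_def using rows n1 by (intro rotated_rows_le[OF W1 y_def]) auto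
    have yBy: "\<bar>\<Sum>i<n. \<Sum>j<n. y k i * y l j * r n i j\<bar> \<le> \<gamma> n * n" for k l
    proof -
      have "\<bar>\<Sum>i<n. \<Sum>j<n. y k i * y l j * r n i j\<bar> \<le> S n / n"
        using rotated_bilinear_le[OF W1 y_def] unfolding S_def U_def .
      also have "\<dots> = \<gamma> n * n" using n0 by (simp add: \<gamma>_def power2_eq_square)
      finally show ?thesis .
    qed
    have e0: "0 \<le> e n" and b0: "0 \<le> \<beta> n" using d1 by (auto simp: e_def \<beta>_def)
    note E = embedding_expansion[OF pos nd adj[OF n1] ase[OF nd] W Weig sdec sign[OF nd] y_def c s_ge s_le s_gap
        e0 less_imp_le[OF e] op[unfolded r_def] b0 less_imp_le[OF b] By[unfolded r_def] yBy[unfolded r_def],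
        folded r_def d_def]
    have E1: "(\<Sum>i<n. (Xh n i $ k / sqrt n - y k i)\<^sup>2) \<le> (?K1 * \<beta> n)\<^sup>2" for k by (rule E(1))
    have E2: "(\<Sum>i<n. (Xh n i $ k / sqrt n - y k i - (\<Sum>j<n. r n i j * y k j) / s $ k)\<^sup>2)
      \<le> (?K2 * (\<gamma> n + (\<beta> n)\<^sup>2 + e n * \<beta> n))\<^sup>2" for k by (rule E(2))
    have E3: "\<bar>Xh n i $ k\<bar> \<le> sqrt (2 / c)" if "i < n" for i k by (rule E(3)[OF _ _ that])
    show ?case
    proof
      fix z assume z: "z \<in> \<Omega>"
      have "\<bar>1 / sqrt n * (\<Sum>i<n. \<kappa> (W n *v Xh n i) z - \<kappa> (x n i) z)\<bar>
        \<le> K * sqrt n * (d * (?K1 * \<beta> n)\<^sup>2) + d * d * (d * \<tau> / c + G * sqrt n * \<bar>\<rho> n\<bar>)"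
        unfolding d_def
      proof (rule embedding_functional_bound[where g = "\<lambda>m v. g m v z" and s = s and r = "r n" and y = y])
        show "0 < n" using n1 by simp
        show "orthogonal_matrix (W n)" by (rule W)
        show "\<bar>W n $ p $ q\<bar> \<le> 1" for p q by (rule W1)
        show "y k i = (tp (W n) *v x n i) $ k / sqrt n" for k i by (rule y_def)
        show "(\<Sum>i<n. (Xh n i $ k / sqrt n - y k i)\<^sup>2) \<le> (first_order_const (real CARD('d)) c * \<beta> n)\<^sup>2" for k
          using E1[of k] by (simp only: d_def)
        show "(\<Sum>i<n. (Xh n i $ k / sqrt n - y k i - (\<Sum>j<n. r n i j * y k j) / s $ k)\<^sup>2) \<le> \<bar>\<rho> n\<bar>\<^sup>2" for k
          using E2[of k] by (simp only: \<rho>_def power2_abs)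
        show "\<bar>g m (x n i) z\<bar> \<le> G" if "i < n" for m i by (rule G[OF xO[OF n1 that] z])
        show "\<bar>\<Sum>i<n. \<Sum>j<n. g m (x n i) z * x n j $ l * r n i j\<bar> \<le> \<tau> * n powr (3/2)" for m l
          using T z by blast
        show "\<bar>\<kappa> (W n *v Xh n i) z - \<kappa> (x n i) z - (\<Sum>m\<in>UNIV. g m (x n i) z * (W n *v Xh n i - x n i) $ m)\<bar>
          \<le> K * (norm (W n *v Xh n i - x n i))\<^sup>2" if i: "i < n" for i
        proof (rule K(2))
          show "norm (x n i) \<le> rad" using norm1[OF xO[OF n1 i]] rad1 by linarith
          show "norm z \<le> rad" using norm1[OF z] rad1 by linarith
          have "norm (W n *v Xh n i) = norm (Xh n i)" by (rule norm_orthogonal_matrix_mult(1)[OF W])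
          also have "\<dots> \<le> (\<Sum>k\<in>UNIV. \<bar>Xh n i $ k\<bar>)" by (rule norm_le_l1_cart)
          also have "\<dots> \<le> (\<Sum>k\<in>(UNIV :: 'd set). sqrt (2 / c))" by (intro sum_mono E3[OF i])
          also have "\<dots> \<le> rad" by (simp add: rad_def d_def)
          finally show "norm (W n *v Xh n i) \<le> rad" .
        qed
      qed (use c s_ge K(1) G0 in auto)
      also have "\<dots> = d * d * d * \<tau> / c + rest n" by (simp add: rest_def algebra_simps)
      also have "d * d * d * \<tau> / c = \<epsilon> / 2" using c d1 by (simp add: \<tau>_def power3_eq_cube)
      finally show "\<bar>1 / sqrt n * (\<Sum>i<n. \<kappa> (W n *v Xh n i) z - \<kappa> (x n i) z)\<bar> \<le> \<epsilon>" using rest by linarith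
    qed
  qed
qed

section \<open>Almost sure convergence of the supremum\<close>

theorem lemma3:
  fixes \<Omega> :: "(real ^ 'd) set"
    and F :: "(real ^ 'd) measure"
    and \<kappa> :: "real ^ 'd \<Rightarrow> real ^ 'd \<Rightarrow> real"
    and M :: "'w measure"
    and X :: "nat \<Rightarrow> 'w \<Rightarrow> nat \<Rightarrow> real ^ 'd"
    and A :: "nat \<Rightarrow> 'w \<Rightarrow> real mat"
    and Xhat :: "nat \<Rightarrow> 'w \<Rightarrow> nat \<Rightarrow> real ^ 'd"
    and W :: "nat \<Rightarrow> 'w \<Rightarrow> real ^ 'd ^ 'd"
    and pos :: "'d \<Rightarrow> nat"
  assumes "latent_space \<Omega>"
    and "latent_distribution \<Omega> F"
    and "distinct_eigenvalues_condition F"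
    and "pd_kernel \<kappa>"
    and "twice_continuously_differentiable (\<lambda>(x, y). \<kappa> x y)"
    and "prob_space M"
    and "\<And>n. n \<ge> 1 \<Longrightarrow> rdpg n F M (X n) (A n)"
    and "bij_betw pos UNIV {..<CARD('d)}"
    and "\<And>n \<omega>. n \<ge> 1 \<Longrightarrow> \<omega> \<in> space M \<Longrightarrow>
           is_ordered_eigendecomposition pos (W n \<omega>) (gram_matrix n (X n \<omega>))"
    and "\<And>n \<omega>. n \<ge> CARD('d) \<Longrightarrow> \<omega> \<in> space M \<Longrightarrow> is_ase pos n (A n \<omega>) (Xhat n \<omega>)"
    and "\<And>n \<omega>. n \<ge> CARD('d) \<Longrightarrow> \<omega> \<in> space M \<Longrightarrow>
           sign_compatible n (Xhat n \<omega>) (X n \<omega>) (W n \<omega>)"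
  shows "AE \<omega> in M.
    (\<lambda>n. SUP f\<in>feature_class \<kappa> \<Omega>.
       \<bar>1 / sqrt (real n) * (\<Sum>i<n. f (W n \<omega> *v Xhat n \<omega> i) - f (X n \<omega> i))\<bar>) \<longlonglongrightarrow> 0"
proof -
  interpret rdpg_sequence M \<Omega> F X A
    by (rule rdpg_sequence.intro[OF assms(6)], unfold_locales) (use assms(1,2,7) in auto)
  obtain g where g_cont: "\<And>m. continuous_on UNIV (\<lambda>(x, z). g m x z :: real)"
    and taylor: "\<And>r. \<exists>K\<ge>0. \<forall>a b z. norm a \<le> r \<longrightarrow> norm b \<le> r \<longrightarrow> norm z \<le> r \<longrightarrow>
       \<bar>\<kappa> b z - \<kappa> a z - (\<Sum>m\<in>UNIV. g m a z * (b - a) $ m)\<bar> \<le> K * (norm (b - a))\<^sup>2"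
    using twice_continuously_differentiable_taylor[OF assms(5)] by blast
  \<comment> \<open>Countability lets the exceptional null sets of the individual kernel parameters
    be united; density makes these parameters sufficient for all of \<Omega>.\<close>
  obtain D where D: "countable D" "D \<subseteq> \<Omega>" "\<Omega> \<subseteq> closure D" using separable by metis
  have comp: "compact \<Omega>" using latent by (simp add: latent_space_def)
  \<comment> \<open>A distribution cannot be concentrated on the empty set. Nonemptiness is what the
    rules for the conditional supremum require.\<close>
  have ne: "\<Omega> \<noteq> {}"
  proof
    assume "\<Omega> = {}"
    then have "AE x in F. False" using dist by (auto simp: latent_distribution_def)
    moreover have "prob_space F" using dist by (simp add: latent_distribution_def)
    ultimately show False using prob_space.AE_False by blast
  qed
  have g_z: "continuous_on UNIV (\<lambda>x. g m x z)" for m z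
  proof -
    have "continuous_on UNIV (\<lambda>x. (\<lambda>(x, z). g m x z) (x, z))"
      by (rule continuous_on_compose2[OF g_cont]) (auto intro: continuous_intros)
    then show ?thesis by simp
  qed
  have g_bd: "\<exists>B. \<forall>x\<in>\<Omega>. \<bar>g m x z\<bar> \<le> B" for m z
  proof -
    have "compact ((\<lambda>x. g m x z) ` \<Omega>)"
      by (intro compact_continuous_image continuous_on_subset[OF g_z] comp) auto
    then show ?thesis by (auto dest!: compact_imp_bounded simp: bounded_iff)
  qed
  have nth: "(\<lambda>x :: real ^ 'd. x $ l) \<in> borel_measurable borel" for l by measurable
  have grad: "AE \<omega> in M. (\<lambda>n. (\<Sum>i<n. \<Sum>j<n. g m (X n \<omega> i) z * X n \<omega> j $ l * R n \<omega> i j) / n powr (3/2)) \<longlonglongrightarrow> 0" for m z l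
  proof -
    obtain B where "\<forall>x\<in>\<Omega>. \<bar>g m x z\<bar> \<le> B" using g_bd by blast
    then show ?thesis
      by (intro AE_bilinear[where g = "\<lambda>x. g m x z" and h = "\<lambda>x. x $ l" and G = B and H = 1]
          borel_measurable_continuous_onI g_z nth component_le_1) auto
  qed
  have coord: "AE \<omega> in M. (\<lambda>n. (\<Sum>i<n. \<Sum>j<n. X n \<omega> i $ k * X n \<omega> j $ l * R n \<omega> i j) / n powr (3/2)) \<longlonglongrightarrow> 0" for k l
    by (intro AE_bilinear[where g = "\<lambda>x. x $ k" and h = "\<lambda>x. x $ l" and G = 1 and H = 1] nth component_le_1)
  have "AE \<omega> in M. \<forall>z\<in>D. \<forall>m\<in>UNIV. \<forall>l\<in>UNIV.
      (\<lambda>n. (\<Sum>i<n. \<Sum>j<n. g m (X n \<omega> i) z * X n \<omega> j $ l * R n \<omega> i j) / n powr (3/2)) \<longlonglongrightarrow> 0"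
    by (intro AE_ball_countable[THEN iffD2] ballI AE_finite_allI D(1) grad) auto
  moreover have "AE \<omega> in M. \<forall>k\<in>UNIV. \<forall>l\<in>UNIV.
      (\<lambda>n. (\<Sum>i<n. \<Sum>j<n. X n \<omega> i $ k * X n \<omega> j $ l * R n \<omega> i j) / n powr (3/2)) \<longlonglongrightarrow> 0"
    by (intro AE_finite_allI coord) auto
  moreover have "AE \<omega> in M. \<forall>k\<in>UNIV. \<forall>l\<in>UNIV.
      (\<lambda>n. gram_matrix n (X n \<omega>) $ k $ l / n) \<longlonglongrightarrow> second_moment_matrix F $ k $ l"
    by (intro AE_finite_allI AE_gram) auto
  ultimately show ?thesis
    using AE_latent AE_cut_norm AE_rows AE_space
  proof eventually_elim
    case (elim \<omega>)
    let ?v = "\<lambda>n f. \<bar>1 / sqrt (real n) * (\<Sum>i<n. f (W n \<omega> *v Xhat n \<omega> i) - f (X n \<omega> i))\<bar>"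
    have adj: "A n \<omega> \<in> adjacency_matrices n" if "1 \<le> n" for n
      using rdpg_space.A_adj[OF rdpg_space[OF that] elim(7)] .
    have unif: "\<forall>\<^sub>F n in sequentially. \<forall>z\<in>\<Omega>.
        \<bar>1 / sqrt n * (\<Sum>i<n. \<kappa> (W n \<omega> *v Xhat n \<omega> i) z - \<kappa> (X n \<omega> i) z)\<bar> \<le> \<epsilon>" if "0 < \<epsilon>" for \<epsilon>
    proof (rule embedding_functional_uniform[where \<Delta> = "second_moment_matrix F" and a = "\<lambda>n. A n \<omega>" and x = "\<lambda>n. X n \<omega>"
          and D = D and g = g and pos = pos])
      show "rank (second_moment_matrix F) = CARD('d)"
        "card {\<mu>::real. \<exists>v. v \<noteq> 0 \<and> second_moment_matrix F *v v = \<mu> *\<^sub>R v} = CARD('d)"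
        using assms(3) by (auto simp: distinct_eigenvalues_condition_def)
    qed (use assms elim adj D g_cont taylor that in auto)
    show ?case
    proof (rule tendstoI)
      fix \<epsilon> :: real assume "0 < \<epsilon>"
      then have "\<forall>\<^sub>F n in sequentially. \<forall>z\<in>\<Omega>. ?v n (feature_map \<kappa> z) \<le> \<epsilon> / 2"
        using unif[of "\<epsilon> / 2"] by (simp add: feature_map_def)
      then show "\<forall>\<^sub>F n in sequentially. dist (SUP f\<in>feature_class \<kappa> \<Omega>. ?v n f) 0 < \<epsilon>"
      proof eventually_elim
        case (elim n)
        have ne': "feature_class \<kappa> \<Omega> \<noteq> {}" using ne by (simp add: feature_class_def)
        have le: "?v n f \<le> \<epsilon> / 2" if "f \<in> feature_class \<kappa> \<Omega>" for f
          using elim that by (auto simp: feature_class_def)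
        \<comment> \<open>The uniform bound that dominates the supremum also supplies the
          boundedness needed to compare it with a single nonnegative value.\<close>
        have 1: "(SUP f\<in>feature_class \<kappa> \<Omega>. ?v n f) \<le> \<epsilon> / 2" by (rule cSUP_least[OF ne' le])
        obtain f where f: "f \<in> feature_class \<kappa> \<Omega>" using ne' by blast
        have "?v n f \<le> (SUP f\<in>feature_class \<kappa> \<Omega>. ?v n f)"
          by (rule cSUP_upper[OF f]) (rule bdd_aboveI2[OF le])
        then have "0 \<le> (SUP f\<in>feature_class \<kappa> \<Omega>. ?v n f)" by (rule order_trans[OF abs_ge_zero])
        then show ?case using 1 \<open>0 < \<epsilon>\<close> by (simp add: dist_real_def)
      qed
    qed
  qed
qed

end
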